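(* Let $G\in L^\infty_{q\times p}$ and assume the Hankel operator $H:H^2_p\to K^2_q$, $Hf=P_-(Gf)$, satisfies: (C1) $H$ has finite rank; (C2) no maximizing vector of $H$ belongs to $SH^2_p$, and the linear span of the maximizing vectors of $H$ has dimension $p$. Let $\gamma=\|H\|$, $\Delta=\gamma^2I_{\mathcal X}-ZWW^*Z^*$ and $\Xi=\gamma^2I_{\mathcal X}-WW^*$. Then $\Delta$ is invertible and the Nehari problem for $G$ has a unique optimal solution $F\in H^\infty_{q\times p}$. This solution is $F=G_+-\Phi_+$, where $G_+$ is the analytic part of $G$ and $\Phi_+$ is the rational $q\times p$ matrix-valued $H^\infty$ function $\Phi_+(\lambda)=N(\lambda)M(\lambda)^{-1}$ with $N(\lambda)=-\Pi HW^*(I_{\mathcal X}-\lambda Z^* )^{-1}Z^*\Delta^{-1}WE$, $M(\lambda)=I+\lambda E^*W^*(I_{\mathcal X}-\lambda Z^* )^{-1}Z^*\Delta^{-1}WE$. Furthermore $r_{\mathrm{spec}}(Z^*\Delta^{-1}\Xi)<1$, and for $|\lambda|\le1$ the inverse of $M(\lambda)$ is $M(\lambda)^{-1}=I-\lambda E^*W^*(I_{\mathcal X}-\lambda Z^*\Delta^{-1}\Xi)^{-1}Z^*\Delta^{-1}WE$.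
   Context: $L^2_{q\times p},H^2,L^\infty,H^\infty$ spaces of $q\times p$ matrix functions on the unit circle; $K^2=L^2\ominus H^2$; analytic part $G_+\in H^2_{q\times p}$ and co-analytic part $G_-\in K^2_{q\times p}$ with $G=G_++G_-$. $P_-$: orthogonal projection of $L^2_q$ onto $K^2_q$; $S$ forward shift on $H^2_p$; $V$ multiplication by $e^{it}$ on $L^2_q$, $V_-=P_-V|_{K^2_q}$. $\mathcal X=\overline{\operatorname{Im}H}$, $Z=V_-|_{\mathcal X}$, $W:H^2_p\to\mathcal X$, $Wf=Hf$. $E:\mathbb C^p\to H^2_p$ maps $u$ to the constant function $u$; $\Pi:K^2_q\to\mathbb C^q$, $\Pi f=\frac1{2\pi}\int_0^{2\pi}e^{it}f(e^{it})dt$. A maximizing vector of $H$ is a nonzero $h$ with $\|Hh\|=\|H\|\,\|h\|$. The Nehari problem: minimize $\|G-F\|_\infty$ over $F\in H^\infty_{q\times p}$; minimizers are optimal solutions. *)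

theory Defs
  imports "HOL-Analysis.Analysis" "HOL-Library.Function_Algebras"
          "HOL-Computational_Algebra.Polynomial"
begin

text \<open>The unit circle is parametrised by t in [0, 2 pi] (point e^{it}); normalised
  integrals are (1/(2 pi)) times the Lebesgue integral over [0, 2 pi].\<close>

abbreviation circ :: "real measure" where
  "circ \<equiv> lebesgue_on {0..2*pi}"

definition L2fun :: "(real \<Rightarrow> 'a::real_normed_vector) set" where
  "L2fun = {f. f \<in> borel_measurable circ \<and> integrable circ (\<lambda>t. (norm (f t))^2)}"

definition fcoefc :: "(real \<Rightarrow> complex) \<Rightarrow> int \<Rightarrow> complex" where
  "fcoefc f n = complex_of_real (1/(2*pi)) * (LINT t|circ. cis (- (of_int n * t)) * f t)"

definition fcoefv :: "(real \<Rightarrow> complex^('n::finite)) \<Rightarrow> int \<Rightarrow> complex^'n" where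
  "fcoefv f n = (\<chi> i. fcoefc (\<lambda>t. f t $ i) n)"

definition fcoefm :: "(real \<Rightarrow> complex^'p^'q) \<Rightarrow> int \<Rightarrow> complex^'p^'q" where
  "fcoefm G n = (\<chi> i j. fcoefc (\<lambda>t. G t $ i $ j) n)"

definition mnorm :: "complex^'p^'q \<Rightarrow> real" where
  "mnorm A = Sup {norm (A *v x) | x. norm x \<le> 1}"

definition Linf_fun :: "(real \<Rightarrow> complex^'p^'q) set" where
  "Linf_fun = {G. G \<in> borel_measurable circ \<and> (\<exists>C. AE t in circ. mnorm (G t) \<le> C)}"

definition linf_norm :: "(real \<Rightarrow> complex^'p^'q) \<Rightarrow> real" where
  "linf_norm G = Inf {C. AE t in circ. mnorm (G t) \<le> C}"

definition Hinf_fun :: "(real \<Rightarrow> complex^'p^'q) set" where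
  "Hinf_fun = {F \<in> Linf_fun. \<forall>n<0. fcoefm F n = 0}"

definition nehari_optimal :: "(real \<Rightarrow> complex^'p^'q) \<Rightarrow> (real \<Rightarrow> complex^'p^'q) \<Rightarrow> bool" where
  "nehari_optimal G F \<longleftrightarrow> F \<in> Hinf_fun \<and>
     (\<forall>F' \<in> Hinf_fun. linf_norm (\<lambda>t. G t - F t) \<le> linf_norm (\<lambda>t. G t - F' t))"

definition is_analytic_part :: "(real \<Rightarrow> complex^'p^'q) \<Rightarrow> (real \<Rightarrow> complex^'p^'q) \<Rightarrow> bool" where
  "is_analytic_part G g \<longleftrightarrow> g \<in> L2fun \<and>
     (\<forall>n. fcoefm g n = (if n \<ge> 0 then fcoefm G n else 0))"

section \<open>L2 via Fourier coefficients (Plancherel), H2, K2\<close>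

type_synonym 'n seq = "int \<Rightarrow> complex^'n"

definition l2 :: "('n::finite) seq set" where
  "l2 = {c. (\<lambda>n. (norm (c n))^2) summable_on UNIV}"

definition H2seq :: "('n::finite) seq set" where
  "H2seq = {c \<in> l2. \<forall>n<0. c n = 0}"

definition K2seq :: "('n::finite) seq set" where
  "K2seq = {c \<in> l2. \<forall>n\<ge>0. c n = 0}"

definition lnorm :: "('n::finite) seq \<Rightarrow> real" where
  "lnorm c = sqrt (\<Sum>\<^sub>\<infinity>n. (norm (c n))^2)"

definition iprod :: "('n::finite) seq \<Rightarrow> 'n seq \<Rightarrow> complex" where
  "iprod c d = (\<Sum>\<^sub>\<infinity>n. (\<Sum>i\<in>UNIV. c n $ i * cnj (d n $ i)))"

definition cscale :: "complex \<Rightarrow> ('n::finite) seq \<Rightarrow> 'n seq" where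
  "cscale a c = (\<lambda>n. a *s c n)"

definition hankel :: "(real \<Rightarrow> complex^'p^'q) \<Rightarrow> 'p seq \<Rightarrow> 'q seq" where
  "hankel G c = (let f = (SOME f. f \<in> L2fun \<and> fcoefv f = c)
                 in (\<lambda>n. if n < 0 then fcoefv (\<lambda>t. G t *v f t) n else 0))"

definition opnorm :: "('p::finite) seq set \<Rightarrow> ('p seq \<Rightarrow> ('q::finite) seq) \<Rightarrow> real" where
  "opnorm U A = Sup {lnorm (A c) | c. c \<in> U \<and> lnorm c \<le> 1}"

definition gam :: "(real \<Rightarrow> complex^'p^'q) \<Rightarrow> real" where
  "gam G = opnorm H2seq (hankel G)"

definition maximizing_vectors :: "(real \<Rightarrow> complex^'p^'q) \<Rightarrow> 'p seq set" where
  "maximizing_vectors G =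
     {h \<in> H2seq. h \<noteq> 0 \<and> lnorm (hankel G h) = gam G * lnorm h}"

definition shiftS :: "('n::finite) seq \<Rightarrow> 'n seq" where
  "shiftS c = (\<lambda>n. c (n - 1))"

definition Vminus :: "('n::finite) seq \<Rightarrow> 'n seq" where
  "Vminus c = (\<lambda>n. if n < 0 then c (n - 1) else 0)"

definition finite_rank :: "('p::finite) seq set \<Rightarrow> ('p seq \<Rightarrow> ('q::finite) seq) \<Rightarrow> bool" where
  "finite_rank U A \<longleftrightarrow> (\<exists>B. finite B \<and> A ` U \<subseteq> module.span cscale B)"

definition Xsp :: "(real \<Rightarrow> complex^'p^'q) \<Rightarrow> 'q seq set" where
  "Xsp G = {d \<in> l2. \<forall>e>0. \<exists>c\<in>H2seq. lnorm (\<lambda>n. hankel G c n - d n) < e}"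

definition adjoint :: "('p::finite) seq set \<Rightarrow> ('q::finite) seq set \<Rightarrow> ('p seq \<Rightarrow> 'q seq) \<Rightarrow> 'q seq \<Rightarrow> 'p seq" where
  "adjoint U Y A = (\<lambda>y. THE u. u \<in> U \<and> (\<forall>v\<in>U. iprod (A v) y = iprod v u))"

definition Einj :: "complex^'n \<Rightarrow> ('n::finite) seq" where
  "Einj u = (\<lambda>n. if n = 0 then u else 0)"

definition Estar :: "('n::finite) seq \<Rightarrow> complex^'n" where
  "Estar c = c 0"

text \<open>Pi f = (1/2pi) int e^{it} f(e^{it}) dt, i.e. the Fourier coefficient of index -1.\<close>
definition PiOp :: "('n::finite) seq \<Rightarrow> complex^'n" where
  "PiOp c = c (-1)"

definition spectrum_on :: "('n::finite) seq set \<Rightarrow> ('n seq \<Rightarrow> 'n seq) \<Rightarrow> complex set" where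
  "spectrum_on X T = {\<mu>. \<not> bij_betw (\<lambda>x n. \<mu> *s x n - T x n) X X}"

definition spec_radius :: "('n::finite) seq set \<Rightarrow> ('n seq \<Rightarrow> 'n seq) \<Rightarrow> real" where
  "spec_radius X T = Sup (cmod ` spectrum_on X T)"

definition Wst :: "(real \<Rightarrow> complex^'p^'q) \<Rightarrow> 'q seq \<Rightarrow> 'p seq" where
  "Wst G = adjoint H2seq (Xsp G) (hankel G)"

definition Zst :: "(real \<Rightarrow> complex^'p^'q) \<Rightarrow> 'q seq \<Rightarrow> 'q seq" where
  "Zst G = adjoint (Xsp G) (Xsp G) Vminus"

definition Delta :: "(real \<Rightarrow> complex^'p^'q) \<Rightarrow> 'q seq \<Rightarrow> 'q seq" where
  "Delta G x = (\<lambda>n. complex_of_real ((gam G)^2) *s x n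
                    - Vminus (hankel G (Wst G (Zst G x))) n)"

definition Xi :: "(real \<Rightarrow> complex^'p^'q) \<Rightarrow> 'q seq \<Rightarrow> 'q seq" where
  "Xi G x = (\<lambda>n. complex_of_real ((gam G)^2) *s x n - hankel G (Wst G x) n)"

definition Delta_inv :: "(real \<Rightarrow> complex^'p^'q) \<Rightarrow> 'q seq \<Rightarrow> 'q seq" where
  "Delta_inv G = the_inv_into (Xsp G) (Delta G)"

definition resolv :: "('n::finite) seq set \<Rightarrow> ('n seq \<Rightarrow> 'n seq) \<Rightarrow> complex \<Rightarrow> 'n seq \<Rightarrow> 'n seq" where
  "resolv X T z = the_inv_into X (\<lambda>x n. x n - z *s T x n)"

definition Nmat :: "(real \<Rightarrow> complex^'p^'q) \<Rightarrow> complex \<Rightarrow> complex^'p^'q" where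
  "Nmat G z = matrix (\<lambda>u. - PiOp (hankel G (Wst G (resolv (Xsp G) (Zst G) z
                    (Zst G (Delta_inv G (hankel G (Einj u))))))))"

definition Mmat :: "(real \<Rightarrow> complex^'p^'q) \<Rightarrow> complex \<Rightarrow> complex^'p^'p" where
  "Mmat G z = mat 1 + matrix (\<lambda>u. z *s Estar (Wst G (resolv (Xsp G) (Zst G) z
                    (Zst G (Delta_inv G (hankel G (Einj u)))))))"

definition Phi_plus :: "(real \<Rightarrow> complex^'p^'q) \<Rightarrow> complex \<Rightarrow> complex^'p^'q" where
  "Phi_plus G z = Nmat G z ** matrix_inv (Mmat G z)"

definition Top :: "(real \<Rightarrow> complex^'p^'q) \<Rightarrow> 'q seq \<Rightarrow> 'q seq" where
  "Top G x = Zst G (Delta_inv G (Xi G x))"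

definition Minv_formula :: "(real \<Rightarrow> complex^'p^'q) \<Rightarrow> complex \<Rightarrow> complex^'p^'p" where
  "Minv_formula G z = mat 1 - matrix (\<lambda>u. z *s Estar (Wst G (resolv (Xsp G) (Top G) z
                    (Zst G (Delta_inv G (hankel G (Einj u)))))))"

end

theory Submission
  imports Defs "HOL-Computational_Algebra.Fundamental_Theorem_Algebra"
begin

text \<open>Let \<open>K\<close> be the space of solutions of \<open>H\<^sup>*H k = \<gamma>\<^sup>2 k\<close>, i.e. the maximizing vectors together with \<open>0\<close>.
  By (C2), evaluation at the origin maps \<open>K\<close> bijectively onto \<open>\<complex>\<^sup>p\<close>, and the element of \<open>K\<close> with value \<open>u\<close> is
  \<open>M(\<cdot>) u\<close>. The identity \<open>H\<^sup>*H k = \<gamma>\<^sup>2 k\<close> and the shift intertwining \<open>H S = V\<^sub>- H\<close> show that \<open>\<langle>H k, H l\<rangle>\<close> and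
  \<open>\<gamma>\<^sup>2 \<langle>k, l\<rangle>\<close> have the same Fourier coefficients for \<open>k, l \<in> K\<close>. So if \<open>B\<close> collects the functions
  \<open>H M(\<cdot>) u\<close>, then \<open>\<Phi> = B M\<inverse>\<close> is \<open>\<gamma>\<close> times an isometry almost everywhere, \<open>G - \<Phi>\<close> is analytic because
  \<open>G M - B\<close> and \<open>M\<inverse>\<close> are, and \<open>G - \<Phi>\<close> attains the lower bound \<open>\<gamma> \<le> \<parallel>G - F\<parallel>\<close> valid for all \<open>F \<in> H\<^sup>\<infinity>\<close>.
  If \<open>F\<close> is any optimal solution and \<open>k \<in> K\<close>, then \<open>\<parallel>(G - F) k\<parallel> \<le> \<gamma> \<parallel>k\<parallel> = \<parallel>H k\<parallel>\<close> forces \<open>(G - F) k = H k\<close>, hence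
  \<open>G - F = \<Phi>\<close>.\<close>

section \<open>Linear maps of finite-dimensional subspaces\<close>

text \<open>Why the state formulas describe \<open>K\<close>: if \<open>k\<close> lies in
  \<open>K\<close> and has value \<open>u\<close> at the origin, then
  \<open>Ws (H k) = cscale g2 k\<close> and \<open>Ws (Zs y) = Sst (Ws y)\<close> give
  \<open>Delta G (H k) = cscale g2 (H (Einj u))\<close>. So \<open>Delta_inv G (H (Einj u))\<close>
  is \<open>H k\<close> divided by \<gamma> squared, and \<open>Ws\<close> after powers of
  \<open>Zs\<close> reads off the Fourier coefficients of \<open>k\<close> one by one. Dually,
  \<open>N\<close> is minus the analytic part of the co-analytic part of \<open>G\<close> times
  \<open>M\<close>. The obstacle is that \<open>M\<close> must have an analytic inverse, which is
  the bound on the spectral radius of \<open>Top G\<close>. The form of \<open>Xi G\<close> is only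
  semidefinite, with \<open>H k\<close> in its kernel for \<open>k\<close> in \<open>K\<close>, so a
  norm estimate leaves eigenvalues on the unit circle open; these need a separate argument with
  autocorrelations. By (C1) the space \<open>X\<close> is finite-dimensional, so spectra are sets of
  eigenvalues and every transfer function is rational. Since \<open>hankel\<close> picks a function
  with prescribed Fourier coefficients, Riesz-Fischer and uniqueness of coefficients underlie
  everything.\<close>

locale complex_vector_space = vector_space scale
  for scale :: "complex \<Rightarrow> 'v::ab_group_add \<Rightarrow> 'v" (infixr \<open>\<odot>\<close> 75)
begin

definition lin_on :: "'v set \<Rightarrow> ('v \<Rightarrow> 'v) \<Rightarrow> bool" where
  "lin_on X A \<longleftrightarrow> A ` X \<subseteq> X \<and> (\<forall>x\<in>X. \<forall>y\<in>X. A (x + y) = A x + A y) \<and> (\<forall>c. \<forall>x\<in>X. A (c \<odot> x) = c \<odot> A x)"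

definition eigvals :: "'v set \<Rightarrow> ('v \<Rightarrow> 'v) \<Rightarrow> complex set" where
  "eigvals X A = {\<mu>. \<exists>v\<in>X. v \<noteq> 0 \<and> A v = \<mu> \<odot> v}"

definition finite_dim :: "'v set \<Rightarrow> bool" where
  "finite_dim X \<longleftrightarrow> subspace X \<and> (\<exists>B. finite B \<and> X \<subseteq> span B)"

text \<open>Applies the product of the factors \<open>A - \<mu>\<close> over the list: an
  annihilating polynomial kept in factored form, so that its roots stay visible.\<close>

primrec kill :: "('v \<Rightarrow> 'v) \<Rightarrow> complex list \<Rightarrow> 'v \<Rightarrow> 'v" where
  "kill A [] y = y"
| "kill A (\<mu> # \<mu>s) y = kill A \<mu>s (A y - \<mu> \<odot> y)"

lemma lin_onD:
  assumes "lin_on X A"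
  shows "x \<in> X \<Longrightarrow> A x \<in> X" "x \<in> X \<Longrightarrow> y \<in> X \<Longrightarrow> A (x + y) = A x + A y"
    "x \<in> X \<Longrightarrow> A (c \<odot> x) = c \<odot> A x"
  using assms unfolding lin_on_def by blast+

lemma lin_on_subset: "lin_on X A \<Longrightarrow> Y \<subseteq> X \<Longrightarrow> A ` Y \<subseteq> Y \<Longrightarrow> lin_on Y A"
  unfolding lin_on_def by blast

lemma lin_on_diff:
  assumes "lin_on X A" "subspace X" "x \<in> X" "y \<in> X"
  shows "A (x - y) = A x - A y"
proof -
  have "A ((x - y) + y) = A (x - y) + A y" using assms by (intro lin_onD(2)[of X] subspace_diff)
  then show ?thesis by simp
qed

lemma lin_on_zero: "lin_on X A \<Longrightarrow> subspace X \<Longrightarrow> A 0 = 0"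
  using lin_on_diff[of X A 0 0] subspace_0 by simp

lemma lin_on_funpow: "lin_on X A \<Longrightarrow> x \<in> X \<Longrightarrow> (A ^^ n) x \<in> X"
  by (induction n) (auto intro: lin_onD)

lemma lin_on_shifted:
  assumes A: "lin_on X A" and X: "subspace X"
  shows "lin_on X (\<lambda>x. A x - \<mu> \<odot> x)"
  unfolding lin_on_def
proof (intro conjI ballI allI)
  show "(\<lambda>x. A x - \<mu> \<odot> x) ` X \<subseteq> X"
    using lin_onD(1)[OF A] X by (auto intro: subspace_diff subspace_scale)
qed (auto simp: lin_onD[OF A] algebra_simps scale_right_diff_distrib scale_left_commute)

lemma lin_on_scaled_diff:
  assumes A: "lin_on X A" and X: "subspace X"
  shows "lin_on X (\<lambda>x. a \<odot> x - A x)"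
  unfolding lin_on_def
proof (intro conjI ballI allI)
  show "(\<lambda>x. a \<odot> x - A x) ` X \<subseteq> X"
    using lin_onD(1)[OF A] X by (auto intro: subspace_diff subspace_scale)
qed (auto simp: lin_onD[OF A] algebra_simps scale_right_diff_distrib scale_left_commute)

lemma lin_on_compose: "lin_on X A \<Longrightarrow> lin_on X B \<Longrightarrow> lin_on X (\<lambda>x. A (B x))"
  unfolding lin_on_def by (auto simp: image_subset_iff)

lemma lin_on_resolvent:
  assumes A: "lin_on X A" and X: "subspace X"
  shows "lin_on X (\<lambda>x. x - z \<odot> A x)"
  unfolding lin_on_def
proof (intro conjI ballI allI)
  show "(\<lambda>x. x - z \<odot> A x) ` X \<subseteq> X"
    using lin_onD(1)[OF A] X by (auto intro: subspace_diff subspace_scale)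
qed (auto simp: lin_onD[OF A] algebra_simps scale_right_diff_distrib scale_left_commute)

lemma lin_on_the_inv:
  assumes A: "lin_on X A" and S: "subspace X" and b: "bij_betw A X X"
  shows "lin_on X (the_inv_into X A)"
proof -
  have inj: "inj_on A X" and im: "A ` X = X" using b by (auto simp: bij_betw_def)
  have iX: "the_inv_into X A x \<in> X" if "x \<in> X" for x using the_inv_into_into[OF inj] im that by blast
  have Ai: "A (the_inv_into X A x) = x" if "x \<in> X" for x using f_the_inv_into_f[OF inj] im that by blast
  show ?thesis
    unfolding lin_on_def
  proof (intro conjI ballI allI)
    fix x y assume x: "x \<in> X" and y: "y \<in> X"
    show "the_inv_into X A (x + y) = the_inv_into X A x + the_inv_into X A y"
      using x y by (intro the_inv_into_f_eq[OF inj]) (auto simp: lin_onD(2)[OF A] iX Ai intro: subspace_add[OF S])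
  next
    fix x c assume x: "x \<in> X"
    show "the_inv_into X A (c \<odot> x) = c \<odot> the_inv_into X A x"
      using x by (intro the_inv_into_f_eq[OF inj]) (auto simp: lin_onD(3)[OF A] iX Ai intro: subspace_scale[OF S])
  qed (use iX in auto)
qed

text \<open>The vector \<open>p(A) x\<close>, computed by Horner's scheme.\<close>

definition pact :: "('v \<Rightarrow> 'v) \<Rightarrow> complex poly \<Rightarrow> 'v \<Rightarrow> 'v" where
  "pact A p x = fold_coeffs (\<lambda>a y. a \<odot> x + A y) p 0"

text \<open>In finite dimension the orbit of a nonzero \<open>x\<close> is linearly dependent, so
  some nonzero polynomial in \<open>A\<close> annihilates \<open>x\<close>. Splitting off complex
  roots one at a time must produce an eigenvector before the polynomial becomes constant.\<close>

lemma ex_eigenvalue: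
  assumes X: "finite_dim X" and A: "lin_on X A" and ne: "X \<noteq> {0}"
  shows "eigvals X A \<noteq> {}"
proof -
  have S: "subspace X" using X by (simp add: finite_dim_def)
  obtain x where x: "x \<in> X" "x \<noteq> 0" using ne subspace_0[OF S] by blast
  have A0: "A 0 = 0" by (rule lin_on_zero[OF A S])
  have pact_0: "pact A 0 x = 0" by (simp add: pact_def)
  have pact_pCons: "pact A (pCons a p) x = a \<odot> x + A (pact A p x)" for a p
    by (cases "a = 0 \<and> p = 0") (auto simp: pact_def A0 fold_coeffs_pCons_coeff_not_0_eq fold_coeffs_pCons_not_0_0_eq)
  have pact_X: "pact A p x \<in> X" for p
    by (induction p) (auto simp: pact_0 pact_pCons S x intro!: subspace_add subspace_scale subspace_0 lin_onD(1)[OF A])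
  have pact_add: "pact A (p + q) x = pact A p x + pact A q x" for p q
    by (induction p q rule: poly_induct2)
       (auto simp: pact_0 pact_pCons pact_X lin_onD(2)[OF A] scale_left_distrib algebra_simps)
  have pact_smult: "pact A (smult c p) x = c \<odot> pact A p x" for c p
    by (induction p) (auto simp: pact_0 pact_pCons pact_X lin_onD(3)[OF A] scale_right_distrib)
  have pact_monom: "pact A (monom 1 k) x = (A ^^ k) x" for k
    by (induction k) (auto simp: pact_pCons pact_0 monom_0 monom_Suc A0)
  obtain B where B: "finite B" "X \<subseteq> span B" using X by (auto simp: finite_dim_def)
  define f where "f k = (A ^^ k) x" for k
  have fX: "f k \<in> X" for k unfolding f_def by (rule lin_on_funpow[OF A x(1)])
  have "\<exists>n. f n \<in> span (f ` {..<n})"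
  proof (rule ccontr)
    assume "\<not> ?thesis"
    then have no: "f n \<notin> span (f ` {..<n})" for n by blast
    have ind: "independent (f ` {..<n}) \<and> card (f ` {..<n}) = n" for n
    proof (induction n)
      case (Suc n)
      have "f n \<notin> f ` {..<n}" using no[of n] span_base[of "f n"] by metis
      then show ?case using Suc no[of n] by (simp add: lessThan_Suc independent_insertI)
    qed (simp add: independent_empty)
    have "f ` {..<Suc (card B)} \<subseteq> span B" using fX B by blast
    then have "card (f ` {..<Suc (card B)}) \<le> card B"
      using independent_span_bound[OF B(1)] ind by blast
    then show False using ind[of "Suc (card B)"] by simp
  qed
  then obtain n where n: "f n \<in> span (f ` {..<n})" by blast
  \<comment> \<open>The degree bound on \<open>q\<close> makes the leading coefficient of
    \<open>monom 1 n - q\<close> equal to 1, so the annihilating polynomial is nonzero.\<close>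
  have "\<exists>q. (q = 0 \<or> degree q < n) \<and> f n = pact A q x"
    using n
  proof (induction rule: span_induct)
    case base
    let ?S = "{v. \<exists>q. (q = 0 \<or> degree q < n) \<and> v = pact A q x}"
    show "subspace ?S"
    proof (rule subspaceI)
      show "0 \<in> ?S" using pact_0 by force
      fix v w assume "v \<in> ?S" "w \<in> ?S"
      then obtain p q where "p = 0 \<or> degree p < n" "v = pact A p x" "q = 0 \<or> degree q < n" "w = pact A q x"
        by blast
      then show "v + w \<in> ?S"
        using pact_add[of p q] degree_add_less[of p n q] by (intro CollectI exI[of _ "p + q"]) auto
    next
      fix c v assume "v \<in> ?S"
      then obtain p where "p = 0 \<or> degree p < n" "v = pact A p x" by blast
      then show "c \<odot> v \<in> ?S"
        using pact_smult[of c p] by (intro CollectI exI[of _ "smult c p"]) auto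
    qed
  next
    case (step v)
    then obtain k where "k < n" "v = f k" by blast
    then show ?case using pact_monom[of k] by (intro exI[of _ "monom 1 k"]) (auto simp: f_def degree_monom_eq)
  qed
  then obtain q where q: "q = 0 \<or> degree q < n" "f n = pact A q x" by blast
  let ?p = "monom 1 n + smult (- 1) q"
  have p0: "pact A ?p x = 0"
    unfolding pact_add pact_smult pact_monom using q(2) by (simp add: f_def)
  have "coeff ?p n = 1" using q(1) by (auto simp: coeff_eq_0)
  then have "?p \<noteq> 0" by (metis coeff_0 zero_neq_one)
  \<comment> \<open>Write \<open>p\<close> as \<open>[:- \<mu>, 1:] * q\<close>. Either
    \<open>pact A q x\<close> is an eigenvector for \<mu>, or \<open>q\<close> annihilates
    \<open>x\<close> as well and has smaller degree.\<close>
  have "p \<noteq> 0 \<Longrightarrow> pact A p x = 0 \<Longrightarrow> eigvals X A \<noteq> {}" for p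
  proof (induction "degree p" arbitrary: p rule: less_induct)
    case less
    show ?case
    proof (cases "degree p = 0")
      case True
      then obtain a where "p = [:a:]" by (rule degree_eq_zeroE)
      then show ?thesis using less.prems x by (auto simp: pact_pCons pact_0 A0)
    next
      case False
      then have "\<not> constant (poly p)" by (simp add: constant_degree)
      then obtain \<mu> where "poly p \<mu> = 0" using fundamental_theorem_of_algebra by blast
      then obtain q where q: "p = [:- \<mu>, 1:] * q" by (metis dvdE poly_eq_0_iff_dvd)
      have "q \<noteq> 0" using q less.prems by auto
      have deg: "degree q < degree p"
        using \<open>q \<noteq> 0\<close> unfolding q by (subst degree_mult_eq) auto
      have "pact A p x = A (pact A q x) - \<mu> \<odot> pact A q x"
      proof -
        have "p = smult (- \<mu>) q + pCons 0 q" unfolding q by simp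
        then show ?thesis by (simp only: pact_add pact_smult pact_pCons) simp
      qed
      then have *: "A (pact A q x) = \<mu> \<odot> pact A q x" using less.prems by simp
      show ?thesis
      proof (cases "pact A q x = 0")
        case True
        then show ?thesis using less.hyps[OF deg \<open>q \<noteq> 0\<close>] by simp
      next
        case False
        then show ?thesis using * pact_X by (auto simp: eigvals_def)
      qed
    qed
  qed
  then show ?thesis using p0 \<open>?p \<noteq> 0\<close> by blast
qed

text \<open>Induction on a bound for the dimension: for an eigenvector \<open>v\<close> with
  eigenvalue \<mu>, the image of \<open>A - \<mu>\<close> is invariant and loses one dimension. That
  all entries of the list are eigenvalues is what later carries stability over to the
  recursion.\<close>

lemma ex_kill:
  assumes X: "finite_dim X" and A: "lin_on X A"
  shows "\<exists>\<mu>s. set \<mu>s \<subseteq> eigvals X A \<and> (\<forall>y\<in>X. kill A \<mu>s y = 0)"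
proof -
  have "\<lbrakk>finite B; card B \<le> n; Y \<subseteq> span B; subspace Y; Y \<subseteq> X; lin_on Y A\<rbrakk> \<Longrightarrow>
     \<exists>\<mu>s. set \<mu>s \<subseteq> eigvals X A \<and> (\<forall>y\<in>Y. kill A \<mu>s y = 0)" for B n Y
  proof (induction n arbitrary: B Y)
    case 0
    then have "Y \<subseteq> {0}" by simp
    then show ?case by (intro exI[of _ "[]"]) auto
  next
    case (Suc n)
    show ?case
    proof (cases "Y = {0}")
      case True
      then show ?thesis by (intro exI[of _ "[]"]) auto
    next
      case False
      have fY: "finite_dim Y" using Suc.prems by (auto simp: finite_dim_def)
      obtain \<mu> v where v: "v \<in> Y" "v \<noteq> 0" "A v = \<mu> \<odot> v"
        using ex_eigenvalue[OF fY Suc.prems(6) False] by (auto simp: eigvals_def)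
      let ?D = "\<lambda>y. A y - \<mu> \<odot> y"
      have D: "lin_on Y ?D" by (rule lin_on_shifted[OF Suc.prems(6,4)])
      \<comment> \<open>A basis through \<open>v\<close>: since \<open>A - \<mu>\<close> sends
        \<open>v\<close> to 0, the images of the remaining basis vectors already span the
        image.\<close>
      obtain C where C: "{v} \<subseteq> C" "C \<subseteq> Y" "independent C" "Y \<subseteq> span C"
        using maximal_independent_subset_extend[of "{v}" Y] v by auto
      have fC: "finite C" "card C \<le> card B"
        using independent_span_bound[OF Suc.prems(1) C(3)] C(2) Suc.prems(3) by auto
      have sub: "?D y \<in> span (?D ` (C - {v}))" if "y \<in> Y" for y
      proof -
        have "y \<in> span C" using that C by blast
        then have "y \<in> Y \<and> ?D y \<in> span (?D ` (C - {v}))"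
        proof (induction rule: span_induct)
          case base
          show "subspace {y. y \<in> Y \<and> ?D y \<in> span (?D ` (C - {v}))}"
          proof (rule subspaceI)
            show "0 \<in> {y. y \<in> Y \<and> ?D y \<in> span (?D ` (C - {v}))}"
              using lin_on_zero[OF D Suc.prems(4)] subspace_0[OF Suc.prems(4)] span_zero by simp
          next
            fix a b assume "a \<in> {y. y \<in> Y \<and> ?D y \<in> span (?D ` (C - {v}))}"
              "b \<in> {y. y \<in> Y \<and> ?D y \<in> span (?D ` (C - {v}))}"
            then show "a + b \<in> {y. y \<in> Y \<and> ?D y \<in> span (?D ` (C - {v}))}"
              using lin_onD(2)[OF D, of a b] subspace_add[OF Suc.prems(4), of a b] span_add by fastforce
          next
            fix c a assume "a \<in> {y. y \<in> Y \<and> ?D y \<in> span (?D ` (C - {v}))}"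
            then show "c \<odot> a \<in> {y. y \<in> Y \<and> ?D y \<in> span (?D ` (C - {v}))}"
              using lin_onD(3)[OF D, of a c] subspace_scale[OF Suc.prems(4), of a c] span_scale by fastforce
          qed
        next
          case (step u)
          then show ?case using C(2) v(3) span_zero by (cases "u = v") (auto intro: span_base)
        qed
        then show ?thesis by blast
      qed
      have "\<exists>\<mu>s. set \<mu>s \<subseteq> eigvals X A \<and> (\<forall>y\<in>?D ` Y. kill A \<mu>s y = 0)"
      proof (rule Suc.IH)
        show "finite (?D ` (C - {v}))" using fC by simp
        have "card (?D ` (C - {v})) \<le> card (C - {v})" using fC by (intro card_image_le) simp
        also have "\<dots> = card C - 1" using C(1) fC by simp
        finally show "card (?D ` (C - {v})) \<le> n" using fC Suc.prems(2) by simp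
        show "?D ` Y \<subseteq> span (?D ` (C - {v}))" using sub by blast
        show sD: "subspace (?D ` Y)"
        proof (rule subspaceI)
          show "0 \<in> ?D ` Y"
            using lin_on_zero[OF D Suc.prems(4)] subspace_0[OF Suc.prems(4)] by (metis (mono_tags) image_eqI)
        next
          fix a b assume "a \<in> ?D ` Y" "b \<in> ?D ` Y"
          then obtain a' b' where "a' \<in> Y" "b' \<in> Y" "a = ?D a'" "b = ?D b'" by blast
          then show "a + b \<in> ?D ` Y"
            using lin_onD(2)[OF D, of a' b'] subspace_add[OF Suc.prems(4), of a' b']
            by (intro image_eqI[of _ _ "a' + b'"]) auto
        next
          fix c a assume "a \<in> ?D ` Y"
          then obtain a' where "a' \<in> Y" "a = ?D a'" by blast
          then show "c \<odot> a \<in> ?D ` Y"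
            using lin_onD(3)[OF D, of a' c] subspace_scale[OF Suc.prems(4), of a' c]
            by (intro image_eqI[of _ _ "c \<odot> a'"]) auto
        qed
        have DY: "?D ` Y \<subseteq> Y" using D by (simp add: lin_on_def)
        then show "?D ` Y \<subseteq> X" using Suc.prems by blast
        have AD: "A (?D y) = ?D (A y)" if "y \<in> Y" for y
          using that lin_on_diff[OF Suc.prems(6,4), of "A y" "\<mu> \<odot> y"] lin_onD[OF Suc.prems(6)]
            subspace_scale[OF Suc.prems(4)] by simp
        show "lin_on (?D ` Y) A"
          using AD lin_onD(1)[OF Suc.prems(6)] by (intro lin_on_subset[OF Suc.prems(6) DY]) auto
      qed
      then obtain \<mu>s where \<mu>s: "set \<mu>s \<subseteq> eigvals X A" "\<forall>y\<in>?D ` Y. kill A \<mu>s y = 0" by blast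
      moreover have "\<mu> \<in> eigvals X A" using v Suc.prems(5) by (auto simp: eigvals_def)
      ultimately show ?thesis by (intro exI[of _ "\<mu> # \<mu>s"]) auto
    qed
  qed
  then show ?thesis using X A by (auto simp: finite_dim_def)
qed

text \<open>Surjectivity from injectivity by walking back along a \<open>kill\<close> list: if
  \<open>A y - \<mu> y = A w\<close> with \<mu> nonzero, then \<open>y\<close> is \<open>A\<close>
  of \<open>(y - w) / \<mu>\<close>.\<close>

lemma lin_on_bij:
  assumes X: "finite_dim X" and A: "lin_on X A" and inj: "\<And>x. x \<in> X \<Longrightarrow> A x = 0 \<Longrightarrow> x = 0"
  shows "bij_betw A X X"
proof -
  have S: "subspace X" using X by (simp add: finite_dim_def)
  have "inj_on A X"
  proof (rule inj_onI)
    fix x y assume *: "x \<in> X" "y \<in> X" "A x = A y"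
    have "A (x - y) = 0" using lin_on_diff[OF A S *(1,2)] *(3) by simp
    then have "x - y = 0" using inj[of "x - y"] subspace_diff[OF S *(1,2)] by blast
    then show "x = y" by simp
  qed
  moreover have "y \<in> A ` X" if y: "y \<in> X" for y
  proof -
    obtain \<mu>s where \<mu>s: "set \<mu>s \<subseteq> eigvals X A" "kill A \<mu>s y = 0" using ex_kill[OF X A] y by blast
    moreover have "0 \<notin> eigvals X A" using inj by (auto simp: eigvals_def)
    ultimately have "0 \<notin> set \<mu>s" by blast
    then show ?thesis using \<mu>s(2) y
    proof (induction \<mu>s arbitrary: y)
      case Nil
      then show ?case using lin_on_zero[OF A S] subspace_0[OF S] by (metis kill.simps(1) image_eqI)
    next
      case (Cons \<mu> \<mu>s)
      have "A y - \<mu> \<odot> y \<in> X" using lin_onD(1)[OF lin_on_shifted[OF A S]] Cons.prems(3) .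
      then have "A y - \<mu> \<odot> y \<in> A ` X" using Cons by auto
      then obtain w where w: "w \<in> X" "A y - \<mu> \<odot> y = A w" by blast
      then have "\<mu> \<odot> y = A (y - w)"
        unfolding lin_on_diff[OF A S Cons.prems(3) w(1)] by (simp add: algebra_simps)
      then have "A ((1 / \<mu>) \<odot> (y - w)) = (1 / \<mu>) \<odot> (\<mu> \<odot> y)"
        using lin_onD(3)[OF A] subspace_diff[OF S] w Cons.prems(3) by simp
      also have "\<dots> = y" using Cons.prems(1) by simp
      finally show ?case using subspace_scale[OF S] subspace_diff[OF S] w Cons.prems(3) by (metis image_eqI)
    qed
  qed
  moreover have "A ` X \<subseteq> X" using A by (simp add: lin_on_def)
  ultimately show ?thesis by (auto simp: bij_betw_def)
qed

text \<open>On an eigenvector for \<nu> each factor \<open>A - \<mu>\<close> acts as the scalar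
  \<open>\<nu> - \<mu>\<close>, so the list can only kill it if \<nu> occurs in it.\<close>

lemma finite_eigvals:
  assumes X: "finite_dim X" and A: "lin_on X A"
  shows "finite (eigvals X A)"
proof -
  obtain \<mu>s where \<mu>s: "\<forall>y\<in>X. kill A \<mu>s y = 0" using ex_kill[OF X A] by blast
  have "kill A \<mu>s v = 0 \<Longrightarrow> v \<noteq> 0 \<Longrightarrow> A v = \<nu> \<odot> v \<Longrightarrow> v \<in> X \<Longrightarrow> \<nu> \<in> set \<mu>s" for \<nu> v \<mu>s
  proof (induction \<mu>s arbitrary: v)
    case (Cons \<mu> \<mu>s)
    show ?case
    proof (cases "\<nu> = \<mu>")
      case False
      have w: "A v - \<mu> \<odot> v = (\<nu> - \<mu>) \<odot> v" using Cons.prems by (simp add: scale_left_diff_distrib)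
      have "\<nu> \<in> set \<mu>s"
      proof (rule Cons.IH[of "(\<nu> - \<mu>) \<odot> v"])
        show "kill A \<mu>s ((\<nu> - \<mu>) \<odot> v) = 0" using Cons.prems(1) w by simp
        show "(\<nu> - \<mu>) \<odot> v \<noteq> 0" using False Cons.prems(2) by simp
        show "A ((\<nu> - \<mu>) \<odot> v) = \<nu> \<odot> (\<nu> - \<mu>) \<odot> v"
          using lin_onD(3)[OF A Cons.prems(4)] Cons.prems(3) by (simp add: mult.commute)
        show "(\<nu> - \<mu>) \<odot> v \<in> X" using X Cons.prems(4) by (simp add: finite_dim_def subspace_scale)
      qed
      then show ?thesis by simp
    qed simp
  qed simp
  then have "eigvals X A \<subseteq> set \<mu>s" using \<mu>s by (auto simp: eigvals_def)
  then show ?thesis using finite_subset by blast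
qed

end

section \<open>Sequences with a rational generating function\<close>

text \<open>Taylor coefficients of a rational function without poles in the closed unit disc;
  summability makes the series converge up to the boundary circle.\<close>

definition ratseq :: "(nat \<Rightarrow> complex) \<Rightarrow> bool" where
  "ratseq c \<longleftrightarrow> summable (\<lambda>n. cmod (c n)) \<and>
     (\<exists>a b :: complex poly. \<forall>z\<in>cball 0 1. poly b z \<noteq> 0 \<and> (\<lambda>n. c n * z ^ n) sums (poly a z / poly b z))"

lemma ratseq_zero: "ratseq (\<lambda>n. 0)"
  unfolding ratseq_def
proof (intro conjI exI ballI)
  fix z :: complex
  show "poly (1 :: complex poly) z \<noteq> 0" by simp
  show "(\<lambda>n. 0 * z ^ n) sums (poly 0 z / poly 1 z)" by simp
qed simp

lemma ratseq_summable:
  assumes "ratseq c" "cmod z \<le> 1"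
  shows "summable (\<lambda>n. c n * z ^ n)"
proof (rule summable_comparison_test')
  show "summable (\<lambda>n. cmod (c n))" using assms by (simp add: ratseq_def)
  show "norm (c n * z ^ n) \<le> cmod (c n)" for n
    unfolding norm_mult norm_power using assms(2) by (intro mult_left_le power_le_one) auto
qed

text \<open>The recursion turns into \<open>C(z) (1 - \<mu> z) = c 0 + z D(z)\<close> for the
  generating functions, which adds only the pole \<open>1 / \<mu>\<close> outside the closed
  disc.\<close>

lemma ratseq_step:
  assumes d: "ratseq d" and rec: "\<And>n. c (Suc n) = \<mu> * c n + d n" and \<mu>: "cmod \<mu> < 1"
  shows "ratseq c"
proof -
  define D where "D = (\<Sum>n. cmod (d n))"
  have sd: "summable (\<lambda>n. cmod (d n))" using d by (simp add: ratseq_def)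
  \<comment> \<open>Summing the recursion bounds the partial sum by \<open>cmod \<mu>\<close> times
    itself plus a constant; as \<open>cmod \<mu> < 1\<close>, this can be solved for the partial
    sum.\<close>
  have "(\<Sum>n<N. cmod (c n)) \<le> (cmod (c 0) + D) / (1 - cmod \<mu>)" for N
  proof -
    have "(\<Sum>n<N. cmod (c n)) \<le> (\<Sum>n<Suc N. cmod (c n))" by simp
    also have "\<dots> = cmod (c 0) + (\<Sum>n<N. cmod (c (Suc n)))" by (rule sum.lessThan_Suc_shift)
    also have "\<dots> \<le> cmod (c 0) + (\<Sum>n<N. cmod \<mu> * cmod (c n) + cmod (d n))"
      unfolding rec by (intro add_left_mono sum_mono order_trans[OF norm_triangle_ineq]) (simp add: norm_mult)
    also have "\<dots> = cmod (c 0) + cmod \<mu> * (\<Sum>n<N. cmod (c n)) + (\<Sum>n<N. cmod (d n))"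
      by (simp add: sum.distrib sum_distrib_left)
    also have "\<dots> \<le> cmod (c 0) + cmod \<mu> * (\<Sum>n<N. cmod (c n)) + D"
      unfolding D_def by (intro add_left_mono sum_le_suminf sd) auto
    finally have "(\<Sum>n<N. cmod (c n)) * (1 - cmod \<mu>) \<le> cmod (c 0) + D" by (simp add: algebra_simps)
    then show ?thesis using \<mu> by (simp add: pos_le_divide_eq)
  qed
  then have sc: "summable (\<lambda>n. cmod (c n))"
    by (intro summableI_nonneg_bounded) auto
  obtain a b :: "complex poly" where "\<forall>z\<in>cball 0 1. poly b z \<noteq> 0 \<and> (\<lambda>n. d n * z ^ n) sums (poly a z / poly b z)"
    using d unfolding ratseq_def by blast
  then have ab: "\<And>z. z \<in> cball 0 1 \<Longrightarrow> poly b z \<noteq> 0"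
    "\<And>z. z \<in> cball 0 1 \<Longrightarrow> (\<lambda>n. d n * z ^ n) sums (poly a z / poly b z)" by blast+
  let ?b = "[:1, - \<mu>:] * b" and ?a = "[:c 0:] * b + [:0, 1:] * a"
  have "poly ?b z \<noteq> 0 \<and> (\<lambda>n. c n * z ^ n) sums (poly ?a z / poly ?b z)" if z: "z \<in> cball 0 1" for z
  proof -
    have "cmod (\<mu> * z) < 1"
      using \<mu> z mult_left_le[of "cmod z" "cmod \<mu>"] by (simp add: norm_mult)
    then have nz: "1 - \<mu> * z \<noteq> 0" by (metis eq_iff_diff_eq_0 norm_one order_less_irrefl)
    have sum: "summable (\<lambda>n. c n * z ^ n)"
    proof (rule summable_comparison_test'[OF sc])
      show "norm (c n * z ^ n) \<le> cmod (c n)" for n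
        unfolding norm_mult norm_power using z by (intro mult_left_le power_le_one) auto
    qed
    define C where "C = (\<Sum>n. c n * z ^ n)"
    have C: "(\<lambda>n. c n * z ^ n) sums C" unfolding C_def using sum by (rule summable_sums)
    have "(\<lambda>n. \<mu> * z * (c n * z ^ n) + z * (d n * z ^ n)) sums (\<mu> * z * C + z * (poly a z / poly b z))"
      by (intro sums_add sums_mult C ab z)
    then have "(\<lambda>n. c (Suc n) * z ^ Suc n) sums (\<mu> * z * C + z * (poly a z / poly b z))"
      by (simp add: rec algebra_simps)
    moreover have "(\<lambda>n. c (Suc n) * z ^ Suc n) sums (C - c 0 * z ^ 0)"
      using C by (subst sums_Suc_iff) simp
    ultimately have "\<mu> * z * C + z * (poly a z / poly b z) = C - c 0" using sums_unique2 by fastforce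
    then have "C * (1 - \<mu> * z) = c 0 + z * (poly a z / poly b z)" by (simp add: algebra_simps)
    then have "C = (c 0 + z * (poly a z / poly b z)) / (1 - \<mu> * z)" using nz by (simp add: eq_divide_eq)
    also have "\<dots> = poly ?a z / poly ?b z" using nz ab(1)[OF z] by (simp add: field_simps)
    finally show ?thesis using C nz ab(1)[OF z] by (auto simp: mult.commute)
  qed
  then have "\<exists>a b :: complex poly. \<forall>z\<in>cball 0 1. poly b z \<noteq> 0 \<and> (\<lambda>n. c n * z ^ n) sums (poly a z / poly b z)"
    by (intro exI[of _ ?a] exI[of _ ?b] ballI)
  then show ?thesis using sc unfolding ratseq_def by blast
qed

section \<open>Stable operators: rational transfer functions and resolvent series\<close>

context complex_vector_space
begin

definition functional_on :: "'v set \<Rightarrow> ('v \<Rightarrow> complex) \<Rightarrow> bool" where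
  "functional_on X L \<longleftrightarrow> (\<forall>x\<in>X. \<forall>y\<in>X. L (x + y) = L x + L y) \<and> (\<forall>c. \<forall>x\<in>X. L (c \<odot> x) = c * L x)"

lemma functional_on_diff:
  assumes "functional_on X L" "subspace X" "x \<in> X" "y \<in> X"
  shows "L (x - y) = L x - L y"
proof -
  have "L ((x - y) + y) = L (x - y) + L y"
    using assms subspace_diff[OF assms(2-4)] unfolding functional_on_def by blast
  then show ?thesis by simp
qed

lemma lin_on_funpow_diff:
  assumes "lin_on X A" "subspace X" "x \<in> X" "y \<in> X"
  shows "(A ^^ n) (x - y) = (A ^^ n) x - (A ^^ n) y" "(A ^^ n) (c \<odot> x) = c \<odot> (A ^^ n) x"
  by (induction n) (use assms in \<open>auto simp: lin_on_diff lin_on_funpow lin_onD\<close>)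

text \<open>Each entry \<mu> of an annihilating list gives a first-order recursion: the sequence for
  \<open>y\<close> is driven by the sequence for \<open>A y - \<mu> y\<close>, which has a shorter
  list.\<close>

lemma stable_ratseq:
  assumes X: "finite_dim X" and A: "lin_on X A" and st: "\<And>\<mu>. \<mu> \<in> eigvals X A \<Longrightarrow> cmod \<mu> < 1"
    and L: "functional_on X L" and y: "y \<in> X"
  shows "ratseq (\<lambda>n. L ((A ^^ n) y))"
proof -
  have S: "subspace X" using X by (simp add: finite_dim_def)
  obtain \<mu>s where "set \<mu>s \<subseteq> eigvals X A" "kill A \<mu>s y = 0" using ex_kill[OF X A] y by blast
  then have "\<forall>\<mu>\<in>set \<mu>s. cmod \<mu> < 1" "kill A \<mu>s y = 0" using st by auto
  then show ?thesis using y
  proof (induction \<mu>s arbitrary: y)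
    case Nil
    have "(A ^^ n) 0 = 0" for n by (induction n) (auto simp: lin_on_zero[OF A S])
    moreover have "L 0 = 0" using functional_on_diff[OF L S subspace_0[OF S] subspace_0[OF S]] by simp
    ultimately show ?case using Nil ratseq_zero by simp
  next
    case (Cons \<mu> \<mu>s)
    have yX: "A y \<in> X" "\<mu> \<odot> y \<in> X" "A y - \<mu> \<odot> y \<in> X"
      using Cons.prems(3) lin_onD(1)[OF A] S by (auto intro: subspace_scale subspace_diff)
    have IH: "ratseq (\<lambda>n. L ((A ^^ n) (A y - \<mu> \<odot> y)))" using Cons yX by auto
    have rec: "L ((A ^^ Suc n) y) = \<mu> * L ((A ^^ n) y) + L ((A ^^ n) (A y - \<mu> \<odot> y))" for n
    proof -
      have "(A ^^ n) (A y - \<mu> \<odot> y) = (A ^^ Suc n) y - \<mu> \<odot> (A ^^ n) y"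
        using lin_on_funpow_diff[OF A S] yX Cons.prems(3) by (simp add: funpow_swap1)
      moreover have "(A ^^ k) y \<in> X" for k using lin_on_funpow[OF A Cons.prems(3)] .
      ultimately show ?thesis
        using functional_on_diff[OF L S] subspace_scale[OF S] L by (simp add: functional_on_def del: funpow.simps)
    qed
    have "cmod \<mu> < 1" using Cons.prems(1) by simp
    then show ?case by (rule ratseq_step[OF IH rec])
  qed
qed

text \<open>A kernel vector of \<open>1 - z A\<close> would be an eigenvector of \<open>A\<close>
  for \<open>1 / z\<close>, of modulus at least 1.\<close>

lemma stable_resolvent_bij:
  assumes X: "finite_dim X" and A: "lin_on X A" and st: "\<And>\<mu>. \<mu> \<in> eigvals X A \<Longrightarrow> cmod \<mu> < 1"
    and z: "cmod z \<le> 1"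
  shows "bij_betw (\<lambda>x. x - z \<odot> A x) X X"
proof (rule lin_on_bij[OF X])
  have S: "subspace X" using X by (simp add: finite_dim_def)
  show "lin_on X (\<lambda>x. x - z \<odot> A x)" by (rule lin_on_resolvent[OF A S])
  fix x assume x: "x \<in> X" "x - z \<odot> A x = 0"
  show "x = 0"
  proof (rule ccontr)
    assume "x \<noteq> 0"
    then have "z \<noteq> 0" using x by auto
    have "z \<odot> A x = x" using x by simp
    then have "A x = (1 / z) \<odot> x" using \<open>z \<noteq> 0\<close> by (metis scale_scale scale_one nonzero_eq_divide_eq)
    then have "1 / z \<in> eigvals X A" using x(1) \<open>x \<noteq> 0\<close> unfolding eigvals_def by blast
    then have "cmod (1 / z) < 1" by (rule st)
    then show False using z \<open>z \<noteq> 0\<close> by (simp add: norm_divide)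
  qed
qed

text \<open>The Neumann series tested against a functional. Substituting
  \<open>b = r - z A r\<close> makes it telescope, and the remainder
  \<open>L ((A ^^ n) r) * z ^ n\<close> tends to 0 by stability.\<close>

lemma resolvent_sums:
  assumes X: "finite_dim X" and A: "lin_on X A" and st: "\<And>\<mu>. \<mu> \<in> eigvals X A \<Longrightarrow> cmod \<mu> < 1"
    and L: "functional_on X L" and z: "cmod z \<le> 1" and r: "r \<in> X" "r - z \<odot> A r = b"
  shows "(\<lambda>n. L ((A ^^ n) b) * z ^ n) sums L r"
proof -
  have S: "subspace X" using X by (simp add: finite_dim_def)
  let ?g = "\<lambda>n. L ((A ^^ n) r) * z ^ n"
  have "summable ?g" by (intro ratseq_summable stable_ratseq[OF X A st L r(1)] z)
  then have "?g \<longlonglongrightarrow> 0" by (rule summable_LIMSEQ_zero)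
  then have "(\<lambda>n. ?g n - ?g (Suc n)) sums (?g 0 - 0)" by (rule telescope_sums')
  moreover have "L ((A ^^ n) b) * z ^ n = ?g n - ?g (Suc n)" for n
  proof -
    have AX: "(A ^^ k) r \<in> X" for k using lin_on_funpow[OF A r(1)] .
    have "(A ^^ n) b = (A ^^ n) r - z \<odot> (A ^^ Suc n) r"
      unfolding r(2)[symmetric] using lin_on_funpow_diff[OF A S] r(1) lin_onD(1)[OF A] subspace_scale[OF S]
      by (simp add: funpow_swap1)
    then have "L ((A ^^ n) b) = L ((A ^^ n) r) - z * L ((A ^^ Suc n) r)"
      using functional_on_diff[OF L S] AX subspace_scale[OF S] L by (simp add: functional_on_def del: funpow.simps)
    then show ?thesis by (simp only: left_diff_distrib right_diff_distrib power_Suc mult_ac)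
  qed
  ultimately show ?thesis by simp
qed

end

section \<open>Square-integrable functions on the circle\<close>

lemma finite_measure_circ: "finite_measure circ"
  by (intro finite_measure_lebesgue_on) auto

lemma measure_circ: "measure circ (space circ) = 2 * pi"
  by (simp add: measure_restrict_space)

lemma integral_circ_const [simp]: "(LINT t|circ. (c::'a::{banach,second_countable_topology})) = (2*pi) *\<^sub>R c"
  by (subst lebesgue_integral_const) (simp add: measure_restrict_space)

lemma integrable_circ_bounded:
  fixes f :: "real \<Rightarrow> 'a::{banach,second_countable_topology}"
  assumes "f \<in> borel_measurable circ" "AE t in circ. norm (f t) \<le> C"
  shows "integrable circ f"
proof -
  interpret finite_measure circ by (rule finite_measure_circ)
  show ?thesis using assms by (intro integrable_const_bound[where B=C]) auto
qed

lemma cis_measurable [measurable]: "(\<lambda>t. cis (a * t)) \<in> borel_measurable circ"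
  by (intro continuous_imp_measurable_on_sets_lebesgue continuous_intros) auto

lemma L2fun_measurable: "f \<in> L2fun \<Longrightarrow> f \<in> borel_measurable circ"
  by (simp add: L2fun_def)

lemma L2fun_square: "f \<in> L2fun \<Longrightarrow> integrable circ (\<lambda>t. (norm (f t))^2)"
  by (simp add: L2fun_def)

lemma square_add_le: "(a + b)^2 \<le> 2 * a^2 + 2 * (b::real)^2"
  using zero_le_power2[of "a - b"] by (simp add: power2_eq_square algebra_simps)

lemma L2fun_bounded_by:
  fixes f :: "real \<Rightarrow> 'a::{banach,second_countable_topology}"
    and g :: "real \<Rightarrow> 'b::{banach,second_countable_topology}"
  assumes f: "f \<in> L2fun" and g: "g \<in> borel_measurable circ"
    and le: "AE t in circ. norm (g t) \<le> C * norm (f t)"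
  shows "g \<in> L2fun"
proof -
  have [measurable]: "g \<in> borel_measurable circ" by (fact g)
  have "integrable circ (\<lambda>t. C^2 * (norm (f t))^2)"
    using L2fun_square[OF f] by simp
  then have "integrable circ (\<lambda>t. (norm (g t))^2)"
  proof (rule Bochner_Integration.integrable_bound)
    show "AE t in circ. norm ((norm (g t))\<^sup>2) \<le> norm (C\<^sup>2 * (norm (f t))\<^sup>2)"
      using le
    proof eventually_elim
      case (elim t)
      then have "(norm (g t))^2 \<le> (C * norm (f t))^2" by (intro power_mono) auto
      then show ?case by (simp add: power_mult_distrib)
    qed
  qed measurable
  then show ?thesis using g by (simp add: L2fun_def)
qed

lemma L2fun_bounded:
  fixes f :: "real \<Rightarrow> 'a::{banach,second_countable_topology}"
  assumes "f \<in> borel_measurable circ" "AE t in circ. norm (f t) \<le> C"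
  shows "f \<in> L2fun"
proof -
  have one: "(\<lambda>t. 1::real) \<in> L2fun" by (auto simp: L2fun_def)
  show ?thesis
    by (rule L2fun_bounded_by[OF one, where C=C]) (use assms in auto)
qed

lemma L2fun_add:
  fixes f g :: "real \<Rightarrow> 'a::{banach,second_countable_topology}"
  assumes f: "f \<in> L2fun" and g: "g \<in> L2fun"
  shows "(\<lambda>t. f t + g t) \<in> L2fun"
proof -
  have [measurable]: "f \<in> borel_measurable circ" "g \<in> borel_measurable circ"
    using f g by (auto simp: L2fun_def)
  have "integrable circ (\<lambda>t. 2 * (norm (f t))^2 + 2 * (norm (g t))^2)"
    using L2fun_square[OF f] L2fun_square[OF g] by simp
  then have "integrable circ (\<lambda>t. (norm (f t + g t))^2)"
  proof (rule Bochner_Integration.integrable_bound)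
    have "(norm (f t + g t))\<^sup>2 \<le> 2 * (norm (f t))\<^sup>2 + 2 * (norm (g t))\<^sup>2" for t
      using power_mono[OF norm_triangle_ineq[of "f t" "g t"], of 2] square_add_le[of "norm (f t)" "norm (g t)"]
      by (meson norm_ge_zero order_trans)
    then show "AE t in circ. norm ((norm (f t + g t))\<^sup>2) \<le> norm (2 * (norm (f t))\<^sup>2 + 2 * (norm (g t))\<^sup>2)"
      by simp
  qed measurable
  then show ?thesis by (simp add: L2fun_def)
qed

lemma L2fun_uminus: "f \<in> L2fun \<Longrightarrow> (\<lambda>t. - f t) \<in> L2fun"
  for f :: "real \<Rightarrow> 'a::{banach,second_countable_topology}"
  by (auto simp: L2fun_def)

lemma L2fun_diff:
  fixes f g :: "real \<Rightarrow> 'a::{banach,second_countable_topology}"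
  assumes "f \<in> L2fun" "g \<in> L2fun"
  shows "(\<lambda>t. f t - g t) \<in> L2fun"
  using L2fun_add[OF assms(1) L2fun_uminus[OF assms(2)]] by simp

lemma L2fun_zero: "(\<lambda>t. 0::'a::real_normed_vector) \<in> L2fun"
  by (simp add: L2fun_def)

lemma L2fun_sum:
  fixes f :: "'i \<Rightarrow> real \<Rightarrow> 'a::{banach,second_countable_topology}"
  assumes "\<And>i. i \<in> I \<Longrightarrow> f i \<in> L2fun"
  shows "(\<lambda>t. \<Sum>i\<in>I. f i t) \<in> L2fun"
  using assms by (induction I rule: infinite_finite_induct) (auto intro: L2fun_add L2fun_zero)

lemma L2fun_mult_bounded:
  fixes f g :: "real \<Rightarrow> complex"
  assumes f: "f \<in> L2fun" and g: "g \<in> borel_measurable circ" "AE t in circ. norm (g t) \<le> C"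
  shows "(\<lambda>t. g t * f t) \<in> L2fun"
proof (rule L2fun_bounded_by[OF f])
  show "(\<lambda>t. g t * f t) \<in> borel_measurable circ"
    using g(1) L2fun_measurable[OF f] by (rule borel_measurable_times)
  show "AE t in circ. norm (g t * f t) \<le> C * norm (f t)"
    using g(2) by eventually_elim (simp add: norm_mult mult_right_mono)
qed

lemma L2fun_cis: "(\<lambda>t. cis (a * t)) \<in> L2fun"
  by (rule L2fun_bounded[where C=1]) auto

lemma L2fun_cmult: "f \<in> L2fun \<Longrightarrow> (\<lambda>t. (c::complex) * f t) \<in> L2fun"
  by (rule L2fun_mult_bounded[where C="norm c"]) auto

lemma L2fun_cis_mult: "f \<in> L2fun \<Longrightarrow> (\<lambda>t. cis (a * t) * f t) \<in> L2fun"
  by (rule L2fun_mult_bounded[where C=1]) auto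

lemma L2fun_cnj: "f \<in> L2fun \<Longrightarrow> (\<lambda>t. cnj (f t)) \<in> L2fun"
proof (rule L2fun_bounded_by[where C=1 and f=f])
  assume "f \<in> L2fun"
  then show "(\<lambda>t. cnj (f t)) \<in> borel_measurable circ"
    by (intro measurable_compose[OF L2fun_measurable] borel_measurable_continuous_onI continuous_intros)
qed auto

lemma L2fun_integrable:
  fixes f :: "real \<Rightarrow> complex"
  assumes "f \<in> L2fun" shows "integrable circ f"
proof -
  interpret finite_measure circ by (rule finite_measure_circ)
  have [measurable]: "f \<in> borel_measurable circ" using assms by (rule L2fun_measurable)
  have "integrable circ (\<lambda>t. (norm (f t))^2 + 1)"
    using L2fun_square[OF assms] by simp
  then show ?thesis
  proof (rule Bochner_Integration.integrable_bound)
    have "norm (f t) \<le> (norm (f t))^2 + 1" for t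
    proof -
      have "0 \<le> (norm (f t) - 1)^2" by simp
      then have "2 * norm (f t) \<le> (norm (f t))^2 + 1" by (simp add: power2_diff)
      then show ?thesis using norm_ge_zero[of "f t"] by linarith
    qed
    then show "AE t in circ. norm (f t) \<le> norm ((norm (f t))\<^sup>2 + 1)" by simp
  qed measurable
qed

lemma L2fun_mult_integrable:
  fixes f g :: "real \<Rightarrow> complex"
  assumes f: "f \<in> L2fun" and g: "g \<in> L2fun"
  shows "integrable circ (\<lambda>t. f t * g t)"
proof -
  have [measurable]: "f \<in> borel_measurable circ" "g \<in> borel_measurable circ"
    using f g by (auto simp: L2fun_def)
  have "integrable circ (\<lambda>t. (norm (f t))^2 + (norm (g t))^2)"
    using L2fun_square[OF f] L2fun_square[OF g] by simp
  then show ?thesis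
  proof (rule Bochner_Integration.integrable_bound)
    have "norm (f t * g t) \<le> (norm (f t))^2 + (norm (g t))^2" for t
    proof -
      have "2 * (norm (f t) * norm (g t)) \<le> (norm (f t))^2 + (norm (g t))^2"
        using zero_le_power2[of "norm (f t) - norm (g t)"]
        by (simp add: power2_eq_square algebra_simps)
      moreover have "0 \<le> norm (f t) * norm (g t)" by simp
      ultimately show ?thesis unfolding norm_mult by linarith
    qed
    then show "AE t in circ. norm (f t * g t) \<le> norm ((norm (f t))\<^sup>2 + (norm (g t))\<^sup>2)" by simp
  qed measurable
qed

section \<open>Scalar Fourier coefficients\<close>

lemma integral_circ_cis:
  fixes n :: int
  shows "(LINT t|circ. cis (of_int n * t)) = (if n = 0 then 2 * pi else 0)"
proof (cases "n = 0")
  case True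
  then show ?thesis using integral_circ_const[of "1::complex"] by (simp add: scaleR_conv_of_real)
next
  case False
  let ?F = "\<lambda>t::real. cis (of_int n * t) / (\<i> * of_int n)"
  have "((\<lambda>t. cis (of_int n * t)) has_integral (?F (2*pi) - ?F 0)) {0..2*pi}"
  proof (rule fundamental_theorem_of_calculus)
    fix t :: real
    have "((\<lambda>z. exp (\<i> * of_int n * z) / (\<i> * of_int n)) has_field_derivative
            exp (\<i> * of_int n * of_real t)) (at (of_real t))"
      using False by (auto intro!: derivative_eq_intros)
    from has_vector_derivative_real_field[OF this]
    show "(?F has_vector_derivative cis (of_int n * t)) (at t within {0..2*pi})"
      by (simp add: cis_conv_exp mult.assoc has_vector_derivative_at_within)
  qed auto
  moreover have "cis (of_int n * (2*pi)) = 1"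
    by (metis cis_2pi cis_multiple_2pi Ints_of_int mult.commute)
  ultimately have "((\<lambda>t. cis (of_int n * t)) has_integral 0) {0..2*pi}" by simp
  moreover have "integrable circ (\<lambda>t. cis (of_int n * t))"
    by (rule integrable_circ_bounded[where C=1]) auto
  ultimately show ?thesis using False
    by (simp add: lebesgue_integral_eq_integral integral_unique)
qed

lemma fcoefc_integrable: "integrable circ f \<Longrightarrow> integrable circ (\<lambda>t. cis (a * t) * f t)"
  by (rule Bochner_Integration.integrable_bound[of circ f]) (auto simp: norm_mult)

lemma fcoefc_integrable': "integrable circ f \<Longrightarrow> integrable circ (\<lambda>t. cis (- (a * t)) * f t)"
  using fcoefc_integrable[of f "-a"] by simp

lemma fcoefc_add:
  "integrable circ f \<Longrightarrow> integrable circ g \<Longrightarrow> fcoefc (\<lambda>t. f t + g t) n = fcoefc f n + fcoefc g n"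
  by (simp add: fcoefc_def distrib_left fcoefc_integrable')

lemma fcoefc_diff:
  "integrable circ f \<Longrightarrow> integrable circ g \<Longrightarrow> fcoefc (\<lambda>t. f t - g t) n = fcoefc f n - fcoefc g n"
  by (simp add: fcoefc_def right_diff_distrib fcoefc_integrable')

lemma fcoefc_cmult: "fcoefc (\<lambda>t. c * f t) n = c * fcoefc f n"
proof -
  have "(LINT t|circ. cis (- (of_int n * t)) * (c * f t)) = c * (LINT t|circ. cis (- (of_int n * t)) * f t)"
    by (subst integral_mult_right_zero[symmetric]) (simp add: mult_ac)
  then show ?thesis by (simp add: fcoefc_def)
qed

lemma fcoefc_zero [simp]: "fcoefc (\<lambda>t. 0) n = 0"
  by (simp add: fcoefc_def)

lemma fcoefc_sum:
  "(\<And>i. i \<in> I \<Longrightarrow> integrable circ (f i)) \<Longrightarrow> fcoefc (\<lambda>t. \<Sum>i\<in>I. f i t) n = (\<Sum>i\<in>I. fcoefc (f i) n)"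
  by (induction I rule: infinite_finite_induct) (auto simp: fcoefc_add)

lemma fcoefc_cong_AE:
  assumes "AE t in circ. f t = g t" "f \<in> borel_measurable circ" "g \<in> borel_measurable circ"
  shows "fcoefc f n = fcoefc g n"
proof -
  have [measurable]: "(\<lambda>t. cis (- (of_int n * t))) \<in> borel_measurable circ"
    using cis_measurable[of "- of_int n"] by simp
  note [measurable] = assms(2,3)
  have "(LINT t|circ. cis (- (of_int n * t)) * f t) = (LINT t|circ. cis (- (of_int n * t)) * g t)"
    by (rule integral_cong_AE) (use assms(1) in auto)
  then show ?thesis by (simp add: fcoefc_def)
qed

lemma fcoefc_cis_mult: "fcoefc (\<lambda>t. cis (of_int m * t) * f t) n = fcoefc f (n - m)"
proof -
  have "cis (- (of_int n * t)) * (cis (of_int m * t) * f t) = cis (- (of_int (n - m) * t)) * f t" for t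
  proof -
    have "cis (- (of_int n * t)) * cis (of_int m * t) = cis (- (of_int (n - m) * t))"
      unfolding cis_mult by (rule arg_cong[where f=cis]) (simp add: algebra_simps)
    then show ?thesis by (metis mult.assoc)
  qed
  then show ?thesis unfolding fcoefc_def by presburger
qed

lemma fcoefc_cis: "fcoefc (\<lambda>t. cis (of_int m * t)) n = (if n = m then 1 else 0)"
proof -
  have "fcoefc (\<lambda>t. cis (of_int m * t)) n = fcoefc (\<lambda>t. 1) (n - m)"
    using fcoefc_cis_mult[of m "\<lambda>t. 1" n] by simp
  also have "\<dots> = (if n = m then 1 else 0)"
    using integral_circ_cis[of "m - n"] by (auto simp: fcoefc_def algebra_simps)
  finally show ?thesis .
qed

lemma fcoefc_cnj: "fcoefc (\<lambda>t. cnj (f t)) n = cnj (fcoefc f (- n))"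
proof -
  have "(LINT t|circ. cis (- (of_int n * t)) * cnj (f t)) = cnj (LINT t|circ. cis (- (of_int (- n) * t)) * f t)"
    unfolding Bochner_Integration.integral_cnj[symmetric]
    by (rule Bochner_Integration.integral_cong) (auto simp: cis_cnj)
  then show ?thesis by (simp add: fcoefc_def)
qed

lemma norm_fcoefc_le:
  assumes "integrable circ f"
  shows "norm (fcoefc f n) \<le> (1/(2*pi)) * (LINT t|circ. norm (f t))"
proof -
  have "norm (LINT t|circ. cis (- (of_int n * t)) * f t) \<le> (LINT t|circ. norm (cis (- (of_int n * t)) * f t))"
    by (rule integral_norm_bound)
  then have "norm (LINT t|circ. cis (- (of_int n * t)) * f t) \<le> (LINT t|circ. norm (f t))"
    by (simp add: norm_mult)
  then show ?thesis unfolding fcoefc_def norm_mult norm_of_real by (intro mult_mono) auto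
qed

lemma integral_mult_cis: "(LINT t|circ. f t * cnj (cis (of_int n * t))) = 2 * pi * fcoefc f n"
  by (simp add: fcoefc_def cis_cnj mult.commute)

definition trigsum :: "(int \<Rightarrow> complex) \<Rightarrow> int set \<Rightarrow> real \<Rightarrow> complex" where
  "trigsum c A t = (\<Sum>k\<in>A. c k * cis (of_int k * t))"

lemma trigsum_L2: "trigsum c A \<in> L2fun"
proof -
  have "(\<lambda>t. \<Sum>k\<in>A. c k * cis (of_int k * t)) \<in> L2fun"
    by (intro L2fun_sum L2fun_cmult L2fun_cis)
  then show ?thesis by (simp add: trigsum_def[abs_def])
qed

lemma fcoefc_trigsum:
  assumes "finite A" shows "fcoefc (trigsum c A) n = (if n \<in> A then c n else 0)"
proof -
  have "fcoefc (trigsum c A) n = (\<Sum>k\<in>A. fcoefc (\<lambda>t. c k * cis (of_int k * t)) n)"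
    unfolding trigsum_def[abs_def]
    by (rule fcoefc_sum) (intro L2fun_integrable L2fun_cmult L2fun_cis)
  also have "\<dots> = (\<Sum>k\<in>A. if k = n then c k else 0)"
    by (intro sum.cong) (auto simp: fcoefc_cmult fcoefc_cis)
  finally show ?thesis using assms by simp
qed

lemma integral_mult_cnj_trigsum:
  assumes "f \<in> L2fun" "finite A"
  shows "(LINT t|circ. f t * cnj (trigsum c A t)) = 2 * pi * (\<Sum>k\<in>A. fcoefc f k * cnj (c k))"
proof -
  have int: "integrable circ (\<lambda>t. f t * cnj (cis (of_int k * t)) * cnj (c k))" for k
    by (intro integrable_mult_left L2fun_mult_integrable assms L2fun_cnj L2fun_cis)
  have "(LINT t|circ. f t * cnj (trigsum c A t))
      = (LINT t|circ. (\<Sum>k\<in>A. f t * cnj (cis (of_int k * t)) * cnj (c k)))"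
    by (simp add: trigsum_def sum_distrib_left mult_ac)
  also have "\<dots> = (\<Sum>k\<in>A. (LINT t|circ. f t * cnj (cis (of_int k * t)) * cnj (c k)))"
    using int by (intro Bochner_Integration.integral_sum)
  also have "\<dots> = (\<Sum>k\<in>A. 2 * pi * fcoefc f k * cnj (c k))"
    by (intro sum.cong refl) (simp only: integral_mult_left_zero integral_mult_cis)
  finally show ?thesis by (simp add: sum_distrib_left mult_ac)
qed

lemma cmod_diff_square: "(cmod (a - b))^2 = (cmod a)^2 + (cmod b)^2 - 2 * Re (a * cnj b)"
  unfolding cmod_power2 by (simp add: power2_eq_square algebra_simps)

lemma integral_minus_trigsum:
  assumes f: "f \<in> L2fun" and A: "finite A"
  shows "(LINT t|circ. (cmod (f t - trigsum (fcoefc f) A t))^2)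
       = (LINT t|circ. (cmod (f t))^2) - 2 * pi * (\<Sum>k\<in>A. (cmod (fcoefc f k))^2)"
proof -
  let ?P = "trigsum (fcoefc f) A"
  have P: "?P \<in> L2fun" by (rule trigsum_L2)
  have re: "(LINT t|circ. Re (h t * cnj (?P t))) = 2 * pi * (\<Sum>k\<in>A. (cmod (fcoefc f k))^2)"
    if h: "h \<in> L2fun" "\<And>k. k \<in> A \<Longrightarrow> fcoefc h k = fcoefc f k" for h
  proof -
    have "(LINT t|circ. Re (h t * cnj (?P t))) = Re (LINT t|circ. h t * cnj (?P t))"
      by (intro integral_Re L2fun_mult_integrable L2fun_cnj P h)
    also have "(LINT t|circ. h t * cnj (?P t)) = 2 * pi * (\<Sum>k\<in>A. complex_of_real ((cmod (fcoefc f k))^2))"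
      unfolding integral_mult_cnj_trigsum[OF h(1) A]
      by (simp add: h(2) complex_norm_square[symmetric])
    finally show ?thesis by (simp flip: of_real_sum)
  qed
  have PP: "(LINT t|circ. (cmod (?P t))^2) = 2 * pi * (\<Sum>k\<in>A. (cmod (fcoefc f k))^2)"
    using re[OF P] fcoefc_trigsum[OF A] by (simp add: complex_mult_cnj cmod_power2)
  have i: "integrable circ (\<lambda>t. Re (f t * cnj (?P t)))"
    by (intro integrable_Re L2fun_mult_integrable L2fun_cnj P f)
  have "(LINT t|circ. (cmod (f t - ?P t))^2)
      = (LINT t|circ. (cmod (f t))^2 + (cmod (?P t))^2 - 2 * Re (f t * cnj (?P t)))"
    by (simp only: cmod_diff_square)
  also have "\<dots> = (LINT t|circ. (cmod (f t))^2) + (LINT t|circ. (cmod (?P t))^2)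
       - 2 * (LINT t|circ. Re (f t * cnj (?P t)))"
    using L2fun_square[OF f] L2fun_square[OF P] i
    by (subst Bochner_Integration.integral_diff Bochner_Integration.integral_add
          Bochner_Integration.integral_mult_right_zero;
        (intro Bochner_Integration.integrable_add integrable_mult_right)?; simp only: if_True)+
  finally show ?thesis using re[OF f] PP by simp
qed

lemma bessel:
  assumes "f \<in> L2fun" "finite A"
  shows "2 * pi * (\<Sum>k\<in>A. (cmod (fcoefc f k))^2) \<le> (LINT t|circ. (cmod (f t))^2)"
proof -
  have "0 \<le> (LINT t|circ. (cmod (f t - trigsum (fcoefc f) A t))^2)"
    by (rule Bochner_Integration.integral_nonneg) simp
  then show ?thesis unfolding integral_minus_trigsum[OF assms] by linarith
qed

section \<open>Uniqueness of Fourier coefficients\<close>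

lemma cos_sin_mult_cis:
  "complex_of_real (cos t) * w = (cis (1 * t) * w + cis (- 1 * t) * w) / 2"
  "complex_of_real (sin t) * w = \<i> / 2 * (cis (- 1 * t) * w - cis (1 * t) * w)"
  by (auto simp: complex_eq_iff field_simps)

text \<open>The class of functions with vanishing Fourier coefficients is stable under multiplication by a
  trigonometric polynomial, which makes the induction over products go through.\<close>

lemma zero_fcoefc_mult_polynomial:
  assumes "real_polynomial_function p"
  shows "integrable circ f \<Longrightarrow> (\<forall>n. fcoefc f n = 0) \<Longrightarrow>
    integrable circ (\<lambda>t. complex_of_real (p (cis t)) * f t) \<and>
    (\<forall>n. fcoefc (\<lambda>t. complex_of_real (p (cis t)) * f t) n = 0)"
  using assms
proof (induction arbitrary: f rule: real_polynomial_function.induct)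
  case (linear p)
  have p: "complex_of_real (p (cis t)) * f t =
     (of_real (p 1) / 2 - \<i> / 2 * of_real (p \<i>)) * (cis (of_int 1 * t) * f t) +
     (of_real (p 1) / 2 + \<i> / 2 * of_real (p \<i>)) * (cis (of_int (-1) * t) * f t)" for t
  proof -
    have "cis t = cos t *\<^sub>R 1 + sin t *\<^sub>R \<i>" by (simp add: complex_eq_iff)
    then have "p (cis t) = cos t * p 1 + sin t * p \<i>"
      using linear.hyps by (simp add: linear_simps)
    then have "complex_of_real (p (cis t)) * f t =
        of_real (p 1) * (of_real (cos t) * f t) + of_real (p \<i>) * (of_real (sin t) * f t)"
      by (simp add: algebra_simps)
    then show ?thesis unfolding cos_sin_mult_cis by (simp add: field_simps)
  qed
  have i: "integrable circ (\<lambda>t. cis (of_int k * t) * f t)" for k :: int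
    by (rule fcoefc_integrable) (fact linear.prems)
  show ?case unfolding p
    using linear.prems i
    by (auto simp: fcoefc_add fcoefc_cmult fcoefc_cis_mult simp del: of_int_1 of_int_minus of_int_neg_numeral)
next
  case (const c)
  then show ?case by (simp add: fcoefc_cmult)
next
  case (add p q)
  then show ?case by (simp add: distrib_right fcoefc_add)
next
  case (mult p q)
  show ?case
    using mult.IH(1)[of "\<lambda>t. complex_of_real (q (cis t)) * f t"] mult.IH(2)[of f] mult.prems
    by (simp add: mult.assoc)
qed

lemma fcoefc_0_eq: "fcoefc f 0 = complex_of_real (1/(2*pi)) * (LINT t|circ. f t)"
  by (simp add: fcoefc_def)

text \<open>\<open>f\<close> annihilates every real polynomial in the coordinates of
  \<open>cis t\<close>, and by Stone-Weierstrass these are uniformly dense in the continuous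
  functions on the circle.\<close>

lemma zero_fcoefc_continuous:
  fixes \<phi> :: "complex \<Rightarrow> real"
  assumes f: "integrable circ f" "\<And>n. fcoefc f n = 0" and \<phi>: "continuous_on (sphere 0 1) \<phi>"
  shows "(LINT t|circ. complex_of_real (\<phi> (cis t)) * f t) = 0"
proof -
  have \<phi>': "(\<lambda>t. complex_of_real (\<phi> (cis t))) \<in> borel_measurable circ"
    by (intro continuous_imp_measurable_on_sets_lebesgue continuous_intros
        continuous_on_compose2[OF \<phi>]) auto
  have bd: "bounded (\<phi> ` sphere 0 1)"
    by (intro compact_imp_bounded compact_continuous_image \<phi> compact_sphere)
  then obtain K where K: "\<And>z. z \<in> sphere 0 1 \<Longrightarrow> \<bar>\<phi> z\<bar> \<le> K"
    unfolding bounded_iff by (metis image_eqI real_norm_def)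
  have int\<phi>: "integrable circ (\<lambda>t. complex_of_real (\<phi> (cis t)) * f t)"
  proof (rule Bochner_Integration.integrable_bound[where f="\<lambda>t. of_real K * f t"])
    show "(\<lambda>t. complex_of_real (\<phi> (cis t)) * f t) \<in> borel_measurable circ"
      using \<phi>' f(1) by (intro borel_measurable_times) auto
    have "\<bar>\<phi> (cis t)\<bar> \<le> \<bar>K\<bar>" for t using K[of "cis t"] by simp
    then show "AE t in circ. norm (complex_of_real (\<phi> (cis t)) * f t) \<le> norm (of_real K * f t)"
      by (simp add: norm_mult mult_right_mono)
  qed (use f in auto)
  have le: "norm (LINT t|circ. complex_of_real (\<phi> (cis t)) * f t) \<le> e * (LINT t|circ. norm (f t))"
    if "e > 0" for e
  proof -
    obtain p where p: "real_polynomial_function p" "\<And>z. z \<in> sphere 0 1 \<Longrightarrow> \<bar>\<phi> z - p z\<bar> < e"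
      using Stone_Weierstrass_real_polynomial_function[OF compact_sphere \<phi> \<open>e > 0\<close>] by metis
    have P: "integrable circ (\<lambda>t. complex_of_real (p (cis t)) * f t)"
      "fcoefc (\<lambda>t. complex_of_real (p (cis t)) * f t) 0 = 0"
      using zero_fcoefc_mult_polynomial[OF p(1) f(1)] f(2) by auto
    have "(LINT t|circ. complex_of_real (\<phi> (cis t)) * f t)
        = (LINT t|circ. complex_of_real (\<phi> (cis t)) * f t - complex_of_real (p (cis t)) * f t)"
      using P int\<phi> by (simp add: fcoefc_0_eq)
    also have "\<dots> = (LINT t|circ. complex_of_real (\<phi> (cis t) - p (cis t)) * f t)"
      by (simp add: algebra_simps)
    also have "norm \<dots> \<le> (LINT t|circ. e * norm (f t))"
    proof (rule Bochner_Integration.integral_norm_bound_integral)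
      show "integrable circ (\<lambda>t. complex_of_real (\<phi> (cis t) - p (cis t)) * f t)"
        using Bochner_Integration.integrable_diff[OF int\<phi> P(1)] by (simp add: algebra_simps)
      show "integrable circ (\<lambda>t. e * norm (f t))" using f by simp
      show "norm (complex_of_real (\<phi> (cis t) - p (cis t)) * f t) \<le> e * norm (f t)" for t
        unfolding norm_mult norm_of_real using p(2)[of "cis t"] by (intro mult_right_mono) auto
    qed
    finally show ?thesis by simp
  qed
  have "norm (LINT t|circ. complex_of_real (\<phi> (cis t)) * f t) \<le> 0"
  proof (rule field_le_epsilon)
    fix e :: real assume "e > 0"
    define I where "I = (LINT t|circ. norm (f t))"
    have I: "I \<ge> 0" unfolding I_def by (rule Bochner_Integration.integral_nonneg) simp
    \<comment> \<open>The denominator \<open>I + 1\<close> instead of \<open>I\<close> covers the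
      case where the integral \<open>I\<close> vanishes.\<close>
    have "norm (LINT t|circ. complex_of_real (\<phi> (cis t)) * f t) \<le> e / (I + 1) * I"
      using le[of "e / (I+1)"] \<open>e > 0\<close> I unfolding I_def by simp
    also have "\<dots> \<le> e"
      using \<open>e > 0\<close> I by (simp add: field_simps)
    finally show "norm (LINT t|circ. complex_of_real (\<phi> (cis t)) * f t) \<le> 0 + e" by simp
  qed
  then show ?thesis by simp
qed

lemma cis_eq_imp_eq:
  assumes "cis s = cis t" "0 \<le> s" "s < 2 * pi" "0 \<le> t" "t < 2 * pi"
  shows "s = t"
proof -
  have "cos s = cos t" "sin s = sin t" using assms(1) by (auto simp: complex_eq_iff)
  then obtain n :: int where n: "s = t + 2 * pi * n" using sin_cos_eq_iff[of s t] by auto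
  then have "\<bar>2 * pi * real_of_int n\<bar> < 2 * pi" using assms by auto
  then have "\<bar>real_of_int n\<bar> < 1" by (simp add: abs_mult)
  then have "n = 0" by linarith
  then show ?thesis using n by simp
qed

text \<open>The indicator of the arc over \<open>{0..a}\<close> is a pointwise limit of continuous
  functions between 0 and 1, so dominated convergence reduces it to the continuous case.\<close>

lemma zero_fcoefc_interval:
  assumes f: "integrable circ f" "\<And>n. fcoefc f n = 0" and a: "0 \<le> a" "a < 2 * pi"
  shows "(LINT t:{..a}|circ. f t) = 0"
proof -
  have fm [measurable]: "f \<in> borel_measurable circ" using f by auto
  define C where "C = cis ` {0..a}"
  have C: "closed C" "C \<noteq> {}"
    unfolding C_def using a
    by (auto intro!: compact_imp_closed compact_continuous_image continuous_intros)
  \<comment> \<open>Lipschitz cut-offs: 1 on the arc, 0 at distance \<open>1 / n\<close> and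
    beyond.\<close>
  define \<phi> where "\<phi> n z = max 0 (1 - real n * infdist z C)" for n z
  have \<phi>c: "continuous_on S (\<phi> n)" for n S
    unfolding \<phi>_def by (intro continuous_intros)
  have \<phi>m: "(\<lambda>t. complex_of_real (\<phi> n (cis t))) \<in> borel_measurable circ" for n
    by (intro continuous_imp_measurable_on_sets_lebesgue continuous_intros
        continuous_on_compose2[OF \<phi>c[of UNIV]]) auto
  have \<phi>lim: "(\<lambda>n. \<phi> n z) \<longlonglongrightarrow> indicator C z" for z
  proof (cases "z \<in> C")
    case True
    then show ?thesis by (simp add: \<phi>_def)
  next
    case False
    then have d: "infdist z C > 0"
      using C infdist_nonneg[of z C] in_closed_iff_infdist_zero[OF C] by (metis less_eq_real_def)
    then obtain N where N: "real N * infdist z C > 1"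
      using reals_Archimedean3[of "infdist z C"] by auto
    have "\<phi> n z = 0" if "n \<ge> N" for n
    proof -
      have "real N * infdist z C \<le> real n * infdist z C" using that d by (intro mult_right_mono) auto
      then show ?thesis using N by (simp add: \<phi>_def)
    qed
    then show ?thesis using False
      by (intro tendsto_eventually) (auto simp: eventually_sequentially)
  qed
  have "(\<lambda>n. LINT t|circ. complex_of_real (\<phi> n (cis t)) * f t) \<longlonglongrightarrow>
        (LINT t|circ. indicator {..a} t *\<^sub>R f t)"
  proof (rule integral_dominated_convergence[where w="\<lambda>t. norm (f t)"])
    \<comment> \<open>At \<open>t = 2 * pi\<close> the point \<open>cis t = 1\<close> lies on the
      arc although \<open>t\<close> exceeds \<open>a\<close>; this single point has to be
      discarded.\<close>
    have ae: "AE t in circ. t \<noteq> 2 * pi"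
      using AE_completion[OF AE_lborel_singleton, of "2*pi"]
      by (subst AE_restrict_space_iff) (auto elim: AE_mp)
    show "AE t in circ. (\<lambda>n. complex_of_real (\<phi> n (cis t)) * f t) \<longlonglongrightarrow> indicator {..a} t *\<^sub>R f t"
    proof (rule AE_mp[OF ae], rule AE_I2, rule impI)
      fix t assume t: "t \<in> space circ" "t \<noteq> 2 * pi"
      have "cis t \<in> C \<longleftrightarrow> t \<in> {..a}"
        using t a cis_eq_imp_eq[of t] by (force simp: C_def)
      then have *: "indicator C (cis t) = (indicator {..a} t :: real)" by (simp add: indicator_def)
      have "(\<lambda>n. complex_of_real (\<phi> n (cis t)) * f t) \<longlonglongrightarrow> complex_of_real (indicator C (cis t)) * f t"
        by (intro tendsto_intros \<phi>lim)
      then show "(\<lambda>n. complex_of_real (\<phi> n (cis t)) * f t) \<longlonglongrightarrow> indicator {..a} t *\<^sub>R f t"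
        by (simp add: * scaleR_conv_of_real)
    qed
    have "\<bar>\<phi> n z\<bar> \<le> 1" for n z by (auto simp: \<phi>_def infdist_nonneg)
    then show "AE t in circ. norm (complex_of_real (\<phi> n (cis t)) * f t) \<le> norm (f t)" for n
      by (auto simp: norm_mult mult_left_le_one_le)
    show "(\<lambda>t. complex_of_real (\<phi> n (cis t)) * f t) \<in> borel_measurable circ" for n
      using \<phi>m fm by (rule borel_measurable_times)
    show "(\<lambda>t. indicator {..a} t *\<^sub>R f t) \<in> borel_measurable circ"
    proof (intro borel_measurable_scaleR fm)
      have "indicator {..a} \<in> borel_measurable lebesgue"
        by (intro borel_measurable_indicator) auto
      then show "(indicator {..a} :: real \<Rightarrow> real) \<in> borel_measurable circ"
        by (rule measurable_restrict_space1)
    qed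
    show "integrable circ (\<lambda>t. norm (f t))" using f by simp
  qed
  moreover have "(LINT t|circ. complex_of_real (\<phi> n (cis t)) * f t) = 0" for n
    using f by (intro zero_fcoefc_continuous \<phi>c)
  ultimately have "(LINT t|circ. indicator {..a} t *\<^sub>R f t) = 0"
    by (simp add: LIMSEQ_const_iff)
  then show ?thesis by (simp add: set_lebesgue_integral_def)
qed

text \<open>Initial segments form an intersection-stable generator of the Borel sets, so the
  vanishing of integrals spreads from them to all Borel sets, and up to null sets to all Lebesgue
  sets.\<close>

theorem fcoefc_zero_imp_AE_zero:
  assumes f: "integrable circ f" "\<And>n. fcoefc f n = 0"
  shows "AE t in circ. f t = 0"
proof -
  interpret finite_measure circ by (rule finite_measure_circ)
  have setI: "A \<inter> {0..2*pi} \<in> sets circ" if "A \<in> sets borel" for A :: "real set"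
    using that by (auto simp: sets_restrict_space)
  have si: "set_integrable circ B f" if "B \<in> sets circ" for B
    unfolding set_integrable_def using f(1) that by (intro integrable_mult_indicator)
  have all: "(LINT t:{0..2*pi}|circ. f t) = 0"
  proof -
    have "(LINT t:{0..2*pi}|circ. f t) = (LINT t|circ. f t)"
      unfolding set_lebesgue_integral_def by (intro Bochner_Integration.integral_cong) auto
    then show ?thesis using f(2)[of 0] by (simp add: fcoefc_0_eq)
  qed
  have borel: "(LINT t:A \<inter> {0..2*pi}|circ. f t) = 0" if "A \<in> sets borel" for A :: "real set"
  proof -
    have "Int_stable (range (\<lambda>a::real. {..a}))" "range (\<lambda>a::real. {..a}) \<subseteq> Pow UNIV"
      by (force simp: Int_stable_def image_iff)+
    moreover have "A \<in> sigma_sets UNIV (range (\<lambda>a::real. {..a}))"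
      using that by (simp add: borel_eq_atMost)
    ultimately show ?thesis
    proof (induction rule: sigma_sets_induct_disjoint)
      case (basic A)
      then obtain a where a: "A = {..a}" by auto
      consider "a < 0" | "0 \<le> a" "a < 2 * pi" | "a \<ge> 2 * pi" by linarith
      then show ?case
      proof cases
        case 1
        then have "A \<inter> {0..2*pi} = {}" using a by auto
        then show ?thesis by (simp add: set_lebesgue_integral_def)
      next
        case 2
        have "(LINT t:A \<inter> {0..2*pi}|circ. f t) = (LINT t:{..a}|circ. f t)"
          unfolding set_lebesgue_integral_def a
          by (intro Bochner_Integration.integral_cong) (auto split: split_indicator)
        then show ?thesis using zero_fcoefc_interval[OF f 2] by simp
      next
        case 3
        then have "A \<inter> {0..2*pi} = {0..2*pi}" using a by auto
        then show ?thesis using all by simp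
      qed
    next
      case empty
      then show ?case by (simp add: set_lebesgue_integral_def)
    next
      case (compl A)
      then have A: "A \<in> sets borel" by (simp add: borel_eq_atMost)
      have "(LINT t:(A \<inter> {0..2*pi}) \<union> ((UNIV - A) \<inter> {0..2*pi})|circ. f t)
          = (LINT t:A \<inter> {0..2*pi}|circ. f t) + (LINT t:(UNIV - A) \<inter> {0..2*pi}|circ. f t)"
        using A by (intro set_integral_Un si setI) auto
      moreover have "(A \<inter> {0..2*pi}) \<union> ((UNIV - A) \<inter> {0..2*pi}) = {0..2*pi}" by auto
      ultimately show ?case using compl all by simp
    next
      case (union A)
      then have A: "A i \<in> sets borel" for i by (auto simp: borel_eq_atMost)
      have eq: "(\<Union>i. A i) \<inter> {0..2*pi} = (\<Union>i. A i \<inter> {0..2*pi})" by auto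
      have z: "(LINT t:A i \<inter> {0..2*pi}|circ. f t) = 0" for i using union.IH by blast
      have "(LINT t:(\<Union>i. A i \<inter> {0..2*pi})|circ. f t) = (\<Sum>i. (LINT t:A i \<inter> {0..2*pi}|circ. f t))"
      proof (rule lebesgue_integral_countable_add)
        show "set_integrable circ (\<Union>i. A i \<inter> {0..2*pi}) f"
          using A setI by (intro si sets.countable_UN) blast
        show "A i \<inter> {0..2*pi} \<inter> (A j \<inter> {0..2*pi}) = {}" if "i \<noteq> j" for i j
          using union that by (auto simp: disjoint_family_on_def)
      qed (use A setI in blast)
      then show ?case unfolding eq z suminf_zero .
    qed
  qed
  show ?thesis
  proof (rule density_zero[OF f(1)])
    fix A assume "A \<in> sets circ"
    then have A: "A \<in> sets lebesgue" "A \<subseteq> {0..2*pi}" by (auto simp: sets_restrict_space)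
    \<comment> \<open>A Lebesgue set is a Borel set together with a part of a Borel null set; only
      the Borel part matters for the integral.\<close>
    then obtain S N N' where S: "A = S \<union> N" "N \<subseteq> N'" "N' \<in> null_sets lborel" "S \<in> sets lborel"
      by (auto elim: sets_completionE)
    have "AE t in lebesgue. t \<notin> N'"
      using S(3) by (intro AE_not_in) (simp add: null_sets_completionI)
    then have "AE t in circ. t \<notin> N'"
      by (subst AE_restrict_space_iff) (auto elim: AE_mp)
    then have "AE t in circ. t \<in> A \<longleftrightarrow> t \<in> S \<inter> {0..2*pi}"
      using S A by (auto elim!: AE_mp)
    then have "(LINT t:S \<inter> {0..2*pi}|circ. f t) = (LINT t:A|circ. f t)"
      using si[OF setI[of S]] si[OF \<open>A \<in> sets circ\<close>] S
      by (intro set_integral_cong_set) (auto simp: set_borel_measurable_def set_integrable_def)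
    then show "(LINT t:A|circ. f t) = 0" using borel[of S] S by simp
  qed
qed

corollary fcoefc_eq_imp_AE_eq:
  assumes "integrable circ f" "integrable circ g" "\<And>n. fcoefc f n = fcoefc g n"
  shows "AE t in circ. f t = g t"
  using fcoefc_zero_imp_AE_zero[of "\<lambda>t. f t - g t"] assms by (simp add: fcoefc_diff)

section \<open>The Riesz--Fischer theorem and Parseval's identity\<close>

text \<open>Cauchy-Schwarz against the constant 1, obtained from a weighted arithmetic-geometric
  inequality: with weight \<open>d\<close> both terms contribute at most
  \<open>pi * d\<close>.\<close>

lemma cauchy_schwarz_circ:
  assumes "f \<in> L2fun" "(LINT t|circ. (cmod (f t))^2) \<le> 2 * pi * d^2" "d > 0"
  shows "(LINT t|circ. cmod (f t)) \<le> 2 * pi * d"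
proof -
  have "(LINT t|circ. cmod (f t)) \<le> (LINT t|circ. (cmod (f t))^2 / (2 * d) + d / 2)"
  proof (rule integral_mono)
    show "integrable circ (\<lambda>t. cmod (f t))" using L2fun_integrable[OF assms(1)] by simp
    show "integrable circ (\<lambda>t. (cmod (f t))^2 / (2 * d) + d / 2)"
      using L2fun_square[OF assms(1)] by simp
    fix t
    have "2 * d * cmod (f t) \<le> (cmod (f t))^2 + d^2"
      using zero_le_power2[of "cmod (f t) - d"] by (simp add: power2_diff mult_ac)
    then show "cmod (f t) \<le> (cmod (f t))^2 / (2 * d) + d / 2"
      using \<open>d > 0\<close> by (simp add: field_simps power2_eq_square)
  qed
  also have "\<dots> = (LINT t|circ. (cmod (f t))^2) / (2 * d) + 2 * pi * (d / 2)"
    using L2fun_square[OF assms(1)] measure_circ by simp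
  also have "\<dots> \<le> 2 * pi * d^2 / (2 * d) + 2 * pi * (d / 2)"
    using assms by (intro add_right_mono divide_right_mono) auto
  also have "\<dots> = 2 * pi * d" using \<open>d > 0\<close> by (simp add: power2_eq_square)
  finally show ?thesis .
qed

lemma nn_integral_L2:
  assumes "f \<in> L2fun"
  shows "(\<integral>\<^sup>+t. ennreal ((cmod (f t))^2) \<partial>circ) = ennreal (LINT t|circ. (cmod (f t))^2)"
  by (rule nn_integral_eq_integral) (use L2fun_square[OF assms] in auto)

text \<open>A fast Cauchy sequence in \<open>L\<^sup>2\<close> converges almost everywhere, and Fatou's lemma identifies
  the pointwise limit with the limit in \<open>L\<^sup>2\<close>.\<close>

lemma L2_fast_cauchy_limit:
  fixes S :: "nat \<Rightarrow> real \<Rightarrow> complex"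
  assumes S: "\<And>n. S n \<in> L2fun"
    and le: "\<And>m n. m \<le> n \<Longrightarrow> (LINT t|circ. (cmod (S n t - S m t))^2) \<le> 2 * pi * ((1/2)^m)^2"
  obtains f where "f \<in> L2fun"
    "\<And>m. (LINT t|circ. (cmod (f t - S m t))^2) \<le> 2 * pi * ((1/2)^m)^2"
proof -
  have Sm [measurable]: "S n \<in> borel_measurable circ" for n using S by (rule L2fun_measurable)
  define D where "D n t = S (Suc n) t - S n t" for n t
  have D: "D n \<in> L2fun" for n unfolding D_def by (intro L2fun_diff S)
  have Dm [measurable]: "D n \<in> borel_measurable circ" for n using D by (rule L2fun_measurable)
  have "(\<integral>\<^sup>+t. (\<Sum>n. ennreal (cmod (D n t))) \<partial>circ) = (\<Sum>n. \<integral>\<^sup>+t. ennreal (cmod (D n t)) \<partial>circ)"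
    by (rule nn_integral_suminf) simp
  also have "\<dots> \<le> (\<Sum>n. ennreal (2 * pi * (1/2)^n))"
  proof (intro suminf_le)
    fix n
    have "(\<integral>\<^sup>+t. ennreal (cmod (D n t)) \<partial>circ) = ennreal (LINT t|circ. cmod (D n t))"
      by (rule nn_integral_eq_integral) (use L2fun_integrable[OF D] in auto)
    also have "\<dots> \<le> ennreal (2 * pi * (1/2)^n)"
      using cauchy_schwarz_circ[OF D[of n], of "(1/2)^n"] le[of n "Suc n"]
      by (intro ennreal_leI) (simp add: D_def)
    finally show "(\<integral>\<^sup>+t. ennreal (cmod (D n t)) \<partial>circ) \<le> ennreal (2 * pi * (1/2)^n)" .
  qed auto
  also have "\<dots> = ennreal (\<Sum>n. 2 * pi * (1/2)^n)"
    by (rule suminf_ennreal2) (auto intro!: summable_mult summable_geometric)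
  also have "\<dots> < \<infinity>" by simp
  finally have fin: "(\<integral>\<^sup>+t. (\<Sum>n. ennreal (cmod (D n t))) \<partial>circ) \<noteq> \<infinity>" by simp
  have "AE t in circ. (\<Sum>n. ennreal (cmod (D n t))) \<noteq> \<infinity>"
    by (rule nn_integral_PInf_AE[OF _ fin]) simp
  then have sum: "AE t in circ. summable (\<lambda>n. D n t)"
    by eventually_elim (rule summable_norm_cancel[OF summable_suminf_not_top]; simp)
  define f where "f t = S 0 t + (\<Sum>n. D n t)" for t
  have fm [measurable]: "f \<in> borel_measurable circ" unfolding f_def[abs_def] by measurable
  have tele: "S 0 t + (\<Sum>i<n. D i t) = S n t" for n t
    by (induction n) (simp_all add: D_def flip: add.assoc)
  have lim: "AE t in circ. (\<lambda>n. S n t) \<longlonglongrightarrow> f t"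
    using sum
  proof eventually_elim
    case (elim t)
    have "(\<lambda>n. S 0 t + (\<Sum>i<n. D i t)) \<longlonglongrightarrow> f t"
      unfolding f_def by (intro tendsto_intros summable_LIMSEQ elim)
    then show ?case by (simp add: tele)
  qed
  have nn: "(\<integral>\<^sup>+t. ennreal ((cmod (f t - S m t))^2) \<partial>circ) \<le> ennreal (2 * pi * ((1/2)^m)^2)" for m
  proof -
    have "(\<integral>\<^sup>+t. ennreal ((cmod (f t - S m t))^2) \<partial>circ)
        = (\<integral>\<^sup>+t. liminf (\<lambda>n. ennreal ((cmod (S n t - S m t))^2)) \<partial>circ)"
    proof (rule nn_integral_cong_AE)
      show "AE t in circ. ennreal ((cmod (f t - S m t))^2) = liminf (\<lambda>n. ennreal ((cmod (S n t - S m t))^2))"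
        using lim
      proof eventually_elim
        case (elim t)
        have "(\<lambda>n. ennreal ((cmod (S n t - S m t))^2)) \<longlonglongrightarrow> ennreal ((cmod (f t - S m t))^2)"
          by (intro tendsto_ennrealI tendsto_intros elim)
        then show ?case by (rule lim_imp_Liminf[OF sequentially_bot, symmetric])
      qed
    qed
    also have "\<dots> \<le> liminf (\<lambda>n. \<integral>\<^sup>+t. ennreal ((cmod (S n t - S m t))^2) \<partial>circ)"
      by (rule nn_integral_liminf) simp
    also have "\<dots> \<le> ennreal (2 * pi * ((1/2)^m)^2)"
    proof (rule Liminf_le)
      show "\<forall>\<^sub>F n in sequentially. (\<integral>\<^sup>+t. ennreal ((cmod (S n t - S m t))^2) \<partial>circ) \<le> ennreal (2 * pi * ((1/2)^m)^2)"
        using eventually_ge_at_top[of m]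
      proof eventually_elim
        case (elim n)
        then show ?case
          using le[OF elim] nn_integral_L2[OF L2fun_diff[OF S S], of n m] by (simp add: ennreal_leI)
      qed
    qed simp
    finally show ?thesis .
  qed
  have diff: "(\<lambda>t. f t - S m t) \<in> L2fun" for m
  proof -
    have "integrable circ (\<lambda>t. (cmod (f t - S m t))^2)"
      using nn[of m] by (intro integrableI_bounded) (auto intro: le_less_trans)
    then show ?thesis by (simp add: L2fun_def)
  qed
  have "f \<in> L2fun" using L2fun_add[OF diff[of 0] S[of 0]] by simp
  moreover have "(LINT t|circ. (cmod (f t - S m t))^2) \<le> 2 * pi * ((1/2)^m)^2" for m
    using nn[of m] nn_integral_L2[OF diff[of m]] by (simp add: ennreal_le_iff)
  ultimately show ?thesis using that by blast
qed

lemma trigsum_diff: "B \<subseteq> A \<Longrightarrow> finite A \<Longrightarrow> trigsum c A t - trigsum c B t = trigsum c (A - B) t"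
  by (simp add: trigsum_def sum_diff)

lemma integral_trigsum_square:
  assumes "finite A"
  shows "(LINT t|circ. (cmod (trigsum c A t))^2) = 2 * pi * (\<Sum>k\<in>A. (cmod (c k))^2)"
proof -
  have eq: "trigsum (fcoefc (trigsum c A)) A = trigsum c A"
    by (auto simp: trigsum_def[of "fcoefc (trigsum c A)"] trigsum_def[of c] fcoefc_trigsum[OF assms] fun_eq_iff
        simp del: fcoefc_zero)
  have "0 = (LINT t|circ. (cmod (trigsum c A t))^2) - 2 * pi * (\<Sum>k\<in>A. (cmod (fcoefc (trigsum c A) k))^2)"
    using integral_minus_trigsum[OF trigsum_L2 assms, of c A] by (simp add: eq)
  then show ?thesis by (simp add: fcoefc_trigsum[OF assms])
qed

text \<open>Trigonometric sums over finite sets with geometrically small tails form a fast Cauchy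
  sequence. The norm identity is part of the conclusion because Parseval's identity is derived from
  it.\<close>

theorem riesz_fischer:
  assumes c: "(\<lambda>k::int. (cmod (c k))^2) summable_on UNIV"
  obtains f where "f \<in> L2fun" "fcoefc f = c"
    "(LINT t|circ. (cmod (f t))^2) = 2 * pi * (\<Sum>\<^sub>\<infinity>k. (cmod (c k))^2)"
proof -
  let ?s = "\<lambda>A. \<Sum>k\<in>A. (cmod (c k))^2" and ?I = "\<Sum>\<^sub>\<infinity>k. (cmod (c k))^2"
  have lim: "(?s \<longlongrightarrow> ?I) (finite_subsets_at_top UNIV)"
    using c by (simp add: has_sum_infsum flip: has_sum_def)
  have le: "?s A \<le> ?I" if "finite A" for A
    using that c by (intro finite_sum_le_infsum) auto
  have "\<exists>A. finite A \<and> ?I - ?s A < e" if "e > 0" for e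
    using tendstoD[OF lim that] le
    by (auto simp: eventually_finite_subsets_at_top dist_real_def abs_minus_commute)
  then have "\<forall>n. \<exists>A. finite A \<and> ?I - ?s A < ((1/2)^n)^2" by simp
  then obtain A0 where A0: "\<And>n. finite (A0 n)" "\<And>n. ?I - ?s (A0 n) < ((1/2)^n)^2" by metis
  \<comment> \<open>The union over \<open>m \<le> n\<close> makes the sets increase, and the
    interval \<open>{- int n..int n}\<close> puts every index into all sets from some point
    on.\<close>
  define A where "A n = (\<Union>m\<le>n. A0 m) \<union> {- int n..int n}" for n
  have fA: "finite (A n)" for n using A0(1) by (simp add: A_def)
  have mono: "A m \<subseteq> A n" if "m \<le> n" for m n
    using that by (force simp: A_def)
  have As: "?I - ?s (A n) < ((1/2)^n)^2" for n
  proof -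
    have "?s (A0 n) \<le> ?s (A n)" using fA by (intro sum_mono2) (auto simp: A_def)
    then show ?thesis using A0(2)[of n] by linarith
  qed
  define S where "S n = trigsum c (A n)" for n
  have SL: "S n \<in> L2fun" for n unfolding S_def by (rule trigsum_L2)
  have Scauchy: "(LINT t|circ. (cmod (S n t - S m t))^2) \<le> 2 * pi * ((1/2)^m)^2" if "m \<le> n" for m n
  proof -
    have "(LINT t|circ. (cmod (S n t - S m t))^2) = 2 * pi * ?s (A n - A m)"
      unfolding S_def using trigsum_diff[OF mono[OF that] fA] integral_trigsum_square fA by simp
    also have "?s (A n - A m) = ?s (A n) - ?s (A m)"
      using mono[OF that] fA by (intro sum_diff) auto
    also have "\<dots> \<le> ((1/2)^m)^2" using le[OF fA[of n]] As[of m] by linarith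
    finally show ?thesis by simp
  qed
  obtain f where f: "f \<in> L2fun"
    "\<And>m. (LINT t|circ. (cmod (f t - S m t))^2) \<le> 2 * pi * ((1/2)^m)^2"
    using L2_fast_cauchy_limit[of S, OF SL Scauchy] by blast
  have pow: "(\<lambda>m. C * ((1/2)^m)) \<longlonglongrightarrow> 0" for C :: real
    by (intro tendsto_mult_right_zero LIMSEQ_power_zero) simp
  have coef: "fcoefc f k = c k" for k
  proof -
    have "(\<lambda>m. cmod (fcoefc f k - c k)) \<longlonglongrightarrow> 0"
    proof (rule tendsto_sandwich[OF _ _ tendsto_const pow[of 1]])
      show "\<forall>\<^sub>F m in sequentially. cmod (fcoefc f k - c k) \<le> 1 * (1/2)^m"
        using eventually_ge_at_top[of "nat \<bar>k\<bar>"]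
      proof eventually_elim
        case (elim m)
        then have k: "k \<in> A m" by (auto simp: A_def)
        have d: "(\<lambda>t. f t - S m t) \<in> L2fun" unfolding S_def by (intro L2fun_diff f trigsum_L2)
        have "fcoefc f k - c k = fcoefc (\<lambda>t. f t - S m t) k"
          using k unfolding S_def
          by (subst fcoefc_diff) (auto intro: L2fun_integrable f trigsum_L2 simp: fcoefc_trigsum fA)
        also have "cmod \<dots> \<le> 1 / (2 * pi) * (LINT t|circ. cmod (f t - S m t))"
          by (intro norm_fcoefc_le L2fun_integrable d)
        also have "\<dots> \<le> 1 / (2 * pi) * (2 * pi * (1/2)^m)"
          by (intro mult_left_mono cauchy_schwarz_circ d f(2)) auto
        finally show ?case by simp
      qed
    qed auto
    then show ?thesis by (simp add: LIMSEQ_const_iff)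
  qed
  moreover have "(LINT t|circ. (cmod (f t))^2) = 2 * pi * ?I"
  proof -
    have eq: "(LINT t|circ. (cmod (f t))^2) = (LINT t|circ. (cmod (f t - S m t))^2) + 2 * pi * ?s (A m)" for m
      using integral_minus_trigsum[OF f(1) fA[of m]] unfolding S_def ext[of "fcoefc f" c, OF coef] by simp
    have "(\<lambda>m. \<bar>(LINT t|circ. (cmod (f t))^2) - 2 * pi * ?I\<bar>) \<longlonglongrightarrow> 0"
    proof (rule tendsto_sandwich[OF _ _ tendsto_const])
      show "(\<lambda>m. (2 * pi * (1/2)^m) * (1/2)^m) \<longlonglongrightarrow> 0"
        using tendsto_mult[OF pow[of "2*pi"] pow[of 1]] by simp
      have "\<bar>(LINT t|circ. (cmod (f t))^2) - 2 * pi * ?I\<bar> \<le> (2 * pi * (1/2)^m) * (1/2)^m" for m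
      proof -
        have "2 * pi * ?s (A m) \<le> 2 * pi * ?I" "2 * pi * (?I - ?s (A m)) \<le> 2 * pi * ((1/2)^m)^2"
          using le[OF fA[of m]] As[of m] by (auto intro!: mult_left_mono)
        moreover have "0 \<le> (LINT t|circ. (cmod (f t - S m t))^2)"
          by (rule Bochner_Integration.integral_nonneg) simp
        ultimately show ?thesis
          using eq[of m] f(2)[of m] unfolding abs_le_iff right_diff_distrib power2_eq_square mult.assoc
          by linarith
      qed
      then show "\<forall>\<^sub>F m in sequentially. \<bar>(LINT t|circ. (cmod (f t))^2) - 2 * pi * ?I\<bar> \<le> (2 * pi * (1/2)^m) * (1/2)^m"
        by simp
    qed auto
    then show ?thesis by (simp add: LIMSEQ_const_iff)
  qed
  ultimately show ?thesis using that[OF f(1) ext] by blast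
qed

text \<open>Bessel gives summability. Riesz-Fischer then produces a function with the same
  coefficients and the right norm, which equals \<open>f\<close> almost everywhere by
  uniqueness.\<close>

theorem parseval:
  assumes f: "f \<in> L2fun"
  shows "(\<lambda>k. (cmod (fcoefc f k))^2) summable_on UNIV"
    "(LINT t|circ. (cmod (f t))^2) = 2 * pi * (\<Sum>\<^sub>\<infinity>k. (cmod (fcoefc f k))^2)"
proof -
  show sum: "(\<lambda>k. (cmod (fcoefc f k))^2) summable_on UNIV"
  proof (rule nonneg_bdd_above_summable_on)
    have "(\<Sum>k\<in>F. (cmod (fcoefc f k))^2) \<le> (LINT t|circ. (cmod (f t))^2) / (2 * pi)" if "finite F" for F
      using bessel[OF f that] by (simp add: pos_le_divide_eq mult.commute)
    then show "bdd_above (sum (\<lambda>k. (cmod (fcoefc f k))^2) ` {F. F \<subseteq> UNIV \<and> finite F})"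
      by (intro bdd_aboveI[where M="(LINT t|circ. (cmod (f t))^2) / (2 * pi)"]) (elim imageE; simp)
  qed simp
  obtain g where g: "g \<in> L2fun" "fcoefc g = fcoefc f"
    "(LINT t|circ. (cmod (g t))^2) = 2 * pi * (\<Sum>\<^sub>\<infinity>k. (cmod (fcoefc f k))^2)"
    using riesz_fischer[OF sum] by metis
  have "AE t in circ. f t = g t"
    by (rule fcoefc_eq_imp_AE_eq) (auto intro: L2fun_integrable f g simp: g(2))
  then have "(LINT t|circ. (cmod (f t))^2) = (LINT t|circ. (cmod (g t))^2)"
    using L2fun_square[OF f] L2fun_square[OF g(1)] by (intro integral_cong_AE) auto
  then show "(LINT t|circ. (cmod (f t))^2) = 2 * pi * (\<Sum>\<^sub>\<infinity>k. (cmod (fcoefc f k))^2)"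
    using g(3) by simp
qed

lemma parseval_has_sum:
  assumes "f \<in> L2fun"
  shows "((\<lambda>k. (cmod (fcoefc f k))^2) has_sum (LINT t|circ. (cmod (f t))^2) / (2*pi)) UNIV"
  using has_sum_infsum[OF parseval(1)[OF assms]] unfolding parseval(2)[OF assms] by simp

lemma cnj_polarization:
  fixes a b :: complex
  shows "a * cnj b = (of_real ((cmod (a + b))^2) - of_real ((cmod (a - b))^2)
     + \<i> * of_real ((cmod (a + \<i> * b))^2) - \<i> * of_real ((cmod (a - \<i> * b))^2)) / 4"
  unfolding cmod_power2 by (simp add: complex_eq_iff power2_eq_square algebra_simps)

lemma has_sum_diff:
  fixes f g :: "'a \<Rightarrow> 'b::topological_ab_group_add"
  assumes "(f has_sum a) A" "(g has_sum b) A"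
  shows "((\<lambda>x. f x - g x) has_sum (a - b)) A"
  using has_sum_add[OF assms(1), of "\<lambda>x. - g x" "- b"] assms(2) by (simp add: has_sum_uminus)

lemma has_sum_sum:
  fixes f :: "'i \<Rightarrow> 'a \<Rightarrow> 'b::topological_comm_monoid_add"
  assumes "\<And>i. i \<in> I \<Longrightarrow> (f i has_sum a i) A"
  shows "((\<lambda>x. \<Sum>i\<in>I. f i x) has_sum (\<Sum>i\<in>I. a i)) A"
  using assms by (induction I rule: infinite_finite_induct) (auto intro: has_sum_add)

theorem parseval_inner:
  assumes f: "f \<in> L2fun" and g: "g \<in> L2fun"
  shows "((\<lambda>k. fcoefc f k * cnj (fcoefc g k)) has_sum (LINT t|circ. f t * cnj (g t)) / (2*pi)) UNIV"
proof -
  have ig: "(\<lambda>t. \<i> * g t) \<in> L2fun" by (rule L2fun_cmult[OF g])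
  note L = L2fun_add[OF f g] L2fun_diff[OF f g] L2fun_add[OF f ig] L2fun_diff[OF f ig]
  note I = L2fun_integrable[OF f] L2fun_integrable[OF g] L2fun_integrable[OF ig]
  let ?q = "\<lambda>h. (LINT t|circ. (cmod (h t))^2)"
  have cdiv: "(h has_sum S) UNIV \<Longrightarrow> ((\<lambda>k. h k / 4) has_sum S / 4) UNIV" for h :: "int \<Rightarrow> complex" and S
    using has_sum_cmult_left[of h UNIV S "1/4"] by simp
  have hs: "((\<lambda>k. (of_real ((cmod (fcoefc (\<lambda>t. f t + g t) k))^2)
      - of_real ((cmod (fcoefc (\<lambda>t. f t - g t) k))^2)
      + \<i> * of_real ((cmod (fcoefc (\<lambda>t. f t + \<i> * g t) k))^2)
      - \<i> * of_real ((cmod (fcoefc (\<lambda>t. f t - \<i> * g t) k))^2)) / 4) has_sum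
     (of_real (?q (\<lambda>t. f t + g t) / (2*pi)) - of_real (?q (\<lambda>t. f t - g t) / (2*pi))
      + \<i> * of_real (?q (\<lambda>t. f t + \<i> * g t) / (2*pi)) - \<i> * of_real (?q (\<lambda>t. f t - \<i> * g t) / (2*pi))) / 4) UNIV"
    by (intro cdiv has_sum_diff has_sum_add has_sum_cmult_right has_sum_of_real
        parseval_has_sum L)
  have eq1: "(of_real ((cmod (fcoefc (\<lambda>t. f t + g t) k))^2)
      - of_real ((cmod (fcoefc (\<lambda>t. f t - g t) k))^2)
      + \<i> * of_real ((cmod (fcoefc (\<lambda>t. f t + \<i> * g t) k))^2)
      - \<i> * of_real ((cmod (fcoefc (\<lambda>t. f t - \<i> * g t) k))^2)) / 4 = fcoefc f k * cnj (fcoefc g k)" for k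
    using I by (simp add: fcoefc_add fcoefc_diff fcoefc_cmult cnj_polarization[of "fcoefc f k"])
  have int: "integrable circ (\<lambda>t. complex_of_real ((cmod (f t + g t))^2))"
    "integrable circ (\<lambda>t. complex_of_real ((cmod (f t - g t))^2))"
    "integrable circ (\<lambda>t. complex_of_real ((cmod (f t + \<i> * g t))^2))"
    "integrable circ (\<lambda>t. complex_of_real ((cmod (f t - \<i> * g t))^2))"
    using L[THEN L2fun_square] by (auto simp del: of_real_power)
  have "(LINT t|circ. f t * cnj (g t)) = (of_real (?q (\<lambda>t. f t + g t)) - of_real (?q (\<lambda>t. f t - g t))
      + \<i> * of_real (?q (\<lambda>t. f t + \<i> * g t)) - \<i> * of_real (?q (\<lambda>t. f t - \<i> * g t))) / 4"
    unfolding cnj_polarization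
    using int by (simp del: of_real_power add: integral_complex_of_real)
  then show ?thesis using hs unfolding eq1 by (simp add: diff_divide_distrib add_divide_distrib mult.commute)
qed

text \<open>The convolution is the inner product of \<open>g\<close> with the conjugate of
  \<open>f\<close> modulated by \<open>cis (n t)\<close>, so it is an instance of
  \<open>parseval_inner\<close>.\<close>

theorem fcoefc_mult:
  assumes f: "f \<in> L2fun" and g: "g \<in> L2fun"
  shows "((\<lambda>k. fcoefc f (n - k) * fcoefc g k) has_sum fcoefc (\<lambda>t. f t * g t) n) UNIV"
proof -
  let ?h = "\<lambda>t. cis (of_int n * t) * cnj (f t)"
  have h: "?h \<in> L2fun" by (intro L2fun_cis_mult L2fun_cnj f)
  have "fcoefc g k * cnj (fcoefc ?h k) = fcoefc f (n - k) * fcoefc g k" for k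
    unfolding fcoefc_cis_mult fcoefc_cnj by (simp add: mult.commute)
  moreover have "(LINT t|circ. g t * cnj (?h t)) / (2*pi) = fcoefc (\<lambda>t. f t * g t) n"
    by (simp add: fcoefc_def cis_cnj mult_ac)
  ultimately show ?thesis using parseval_inner[OF g h] by presburger
qed

section \<open>Square-summable sequences\<close>

definition hdot :: "complex^'n \<Rightarrow> complex^'n \<Rightarrow> complex" where
  "hdot x y = (\<Sum>i\<in>UNIV. x $ i * cnj (y $ i))"

lemma norm_vec_square: "(norm (x::'a::real_normed_vector^'n))^2 = (\<Sum>i\<in>UNIV. (norm (x $ i))^2)"
  by (simp add: norm_vec_def L2_set_def sum_nonneg)

lemma hdot_self: "hdot x x = of_real ((norm x)^2)"
  unfolding hdot_def norm_vec_square of_real_sum complex_norm_square ..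

lemma hdot_add_left: "hdot (x + y) z = hdot x z + hdot y z"
  and hdot_scale_left: "hdot (a *s x) z = a * hdot x z"
  and hdot_cnj: "cnj (hdot x z) = hdot z x"
  and hdot_zero_left [simp]: "hdot 0 x = 0"
  and hdot_zero_right [simp]: "hdot x 0 = 0"
  by (auto simp: hdot_def sum.distrib sum_distrib_left algebra_simps)

lemma norm_scale_vec: "norm (a *s (x::complex^'n)) = cmod a * norm x"
proof (rule power2_eq_imp_eq)
  show "(norm (a *s x))^2 = (cmod a * norm x)^2"
    by (simp add: norm_vec_square power_mult_distrib norm_mult sum_distrib_left)
qed auto

lemma cmod_hdot_le: "cmod (hdot x y) \<le> norm x * norm y"
proof -
  have "cmod (hdot x y) \<le> (\<Sum>i\<in>UNIV. \<bar>cmod (x $ i)\<bar> * \<bar>cmod (y $ i)\<bar>)"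
    unfolding hdot_def by (rule sum_norm_le) (simp add: norm_mult)
  also have "\<dots> \<le> norm x * norm y"
    unfolding norm_vec_def by (rule L2_set_mult_ineq)
  finally show ?thesis .
qed

lemma iprod_hdot: "iprod c d = (\<Sum>\<^sub>\<infinity>n. hdot (c n) (d n))"
  by (simp add: iprod_def hdot_def)

lemma l2D: "c \<in> l2 \<Longrightarrow> (\<lambda>n. (norm (c n))^2) summable_on UNIV"
  by (simp add: l2_def)

lemma l2_comparison:
  assumes "(\<lambda>n. f n) summable_on UNIV" "\<And>n. (norm (c n))^2 \<le> f n"
  shows "c \<in> l2"
  unfolding l2_def using summable_on_comparison_test[OF assms(1), of "\<lambda>n. (norm (c n))^2"] assms(2) by auto

lemma l2_add: "c \<in> l2 \<Longrightarrow> d \<in> l2 \<Longrightarrow> c + d \<in> l2"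
proof (rule l2_comparison[where f="\<lambda>n. 2 * (norm (c n))^2 + 2 * (norm (d n))^2"])
  assume "c \<in> l2" "d \<in> l2"
  then show "(\<lambda>n. 2 * (norm (c n))^2 + 2 * (norm (d n))^2) summable_on UNIV"
    by (intro summable_on_add summable_on_cmult_right l2D)
  show "(norm ((c + d) n))^2 \<le> 2 * (norm (c n))^2 + 2 * (norm (d n))^2" for n
    using power_mono[OF norm_triangle_ineq[of "c n" "d n"], of 2] square_add_le[of "norm (c n)" "norm (d n)"]
    unfolding plus_fun_apply by (meson norm_ge_zero order_trans)
qed

lemma l2_scale: "c \<in> l2 \<Longrightarrow> cscale a c \<in> l2"
  by (rule l2_comparison[where f="\<lambda>n. (cmod a)^2 * (norm (c n))^2"])
     (auto simp: cscale_def norm_scale_vec power_mult_distrib intro: summable_on_cmult_right l2D)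

lemma l2_zero [simp]: "0 \<in> l2"
  by (simp add: l2_def)

global_interpretation seqs: complex_vector_space "cscale :: complex \<Rightarrow> ('n::finite) seq \<Rightarrow> 'n seq"
  by unfold_locales (auto simp: cscale_def fun_eq_iff vec_eq_iff algebra_simps)

lemma cscale_minus_one: "cscale (- 1) c = - c"
  by (simp add: seqs.scale_minus_left)

lemma l2_uminus: "c \<in> l2 \<Longrightarrow> - c \<in> l2"
  using l2_scale[of c "-1"] by (simp add: cscale_minus_one)

lemma l2_diff: "c \<in> l2 \<Longrightarrow> d \<in> l2 \<Longrightarrow> c - d \<in> l2"
  using l2_add[of c "- d"] l2_uminus[of d] by simp

lemma cscale_apply: "cscale a c n = a *s c n"
  by (simp add: cscale_def)

lemma l2_restrict: "c \<in> l2 \<Longrightarrow> (\<lambda>n. if P n then c n else 0) \<in> l2"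
  by (rule l2_comparison[of "\<lambda>n. (norm (c n))^2"]) (auto intro: l2D)

lemma l2_reindex: "c \<in> l2 \<Longrightarrow> bij h \<Longrightarrow> (\<lambda>n. c (h n)) \<in> l2"
  using summable_on_reindex_bij_betw[of h UNIV UNIV "\<lambda>n. (norm (c n))^2"] by (simp add: l2_def)

lemma l2_finite_support: "finite {n. c n \<noteq> 0} \<Longrightarrow> c \<in> l2"
  using summable_on_cong_neutral[of "{n. c n \<noteq> 0}" UNIV "\<lambda>n. (norm (c n))^2" "\<lambda>n. (norm (c n))^2"]
  by (simp add: l2_def)

lemma hdot_summable_norm:
  assumes "c \<in> l2" "d \<in> l2"
  shows "(\<lambda>n. norm (hdot (c n) (d n))) summable_on UNIV"
proof (rule summable_on_comparison_test)
  show "(\<lambda>n. (norm (c n))^2 + (norm (d n))^2) summable_on UNIV"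
    using assms by (intro summable_on_add l2D)
  show "norm (hdot (c n) (d n)) \<le> (norm (c n))^2 + (norm (d n))^2" for n
  proof -
    have "0 \<le> (norm (c n) - norm (d n))^2" by simp
    then have "2 * (norm (c n) * norm (d n)) \<le> (norm (c n))^2 + (norm (d n))^2" by (simp add: power2_diff)
    moreover have "0 \<le> norm (c n) * norm (d n)" by simp
    ultimately show ?thesis using cmod_hdot_le[of "c n" "d n"] by linarith
  qed
qed auto

lemma hdot_summable: "c \<in> l2 \<Longrightarrow> d \<in> l2 \<Longrightarrow> (\<lambda>n. hdot (c n) (d n)) summable_on UNIV"
  by (rule abs_summable_summable) (rule hdot_summable_norm)

lemma iprod_add_left: "c \<in> l2 \<Longrightarrow> d \<in> l2 \<Longrightarrow> e \<in> l2 \<Longrightarrow> iprod (c + d) e = iprod c e + iprod d e"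
  unfolding iprod_hdot by (subst infsum_add[symmetric]) (auto simp: hdot_add_left intro: hdot_summable)

lemma iprod_scale_left: "iprod (cscale a c) e = a * iprod c e"
  unfolding iprod_hdot by (simp add: cscale_def hdot_scale_left infsum_cmult_right')

lemma iprod_cnj: "cnj (iprod c d) = iprod d c"
  unfolding iprod_hdot by (simp add: hdot_cnj flip: infsum_cnj)

lemma iprod_add_right: "c \<in> l2 \<Longrightarrow> d \<in> l2 \<Longrightarrow> e \<in> l2 \<Longrightarrow> iprod e (c + d) = iprod e c + iprod e d"
  using iprod_add_left[of c d e] by (metis iprod_cnj complex_cnj_add)

lemma iprod_scale_right: "iprod e (cscale a c) = cnj a * iprod e c"
  by (metis iprod_cnj iprod_scale_left complex_cnj_mult)

lemma iprod_zero [simp]: "iprod 0 c = 0" "iprod c 0 = 0"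
  by (simp_all add: iprod_hdot)

lemma iprod_minus_left: "iprod (- c) e = - iprod c e"
  using iprod_scale_left[of "-1" c e] by (simp add: cscale_minus_one)

lemma iprod_minus_right: "iprod e (- c) = - iprod e c"
  using iprod_scale_right[of e "-1" c] by (simp add: cscale_minus_one)

lemma iprod_diff_left: "c \<in> l2 \<Longrightarrow> d \<in> l2 \<Longrightarrow> e \<in> l2 \<Longrightarrow> iprod (c - d) e = iprod c e - iprod d e"
  using iprod_add_left[of c "-d" e] l2_uminus[of d] by (simp add: iprod_minus_left)

lemma iprod_diff_right: "c \<in> l2 \<Longrightarrow> d \<in> l2 \<Longrightarrow> e \<in> l2 \<Longrightarrow> iprod e (c - d) = iprod e c - iprod e d"
  using iprod_add_right[of c "-d" e] l2_uminus[of d] by (simp add: iprod_minus_right)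

lemma lnorm_nonneg [simp]: "0 \<le> lnorm c"
  by (simp add: lnorm_def infsum_nonneg)

lemma lnorm_square: "(lnorm c)^2 = (\<Sum>\<^sub>\<infinity>n. (norm (c n))^2)"
  by (simp add: lnorm_def infsum_nonneg)

lemma iprod_self: "c \<in> l2 \<Longrightarrow> iprod c c = of_real ((lnorm c)^2)"
  unfolding iprod_hdot lnorm_square hdot_self
  by (intro infsumI has_sum_of_real has_sum_infsum l2D)

lemma lnorm_zero [simp]: "lnorm 0 = 0"
  by (simp add: lnorm_def)

lemma lnorm_eq_zero_iff: "c \<in> l2 \<Longrightarrow> lnorm c = 0 \<longleftrightarrow> c = 0"
proof
  assume c: "c \<in> l2" and "lnorm c = 0"
  then have 0: "(\<Sum>\<^sub>\<infinity>n. (norm (c n))^2) = 0" using lnorm_square[of c] by simp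
  have "(norm (c n))^2 = 0" for n
    by (rule nonneg_infsum_le_0D[of _ UNIV]) (use 0 l2D[OF c] in auto)
  then show "c = 0" by (simp add: fun_eq_iff)
qed simp

lemma lnorm_scale: "lnorm (cscale a c) = cmod a * lnorm c"
proof (rule power2_eq_imp_eq)
  show "(lnorm (cscale a c))^2 = (cmod a * lnorm c)^2"
    unfolding power_mult_distrib lnorm_square
    by (simp add: cscale_def norm_scale_vec power_mult_distrib infsum_cmult_right')
qed auto

lemma lnorm_minus [simp]: "lnorm (- c) = lnorm c"
  using lnorm_scale[of "-1" c] by (simp add: cscale_minus_one)

lemma lnorm_add_square:
  assumes "c \<in> l2" "d \<in> l2"
  shows "(lnorm (c + d))^2 = (lnorm c)^2 + (lnorm d)^2 + 2 * Re (iprod c d)"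
proof -
  have "complex_of_real ((lnorm (c + d))^2) = iprod c c + iprod d d + (iprod c d + cnj (iprod c d))"
    unfolding iprod_self[OF l2_add[OF assms], symmetric] iprod_cnj using assms
    by (simp add: iprod_add_left iprod_add_right l2_add del: plus_fun_apply)
  also have "\<dots> = of_real ((lnorm c)^2 + (lnorm d)^2 + 2 * Re (iprod c d))"
    using assms by (simp add: complex_add_cnj iprod_self)
  finally show ?thesis by (rule of_real_eq_iff[THEN iffD1])
qed

lemma lnorm_diff_square:
  assumes "c \<in> l2" "d \<in> l2"
  shows "(lnorm (c - d))^2 = (lnorm c)^2 + (lnorm d)^2 - 2 * Re (iprod c d)"
  using lnorm_add_square[of c "-d"] assms by (simp add: l2_uminus iprod_minus_right)

text \<open>The arithmetic-geometric bound becomes Cauchy-Schwarz after normalising both sequences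
  to norm 1.\<close>

lemma cmod_iprod_le:
  assumes c: "c \<in> l2" and d: "d \<in> l2"
  shows "cmod (iprod c d) \<le> lnorm c * lnorm d"
proof -
  have amgm: "cmod (iprod c d) \<le> ((lnorm c)^2 + (lnorm d)^2) / 2" if "c \<in> l2" "d \<in> l2" for c d :: "'a seq"
  proof -
    have "cmod (iprod c d) \<le> (\<Sum>\<^sub>\<infinity>n. norm (hdot (c n) (d n)))"
      unfolding iprod_hdot by (intro norm_infsum_bound hdot_summable_norm that)
    also have "\<dots> \<le> (\<Sum>\<^sub>\<infinity>n. (norm (c n))^2 * (1/2) + (norm (d n))^2 * (1/2))"
    proof (rule infsum_mono)
      show "norm (hdot (c n) (d n)) \<le> (norm (c n))^2 * (1/2) + (norm (d n))^2 * (1/2)" for n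
      proof -
        have "0 \<le> (norm (c n) - norm (d n))^2" by simp
        then have "2 * (norm (c n) * norm (d n)) \<le> (norm (c n))^2 + (norm (d n))^2" by (simp add: power2_diff)
        then show ?thesis using cmod_hdot_le[of "c n" "d n"] by linarith
      qed
    qed (intro hdot_summable_norm summable_on_add summable_on_cmult_left l2D that)+
    also have "\<dots> = ((lnorm c)^2 + (lnorm d)^2) / 2"
      unfolding lnorm_square infsum_add[OF summable_on_cmult_left summable_on_cmult_left, OF l2D l2D, OF that]
        infsum_cmult_left' by simp
    finally show ?thesis .
  qed
  show ?thesis
  proof (cases "lnorm c = 0 \<or> lnorm d = 0")
    case True
    then have "c = 0 \<or> d = 0" using c d by (auto simp: lnorm_eq_zero_iff)
    then show ?thesis by auto
  next
    case False
    then have pos: "lnorm c > 0" "lnorm d > 0" using lnorm_nonneg by (metis less_eq_real_def)+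
    let ?c = "cscale (of_real (1 / lnorm c)) c" and ?d = "cscale (of_real (1 / lnorm d)) d"
    have "cmod (iprod ?c ?d) \<le> ((lnorm ?c)^2 + (lnorm ?d)^2) / 2"
      by (intro amgm l2_scale c d)
    also have "\<dots> = 1" using pos by (simp add: lnorm_scale norm_divide)
    finally have "cmod (iprod c d) / (lnorm c * lnorm d) \<le> 1"
      using pos by (simp add: iprod_scale_left iprod_scale_right norm_mult norm_divide mult.commute)
    then show ?thesis unfolding pos_divide_le_eq[OF mult_pos_pos[OF pos]] by simp
  qed
qed

lemma infsum_single:
  fixes f :: "'a \<Rightarrow> 'b::{topological_comm_monoid_add,t2_space}"
  assumes "\<And>n. n \<noteq> k \<Longrightarrow> f n = 0"
  shows "infsum f UNIV = f k"
  using infsum_cong_neutral[of UNIV "{k}" f f] assms by auto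

section \<open>Vector-valued functions on the circle\<close>

lemma borel_measurable_vec_iff:
  fixes f :: "'a \<Rightarrow> 'b::euclidean_space^'n"
  shows "f \<in> borel_measurable M \<longleftrightarrow> (\<forall>i. (\<lambda>t. f t $ i) \<in> borel_measurable M)"
proof safe
  fix i assume "f \<in> borel_measurable M"
  then show "(\<lambda>t. f t $ i) \<in> borel_measurable M"
    by (rule measurable_compose) (intro borel_measurable_continuous_onI continuous_on_component continuous_on_id)
next
  assume *: "\<forall>i. (\<lambda>t. f t $ i) \<in> borel_measurable M"
  show "f \<in> borel_measurable M"
  proof (rule borel_measurable_euclidean_space[THEN iffD2], rule ballI)
    fix b :: "'b^'n" assume "b \<in> Basis"
    then obtain i u where b: "b = axis i u" by (auto simp: Basis_vec_def)
    have [measurable]: "(\<lambda>x. f x $ i) \<in> borel_measurable M" using * by blast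
    show "(\<lambda>x. f x \<bullet> b) \<in> borel_measurable M"
      unfolding b inner_axis by measurable
  qed
qed

lemma L2fun_vec_iff:
  fixes f :: "real \<Rightarrow> 'b::euclidean_space^'n"
  shows "f \<in> L2fun \<longleftrightarrow> (\<forall>i. (\<lambda>t. f t $ i) \<in> L2fun)"
proof safe
  fix i assume f: "f \<in> L2fun"
  then show "(\<lambda>t. f t $ i) \<in> L2fun"
    by (rule L2fun_bounded_by[where C=1])
       (use L2fun_measurable[OF f] in \<open>auto simp: borel_measurable_vec_iff Finite_Cartesian_Product.norm_nth_le\<close>)
next
  assume f: "\<forall>i. (\<lambda>t. f t $ i) \<in> L2fun"
  then have "f \<in> borel_measurable circ"
    unfolding borel_measurable_vec_iff[of f] by (auto dest: L2fun_measurable)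
  moreover have "integrable circ (\<lambda>t. (norm (f t))^2)"
    unfolding norm_vec_square using f by (intro Bochner_Integration.integrable_sum) (auto dest: L2fun_square)
  ultimately show "f \<in> L2fun" by (simp add: L2fun_def)
qed

lemma L2fun_mat_iff:
  fixes f :: "real \<Rightarrow> complex^'n^'m"
  shows "f \<in> L2fun \<longleftrightarrow> (\<forall>i j. (\<lambda>t. f t $ i $ j) \<in> L2fun)"
  by (simp add: L2fun_vec_iff[of f] L2fun_vec_iff[of "\<lambda>t. f t $ _"])

lemma L2fun_comp: "f \<in> L2fun \<Longrightarrow> (\<lambda>t. f t $ i) \<in> L2fun" for f :: "real \<Rightarrow> complex^'n"
  by (simp add: L2fun_vec_iff)

lemma fcoefv_comp: "fcoefv f n $ i = fcoefc (\<lambda>t. f t $ i) n"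
  by (simp add: fcoefv_def)

lemma fcoefv_add: "f \<in> L2fun \<Longrightarrow> g \<in> L2fun \<Longrightarrow> fcoefv (\<lambda>t. f t + g t) = fcoefv f + fcoefv g"
  by (auto simp: fun_eq_iff vec_eq_iff fcoefv_comp fcoefc_add L2fun_comp L2fun_integrable)

lemma fcoefv_diff: "f \<in> L2fun \<Longrightarrow> g \<in> L2fun \<Longrightarrow> fcoefv (\<lambda>t. f t - g t) = fcoefv f - fcoefv g"
  by (auto simp: fun_eq_iff vec_eq_iff fcoefv_comp fcoefc_diff L2fun_comp L2fun_integrable)

lemma fcoefv_scale: "fcoefv (\<lambda>t. a *s f t) = cscale a (fcoefv f)"
  by (auto simp: fun_eq_iff vec_eq_iff fcoefv_comp cscale_def fcoefc_cmult)

lemma L2fun_scale_vec: "f \<in> L2fun \<Longrightarrow> (\<lambda>t. (a::complex) *s f t) \<in> L2fun"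
  by (auto simp: L2fun_vec_iff intro: L2fun_cmult)

lemma parseval_vec:
  fixes f g :: "real \<Rightarrow> complex^'n"
  assumes f: "f \<in> L2fun" and g: "g \<in> L2fun"
  shows "iprod (fcoefv f) (fcoefv g) = (LINT t|circ. hdot (f t) (g t)) / (2*pi)"
proof -
  have "((\<lambda>k. \<Sum>i\<in>UNIV. fcoefc (\<lambda>t. f t $ i) k * cnj (fcoefc (\<lambda>t. g t $ i) k)) has_sum
      (\<Sum>i\<in>UNIV. (LINT t|circ. f t $ i * cnj (g t $ i)) / (2*pi))) UNIV"
    by (intro has_sum_sum parseval_inner L2fun_comp f g)
  also have "(\<Sum>i\<in>UNIV. (LINT t|circ. f t $ i * cnj (g t $ i)) / (2*pi)) = (LINT t|circ. hdot (f t) (g t)) / (2*pi)"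
    unfolding hdot_def sum_divide_distrib[symmetric]
    by (subst Bochner_Integration.integral_sum)
       (auto intro!: L2fun_mult_integrable L2fun_cnj L2fun_comp f g)
  finally show ?thesis by (simp add: iprod_def fcoefv_comp infsumI)
qed

lemma fcoefv_l2:
  assumes "f \<in> L2fun" shows "fcoefv f \<in> l2"
proof -
  have "((\<lambda>k. \<Sum>i\<in>UNIV. (cmod (fcoefc (\<lambda>t. f t $ i) k))^2) has_sum
      (\<Sum>i\<in>UNIV. (LINT t|circ. (cmod (f t $ i))^2) / (2*pi))) UNIV"
    by (intro has_sum_sum parseval_has_sum L2fun_comp assms)
  then show ?thesis
    unfolding l2_def mem_Collect_eq norm_vec_square fcoefv_comp by (rule has_sum_imp_summable)
qed

lemma lnorm_fcoefv:
  fixes f :: "real \<Rightarrow> complex^'n"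
  assumes f: "f \<in> L2fun"
  shows "(lnorm (fcoefv f))^2 = (LINT t|circ. (norm (f t))^2) / (2*pi)"
proof -
  have "complex_of_real ((lnorm (fcoefv f))^2) = (LINT t|circ. hdot (f t) (f t)) / (2*pi)"
    using parseval_vec[OF f f] iprod_self[OF fcoefv_l2[OF f]] by simp
  also have "\<dots> = of_real ((LINT t|circ. (norm (f t))^2) / (2*pi))"
    unfolding hdot_self using integral_complex_of_real[of circ "\<lambda>t. (norm (f t))^2"] by simp
  finally show ?thesis by (rule of_real_eq_iff[THEN iffD1])
qed

lemma fcoefv_surj:
  fixes c :: "('n::finite) seq"
  assumes "c \<in> l2"
  obtains f where "f \<in> L2fun" "fcoefv f = c"
proof -
  have "\<exists>f. f \<in> L2fun \<and> fcoefc f = (\<lambda>n. c n $ i)" for i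
  proof -
    have "(\<lambda>n. (cmod (c n $ i))^2) summable_on UNIV"
      by (rule summable_on_comparison_test[OF l2D[OF assms]]) (auto simp: Finite_Cartesian_Product.norm_nth_le)
    then show ?thesis using riesz_fischer[of "\<lambda>n. c n $ i"] by metis
  qed
  then obtain F where F: "\<And>i. F i \<in> L2fun" "\<And>i. fcoefc (F i) = (\<lambda>n. c n $ i)" by metis
  let ?f = "\<lambda>t. \<chi> i. F i t"
  have "?f \<in> L2fun" using F by (simp add: L2fun_vec_iff)
  moreover have "fcoefv ?f = c" using F by (auto simp: fun_eq_iff vec_eq_iff fcoefv_comp)
  ultimately show ?thesis using that by blast
qed

lemma fcoefv_inj_AE:
  fixes f g :: "real \<Rightarrow> complex^'n"
  assumes "f \<in> L2fun" "g \<in> L2fun" "fcoefv f = fcoefv g"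
  shows "AE t in circ. f t = g t"
proof -
  have "AE t in circ. f t $ i = g t $ i" for i
  proof (rule fcoefc_eq_imp_AE_eq)
    show "fcoefc (\<lambda>t. f t $ i) n = fcoefc (\<lambda>t. g t $ i) n" for n
      using assms(3) by (metis fcoefv_comp)
  qed (intro L2fun_integrable L2fun_comp assms)+
  then have "AE t in circ. \<forall>i\<in>UNIV. f t $ i = g t $ i"
    by (intro AE_finite_allI) auto
  then show ?thesis by (simp add: vec_eq_iff)
qed

lemma fcoefv_cong_AE:
  fixes f g :: "real \<Rightarrow> complex^'n"
  assumes "AE t in circ. f t = g t" "f \<in> L2fun" "g \<in> L2fun"
  shows "fcoefv f = fcoefv g"
proof -
  have "fcoefc (\<lambda>t. f t $ i) n = fcoefc (\<lambda>t. g t $ i) n" for i n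
    using assms(1) by (intro fcoefc_cong_AE L2fun_measurable L2fun_comp assms(2,3)) (auto elim: AE_mp)
  then show ?thesis by (auto simp: fun_eq_iff vec_eq_iff fcoefv_comp)
qed

lemma fcoefv_mult:
  fixes A :: "real \<Rightarrow> complex^'n^'m"
  assumes A: "\<And>i j. (\<lambda>t. A t $ i $ j) \<in> L2fun" and f: "f \<in> L2fun"
  shows "((\<lambda>k. fcoefm A (n - k) *v fcoefv f k) has_sum fcoefv (\<lambda>t. A t *v f t) n) UNIV"
proof -
  have *: "((\<lambda>k. \<Sum>j\<in>UNIV. fcoefc (\<lambda>t. A t $ i $ j) (n - k) * fcoefc (\<lambda>t. f t $ j) k) has_sum
     (\<Sum>j\<in>UNIV. fcoefc (\<lambda>t. A t $ i $ j * f t $ j) n)) UNIV" for i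
    by (intro has_sum_sum fcoefc_mult A L2fun_comp f)
  have "(\<Sum>j\<in>UNIV. fcoefc (\<lambda>t. A t $ i $ j * f t $ j) n) = fcoefv (\<lambda>t. A t *v f t) n $ i" for i
    unfolding fcoefv_comp matrix_vector_mult_def vec_lambda_beta
    by (rule fcoefc_sum[symmetric]) (intro L2fun_mult_integrable A L2fun_comp f)
  then have "((\<lambda>k. (fcoefm A (n - k) *v fcoefv f k) $ i) has_sum fcoefv (\<lambda>t. A t *v f t) n $ i) UNIV" for i
    using *[of i] by (simp add: matrix_vector_mult_def fcoefm_def fcoefv_comp)
  then show ?thesis
    unfolding has_sum_def by (intro vec_tendstoI) (simp add: sum_component)
qed

section \<open>Essentially bounded matrix functions and Hankel operators\<close>

lemma mnorm_set_bdd: "bdd_above {norm ((A::complex^'n^'m) *v x) | x. norm x \<le> 1}"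
proof -
  obtain K where K: "\<And>x. norm (A *v x) \<le> norm x * K" "K \<ge> 0"
    using bounded_linear.nonneg_bounded[OF matrix_vector_mul_bounded_linear[of A]] by blast
  have "norm (A *v x) \<le> K" if "norm x \<le> 1" for x
    using K(1)[of x] mult_right_mono[OF that K(2)] by simp
  then show ?thesis by (intro bdd_aboveI[where M=K]) auto
qed

lemma norm_mult_le_mnorm: "norm ((A::complex^'n^'m) *v x) \<le> mnorm A * norm x"
proof (cases "x = 0")
  case False
  let ?y = "(1 / norm x) *\<^sub>R x"
  have "norm (A *v ?y) \<le> mnorm A"
    unfolding mnorm_def using False by (intro cSup_upper mnorm_set_bdd) force
  moreover have "A *v ?y = (1 / norm x) *\<^sub>R (A *v x)"
    using linear_scale[OF bounded_linear.linear[OF matrix_vector_mul_bounded_linear]] .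
  ultimately show ?thesis using False by (simp add: field_simps)
qed simp

lemma mnorm_nonneg: "0 \<le> mnorm (A::complex^'n^'m)"
proof -
  have "norm (A *v 0) \<le> mnorm A"
    unfolding mnorm_def by (intro cSup_upper mnorm_set_bdd CollectI exI[of _ 0]) simp
  then show ?thesis by simp
qed

lemma mnorm_le: "(\<And>x. norm x \<le> 1 \<Longrightarrow> norm ((A::complex^'n^'m) *v x) \<le> C) \<Longrightarrow> mnorm A \<le> C"
  unfolding mnorm_def by (rule cSup_least) (auto intro: exI[of _ 0])

lemma mnorm_diff_le: "mnorm (A - B) \<le> mnorm A + mnorm (B::complex^'n^'m)"
proof (rule mnorm_le)
  fix x :: "complex^'n" assume x: "norm x \<le> 1"
  have "norm ((A - B) *v x) \<le> norm (A *v x) + norm (B *v x)"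
    unfolding matrix_vector_mult_diff_rdistrib by (rule norm_triangle_ineq4)
  also have "\<dots> \<le> mnorm A + mnorm B"
    using norm_mult_le_mnorm[of A x] norm_mult_le_mnorm[of B x]
      mult_left_le[OF x mnorm_nonneg, of A] mult_left_le[OF x mnorm_nonneg, of B] by linarith
  finally show "norm ((A - B) *v x) \<le> mnorm A + mnorm B" .
qed

lemma entry_le_mnorm: "cmod (A $ i $ j) \<le> mnorm (A::complex^'n^'m)"
proof -
  have "A $ i $ j = (A *v axis j 1) $ i"
    by (simp add: matrix_vector_mult_def axis_def if_distrib cong: if_cong)
  also have "cmod \<dots> \<le> norm (A *v axis j 1)" by (rule Finite_Cartesian_Product.norm_nth_le)
  also have "\<dots> \<le> mnorm A" using norm_mult_le_mnorm[of A "axis j 1"] by simp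
  finally show ?thesis .
qed

lemma Linf_measurable: "G \<in> Linf_fun \<Longrightarrow> G \<in> borel_measurable circ"
  by (simp add: Linf_fun_def)

text \<open>Rules out negative essential bounds, so that the infimum defining
  \<open>linf_norm\<close> runs over a set bounded below.\<close>

lemma not_AE_circ_False: "\<not> (AE t in circ. False)"
proof
  assume "AE t in circ. False"
  then obtain N where N0: "{t \<in> space circ. \<not> False} \<subseteq> N" and N: "emeasure circ N = 0" "N \<in> sets circ"
    by (rule AE_E)
  have "space circ \<subseteq> N" using N0 by blast
  then have "emeasure circ (space circ) = 0"
    using emeasure_mono[of "space circ" N circ] N by simp
  then show False using measure_circ unfolding measure_def by simp
qed

lemma Linf_set_bdd: "bdd_below {C. AE t in circ. mnorm (G t :: complex^'p^'q) \<le> C}"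
proof (rule bdd_belowI)
  fix C assume "C \<in> {C. AE t in circ. mnorm (G t) \<le> C}"
  then have C: "AE t in circ. mnorm (G t) \<le> C" by simp
  show "0 \<le> C"
  proof (rule ccontr)
    assume "\<not> 0 \<le> C"
    then have "mnorm (G t) \<le> C \<Longrightarrow> False" for t using mnorm_nonneg[of "G t"] by linarith
    then have "AE t in circ. False" using C by (auto elim: AE_mp)
    then show False using not_AE_circ_False by blast
  qed
qed

lemma linf_norm_le: "AE t in circ. mnorm (G t :: complex^'p^'q) \<le> C \<Longrightarrow> linf_norm G \<le> C"
  unfolding linf_norm_def by (intro cInf_lower Linf_set_bdd) auto

text \<open>The infimum is attained: the bounds \<open>linf_norm G + 1 / Suc n\<close> hold outside
  one common null set because there are countably many of them.\<close>

lemma Linf_AE_le: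
  fixes G :: "real \<Rightarrow> complex^'p^'q"
  assumes "G \<in> Linf_fun"
  shows "AE t in circ. mnorm (G t) \<le> linf_norm G"
proof -
  have "AE t in circ. mnorm (G t) \<le> linf_norm G + 1 / real (Suc n)" for n
  proof -
    have "{C. AE t in circ. mnorm (G t) \<le> C} \<noteq> {}" using assms by (auto simp: Linf_fun_def)
    moreover have "Inf {C. AE t in circ. mnorm (G t) \<le> C} < linf_norm G + 1 / real (Suc n)"
      by (simp add: linf_norm_def)
    ultimately obtain C where C: "AE t in circ. mnorm (G t) \<le> C" "C < linf_norm G + 1 / real (Suc n)"
      using cInf_lessD[of "{C. AE t in circ. mnorm (G t) \<le> C}"] by auto
    show ?thesis using C(1) by eventually_elim (use C(2) in linarith)
  qed
  then have "AE t in circ. \<forall>n. mnorm (G t) \<le> linf_norm G + 1 / real (Suc n)"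
    by (simp add: AE_all_countable)
  then show ?thesis
  proof eventually_elim
    case (elim t)
    have "(\<lambda>n. linf_norm G + 1 / real (Suc n)) \<longlonglongrightarrow> linf_norm G + 0"
      by (intro tendsto_intros LIMSEQ_Suc lim_1_over_n)
    then show ?case using elim by (intro LIMSEQ_le_const[of _ "linf_norm G"]) auto
  qed
qed

lemma linf_norm_nonneg: "G \<in> Linf_fun \<Longrightarrow> 0 \<le> linf_norm G"
proof (rule ccontr)
  assume "G \<in> Linf_fun" "\<not> 0 \<le> linf_norm G"
  then have "mnorm (G t) \<le> linf_norm G \<Longrightarrow> False" for t using mnorm_nonneg[of "G t"] by linarith
  then have "AE t in circ. False" using Linf_AE_le[OF \<open>G \<in> Linf_fun\<close>] by (auto elim: AE_mp)
  then show False using not_AE_circ_False by blast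
qed

lemma Linf_diff:
  assumes "G \<in> Linf_fun" "F \<in> Linf_fun"
  shows "(\<lambda>t. G t - F t) \<in> Linf_fun"
proof -
  have "AE t in circ. mnorm (G t - F t) \<le> linf_norm G + linf_norm F"
    using Linf_AE_le[OF assms(1)] Linf_AE_le[OF assms(2)]
    by eventually_elim (rule order_trans[OF mnorm_diff_le], linarith)
  moreover have "(\<lambda>t. G t - F t) \<in> borel_measurable circ"
    using assms by (intro borel_measurable_diff Linf_measurable)
  ultimately show ?thesis by (auto simp: Linf_fun_def)
qed

lemma measurable_entry:
  fixes G :: "real \<Rightarrow> complex^'p^'q"
  shows "G \<in> borel_measurable M \<longleftrightarrow> (\<forall>i j. (\<lambda>t. G t $ i $ j) \<in> borel_measurable M)"
  by (simp add: borel_measurable_vec_iff[of G] borel_measurable_vec_iff[of "\<lambda>t. G t $ _"])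

lemma Linf_entry:
  assumes "G \<in> Linf_fun"
  shows "(\<lambda>t. G t $ i $ j) \<in> borel_measurable circ" "AE t in circ. cmod (G t $ i $ j) \<le> linf_norm G"
proof -
  show "(\<lambda>t. G t $ i $ j) \<in> borel_measurable circ"
    using Linf_measurable[OF assms] unfolding measurable_entry by blast
  show "AE t in circ. cmod (G t $ i $ j) \<le> linf_norm G"
    using Linf_AE_le[OF assms] by eventually_elim (rule order_trans[OF entry_le_mnorm])
qed

lemma Linf_entry_L2: "G \<in> Linf_fun \<Longrightarrow> (\<lambda>t. G t $ i $ j) \<in> L2fun"
  by (rule L2fun_bounded[OF Linf_entry])

lemma Linf_mult_L2:
  assumes "G \<in> Linf_fun" "f \<in> L2fun"
  shows "(\<lambda>t. G t *v f t) \<in> L2fun"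
  unfolding L2fun_vec_iff matrix_vector_mult_def vec_lambda_beta
  by (intro allI L2fun_sum L2fun_mult_bounded[OF L2fun_comp[OF assms(2)] Linf_entry[OF assms(1)]])

lemma lnorm_le_linf_norm:
  assumes G: "G \<in> Linf_fun" and f: "f \<in> L2fun"
  shows "lnorm (fcoefv (\<lambda>t. G t *v f t)) \<le> linf_norm G * lnorm (fcoefv f)"
proof (rule power2_le_imp_le)
  have "(LINT t|circ. (norm (G t *v f t))^2) \<le> (LINT t|circ. (linf_norm G)^2 * (norm (f t))^2)"
  proof (rule integral_mono_AE)
    show "integrable circ (\<lambda>t. (norm (G t *v f t))^2)"
      by (rule L2fun_square[OF Linf_mult_L2[OF G f]])
    show "AE t in circ. (norm (G t *v f t))^2 \<le> (linf_norm G)^2 * (norm (f t))^2"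
      using Linf_AE_le[OF G]
    proof eventually_elim
      case (elim t)
      have "norm (G t *v f t) \<le> linf_norm G * norm (f t)"
        using norm_mult_le_mnorm[of "G t" "f t"] mult_right_mono[OF elim, of "norm (f t)"] by simp
      then show ?case by (metis norm_ge_zero power_mono power_mult_distrib)
    qed
  qed (use L2fun_square[OF f] in simp)
  then show "(lnorm (fcoefv (\<lambda>t. G t *v f t)))^2 \<le> (linf_norm G * lnorm (fcoefv f))^2"
    unfolding power_mult_distrib lnorm_fcoefv[OF f] lnorm_fcoefv[OF Linf_mult_L2[OF G f]]
    by (simp add: divide_right_mono)
qed (use linf_norm_nonneg[OF G] in simp)

text \<open>The function chosen in the definition of \<open>hankel\<close> is immaterial: any two
  candidates agree almost everywhere, hence so do their products with \<open>G\<close>.\<close>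

lemma hankel_fcoefv:
  assumes G: "G \<in> Linf_fun" and f: "f \<in> L2fun"
  shows "hankel G (fcoefv f) = (\<lambda>n. if n < 0 then fcoefv (\<lambda>t. G t *v f t) n else 0)"
proof -
  define g where "g = (SOME g. g \<in> L2fun \<and> fcoefv g = fcoefv f)"
  have g: "g \<in> L2fun" "fcoefv g = fcoefv f"
    using someI[of "\<lambda>g. g \<in> L2fun \<and> fcoefv g = fcoefv f" f] f by (auto simp: g_def)
  have "AE t in circ. G t *v g t = G t *v f t"
    using fcoefv_inj_AE[OF g(1) f g(2)] by eventually_elim simp
  then have "fcoefv (\<lambda>t. G t *v g t) = fcoefv (\<lambda>t. G t *v f t)"
    by (intro fcoefv_cong_AE Linf_mult_L2 G f g)
  then show ?thesis by (simp add: hankel_def g_def[symmetric] cong: if_cong)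
qed

lemma H2seq_l2: "c \<in> H2seq \<Longrightarrow> c \<in> l2" and K2seq_l2: "d \<in> K2seq \<Longrightarrow> d \<in> l2"
  by (auto simp: H2seq_def K2seq_def)

lemma H2seq_add: "c \<in> H2seq \<Longrightarrow> d \<in> H2seq \<Longrightarrow> c + d \<in> H2seq"
  and H2seq_scale: "c \<in> H2seq \<Longrightarrow> cscale a c \<in> H2seq"
  and H2seq_zero [simp]: "0 \<in> H2seq"
  using l2_add[of c d] l2_scale[of c a] by (auto simp: H2seq_def cscale_apply)

lemma fcoefv_cis_scale: "fcoefv (\<lambda>t. cis t *s f t) = shiftS (fcoefv f)"
  using fcoefc_cis_mult[of 1] by (auto simp: fun_eq_iff vec_eq_iff fcoefv_comp shiftS_def)

lemma shiftS_l2: "c \<in> l2 \<Longrightarrow> shiftS c \<in> l2"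
  unfolding shiftS_def by (rule l2_reindex) (auto intro: bij_betwI[where g="\<lambda>n. n + 1"])

lemma shiftS_H2: "c \<in> H2seq \<Longrightarrow> shiftS c \<in> H2seq"
  using shiftS_l2[of c] by (auto simp: H2seq_def shiftS_def)

lemma infsum_int_shift: "(\<Sum>\<^sub>\<infinity>n::int. f (n + k)) = (\<Sum>\<^sub>\<infinity>n. f n)"
  by (rule infsum_reindex_bij_betw) (auto intro: bij_betwI[where g="\<lambda>n. n - k"])

lemma iprod_shiftS: "iprod (shiftS c) (shiftS d) = iprod c d"
  unfolding iprod_hdot shiftS_def using infsum_int_shift[of "\<lambda>n. hdot (c n) (d n)" "-1"] by simp

lemma lnorm_shiftS: "lnorm (shiftS c) = lnorm c"
  unfolding lnorm_def shiftS_def using infsum_int_shift[of "\<lambda>n. (norm (c n))^2" "-1"] by simp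

lemma lnorm_restrict_le: "c \<in> l2 \<Longrightarrow> lnorm (\<lambda>n. if P n then c n else 0) \<le> lnorm c"
  unfolding lnorm_def
  by (intro real_sqrt_le_mono infsum_mono l2D l2_restrict) auto

lemma Einj_l2: "Einj u \<in> l2"
  by (rule l2_finite_support) (auto simp: Einj_def intro: finite_subset[of _ "{0}"])

lemma Einj_H2: "Einj u \<in> H2seq"
  using Einj_l2 by (auto simp: H2seq_def Einj_def)

lemma Einj_add: "Einj (u + v) = Einj u + Einj v"
  and Einj_scale: "Einj (a *s u) = cscale a (Einj u)"
  by (auto simp: Einj_def cscale_def fun_eq_iff)

text \<open>The backward shift, which is the adjoint of \<open>shiftS\<close> on
  \<open>H2seq\<close>.\<close>

definition Sst :: "('n::finite) seq \<Rightarrow> 'n seq" where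
  "Sst c = (\<lambda>n. if n \<ge> 0 then c (n + 1) else 0)"

lemma Sst_l2: "c \<in> l2 \<Longrightarrow> Sst c \<in> l2"
  unfolding Sst_def by (rule l2_restrict, rule l2_reindex) (auto intro: bij_betwI[where g="\<lambda>n. n - 1"])

lemma Sst_H2: "c \<in> l2 \<Longrightarrow> Sst c \<in> H2seq"
  using Sst_l2[of c] by (auto simp: H2seq_def Sst_def)

lemma Vminus_l2: "c \<in> l2 \<Longrightarrow> Vminus c \<in> l2"
  unfolding Vminus_def by (rule l2_restrict) (rule shiftS_l2[unfolded shiftS_def])

lemma H2_decomp: "c \<in> H2seq \<Longrightarrow> c = Einj (c 0) + shiftS (Sst c)"
  by (auto simp: H2seq_def Einj_def shiftS_def Sst_def fun_eq_iff)

text \<open>Coordinates where one factor vanishes may be altered freely. This is how orthogonal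
  projections onto \<open>H2seq\<close> and \<open>K2seq\<close> are dropped inside inner
  products.\<close>

lemma iprod_cong: "(\<And>n. c n = c' n \<and> d n = d' n \<or> (c n = 0 \<or> d n = 0) \<and> (c' n = 0 \<or> d' n = 0)) \<Longrightarrow> iprod c d = iprod c' d'"
  unfolding iprod_hdot by (rule infsum_cong) (metis hdot_zero_left hdot_zero_right)

lemma iprod_Sst:
  assumes "c \<in> H2seq"
  shows "iprod c (Sst d) = iprod (shiftS c) d"
proof -
  have "iprod c (Sst d) = iprod (shiftS c) (shiftS (Sst d))" by (simp add: iprod_shiftS)
  also have "\<dots> = iprod (shiftS c) d"
    using assms by (intro iprod_cong) (auto simp: shiftS_def Sst_def H2seq_def)
  finally show ?thesis .
qed

lemma iprod_Vminus:
  assumes "d \<in> K2seq"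
  shows "iprod (Vminus c) d = iprod (shiftS c) d"
  using assms by (intro iprod_cong) (auto simp: Vminus_def shiftS_def K2seq_def)

section \<open>Hankel operators with an essentially bounded symbol\<close>

context
  fixes G :: "real \<Rightarrow> complex^'p^'q"
  assumes G: "G \<in> Linf_fun"
begin

lemma hankel_K2: "c \<in> l2 \<Longrightarrow> hankel G c \<in> K2seq"
proof -
  assume "c \<in> l2"
  then obtain f where f: "f \<in> L2fun" "fcoefv f = c" by (rule fcoefv_surj)
  show ?thesis
    unfolding f(2)[symmetric] hankel_fcoefv[OF G f(1)] K2seq_def
    using l2_restrict[OF fcoefv_l2[OF Linf_mult_L2[OF G f(1)]], of "\<lambda>n. n < 0"] by simp
qed

lemma hankel_l2: "c \<in> l2 \<Longrightarrow> hankel G c \<in> l2"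
  using hankel_K2 K2seq_l2 by blast

lemma hankel_add: "c \<in> l2 \<Longrightarrow> d \<in> l2 \<Longrightarrow> hankel G (c + d) = hankel G c + hankel G d"
proof -
  assume "c \<in> l2" "d \<in> l2"
  then obtain f g where f: "f \<in> L2fun" "fcoefv f = c" and g: "g \<in> L2fun" "fcoefv g = d"
    using fcoefv_surj by metis
  have "fcoefv (\<lambda>t. f t + g t) = c + d" using f g by (simp add: fcoefv_add)
  then have "hankel G (c + d) = (\<lambda>n. if n < 0 then fcoefv (\<lambda>t. G t *v f t + G t *v g t) n else 0)"
    using hankel_fcoefv[OF G L2fun_add[OF f(1) g(1)]] by (simp add: matrix_vector_right_distrib cong: if_cong)
  also have "\<dots> = hankel G c + hankel G d"
    unfolding f(2)[symmetric] g(2)[symmetric] hankel_fcoefv[OF G f(1)] hankel_fcoefv[OF G g(1)]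
      fcoefv_add[OF Linf_mult_L2[OF G f(1)] Linf_mult_L2[OF G g(1)]] by (auto simp: fun_eq_iff)
  finally show ?thesis .
qed

lemma hankel_scale: "c \<in> l2 \<Longrightarrow> hankel G (cscale a c) = cscale a (hankel G c)"
proof -
  assume "c \<in> l2"
  then obtain f where f: "f \<in> L2fun" "fcoefv f = c" by (rule fcoefv_surj)
  have "hankel G (cscale a c) = (\<lambda>n. if n < 0 then fcoefv (\<lambda>t. a *s (G t *v f t)) n else 0)"
    using hankel_fcoefv[OF G L2fun_scale_vec[OF f(1), of a]] by (simp add: fcoefv_scale f vector_scalar_commute cong: if_cong)
  also have "\<dots> = cscale a (hankel G c)"
    unfolding f(2)[symmetric] hankel_fcoefv[OF G f(1)] fcoefv_scale by (auto simp: fun_eq_iff cscale_def)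
  finally show ?thesis .
qed

lemma hankel_shift: "c \<in> l2 \<Longrightarrow> hankel G (shiftS c) = Vminus (hankel G c)"
proof -
  assume "c \<in> l2"
  then obtain f where f: "f \<in> L2fun" "fcoefv f = c" by (rule fcoefv_surj)
  have s: "(\<lambda>t. cis t *s f t) \<in> L2fun"
    using L2fun_cis_mult[of _ 1] f by (auto simp: L2fun_vec_iff)
  have "hankel G (shiftS c) = (\<lambda>n. if n < 0 then fcoefv (\<lambda>t. cis t *s (G t *v f t)) n else 0)"
    using hankel_fcoefv[OF G s] by (simp add: fcoefv_cis_scale f vector_scalar_commute cong: if_cong)
  also have "\<dots> = Vminus (hankel G c)"
    unfolding f(2)[symmetric] hankel_fcoefv[OF G f(1)] fcoefv_cis_scale
    by (auto simp: fun_eq_iff Vminus_def shiftS_def)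
  finally show ?thesis .
qed

lemma hankel_bound: "c \<in> l2 \<Longrightarrow> lnorm (hankel G c) \<le> linf_norm G * lnorm c"
proof -
  assume "c \<in> l2"
  then obtain f where f: "f \<in> L2fun" "fcoefv f = c" by (rule fcoefv_surj)
  show ?thesis
    unfolding f(2)[symmetric] hankel_fcoefv[OF G f(1)]
    by (rule order_trans[OF lnorm_restrict_le lnorm_le_linf_norm[OF G f(1)]])
       (intro fcoefv_l2 Linf_mult_L2 G f)
qed

lemma hankel_convolution:
  assumes "c \<in> l2" "n < 0"
  shows "((\<lambda>k. fcoefm G (n - k) *v c k) has_sum hankel G c n) UNIV"
proof -
  obtain f where f: "f \<in> L2fun" "fcoefv f = c" using assms(1) by (rule fcoefv_surj)
  show ?thesis
    using fcoefv_mult[of G f n] Linf_entry_L2[OF G] f(1) assms(2)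
    unfolding f(2)[symmetric] hankel_fcoefv[OF G f(1)] by simp
qed

lemma hankel_opnorm_bdd: "bdd_above {lnorm (hankel G c) | c. c \<in> H2seq \<and> lnorm c \<le> 1}"
proof (rule bdd_aboveI)
  fix x assume "x \<in> {lnorm (hankel G c) | c. c \<in> H2seq \<and> lnorm c \<le> 1}"
  then obtain c where c: "c \<in> H2seq" "lnorm c \<le> 1" "x = lnorm (hankel G c)" by blast
  then show "x \<le> linf_norm G"
    using hankel_bound[OF H2seq_l2, of c] mult_left_le[OF c(2) linf_norm_nonneg[OF G]] by linarith
qed

lemma gam_nonneg: "0 \<le> gam G"
proof -
  have "lnorm (hankel G 0) \<le> gam G"
    unfolding gam_def opnorm_def by (intro cSup_upper hankel_opnorm_bdd) force
  then show ?thesis using lnorm_nonneg order_trans by blast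
qed

lemma hankel_le_gam:
  assumes c: "c \<in> H2seq"
  shows "lnorm (hankel G c) \<le> gam G * lnorm c"
proof (cases "lnorm c = 0")
  case True
  then show ?thesis using hankel_bound[OF H2seq_l2[OF c]] by simp
next
  case False
  then have pos: "lnorm c > 0" using lnorm_nonneg[of c] by linarith
  let ?c = "cscale (of_real (1 / lnorm c)) c"
  have "lnorm (hankel G ?c) \<le> gam G"
    unfolding gam_def opnorm_def using pos
    by (intro cSup_upper hankel_opnorm_bdd) (auto intro!: exI[of _ ?c] H2seq_scale c simp: lnorm_scale norm_divide)
  then show ?thesis using pos c
    by (simp add: hankel_scale[OF H2seq_l2] lnorm_scale norm_divide pos_divide_le_eq)
qed

lemma gam_le:
  assumes "0 \<le> C" "\<And>c. c \<in> H2seq \<Longrightarrow> lnorm (hankel G c) \<le> C * lnorm c"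
  shows "gam G \<le> C"
  unfolding gam_def opnorm_def
proof (rule cSup_least)
  have "lnorm (hankel G 0) \<in> {lnorm (hankel G c) |c. c \<in> H2seq \<and> lnorm c \<le> 1}"
    by (intro CollectI exI[of _ 0]) simp
  then show "{lnorm (hankel G c) |c. c \<in> H2seq \<and> lnorm c \<le> 1} \<noteq> {}" by blast
  fix x assume "x \<in> {lnorm (hankel G c) |c. c \<in> H2seq \<and> lnorm c \<le> 1}"
  then obtain c where c: "c \<in> H2seq" "lnorm c \<le> 1" "x = lnorm (hankel G c)" by blast
  then show "x \<le> C" using assms(2)[of c] mult_left_le[OF c(2) assms(1)] by linarith
qed

text \<open>The adjoint multiplies by the pointwise conjugate transpose of \<open>G\<close> and
  keeps the coefficients of index at least 0. Existence must be shown because \<open>adjoint\<close>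
  is a definite description.\<close>

lemma hankel_adjoint_ex:
  assumes "y \<in> K2seq"
  shows "\<exists>u\<in>H2seq. \<forall>v\<in>H2seq. iprod (hankel G v) y = iprod v u"
proof -
  obtain g where g: "g \<in> L2fun" "fcoefv g = y" using fcoefv_surj[OF K2seq_l2[OF assms]] .
  let ?A = "\<lambda>t. \<chi> i j. cnj (G t $ j $ i)"
  have A: "(\<lambda>t. ?A t *v g t) \<in> L2fun"
    unfolding L2fun_vec_iff matrix_vector_mult_def vec_lambda_beta
  proof (intro allI L2fun_sum L2fun_mult_bounded[OF L2fun_comp[OF g(1)]])
    fix i j
    show "(\<lambda>t. cnj (G t $ j $ i)) \<in> borel_measurable circ"
      by (intro L2fun_measurable L2fun_cnj Linf_entry_L2 G)
    show "AE t in circ. cmod (cnj (G t $ j $ i)) \<le> linf_norm G"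
      using Linf_entry(2)[OF G, of j i] by simp
  qed
  define u where "u = (\<lambda>n. if n \<ge> 0 then fcoefv (\<lambda>t. ?A t *v g t) n else 0)"
  have u: "u \<in> H2seq"
    using l2_restrict[OF fcoefv_l2[OF A], of "\<lambda>n. n \<ge> 0"] by (simp add: u_def H2seq_def)
  have hd: "hdot (B *v x) z = hdot x ((\<chi> i j. cnj (B $ j $ i)) *v z)" for B :: "complex^'p^'q" and x z
    unfolding hdot_def matrix_vector_mult_def
    by (simp add: sum_distrib_left sum_distrib_right mult_ac) (rule sum.swap)
  have "iprod (hankel G v) y = iprod v u" if v: "v \<in> H2seq" for v
  proof -
    obtain f where f: "f \<in> L2fun" "fcoefv f = v" using fcoefv_surj[OF H2seq_l2[OF v]] .
    have "iprod (hankel G v) y = iprod (fcoefv (\<lambda>t. G t *v f t)) (fcoefv g)"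
      unfolding f(2)[symmetric] hankel_fcoefv[OF G f(1)] g(2)
      using assms by (intro iprod_cong) (auto simp: K2seq_def)
    also have "\<dots> = iprod (fcoefv f) (fcoefv (\<lambda>t. ?A t *v g t))"
      by (simp add: parseval_vec Linf_mult_L2 G f(1) g(1) A hd)
    also have "\<dots> = iprod v u"
      unfolding f(2) using v by (intro iprod_cong) (auto simp: u_def H2seq_def)
    finally show ?thesis .
  qed
  then show ?thesis using u by blast
qed

text \<open>The product of the analytic functions \<open>F\<close> and \<open>f\<close> has no
  negative coefficients, so \<open>G\<close> and \<open>G - F\<close> have the same Hankel
  operator.\<close>

lemma hankel_minus_Hinf:
  assumes F: "F \<in> Hinf_fun" and f: "f \<in> L2fun" "fcoefv f \<in> H2seq" and n: "n < 0"
  shows "fcoefv (\<lambda>t. (G t - F t) *v f t) n = hankel G (fcoefv f) n"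
proof -
  have Fi: "F \<in> Linf_fun" and Fn: "\<And>n. n < 0 \<Longrightarrow> fcoefm F n = 0" using F by (auto simp: Hinf_fun_def)
  have "fcoefm F (n - k) *v fcoefv f k = 0" for k
    using Fn[of "n - k"] n f(2) by (cases "k < 0") (auto simp: H2seq_def)
  then have "((\<lambda>k::int. 0) has_sum fcoefv (\<lambda>t. F t *v f t) n) UNIV"
    using fcoefv_mult[of F f n] Linf_entry_L2[OF Fi] f(1) by simp
  then have "fcoefv (\<lambda>t. F t *v f t) n = 0" by (metis infsumI infsum_0_simp)
  then show ?thesis
    unfolding hankel_fcoefv[OF G f(1)] matrix_vector_mult_diff_rdistrib
      fcoefv_diff[OF Linf_mult_L2[OF G f(1)] Linf_mult_L2[OF Fi f(1)]] using n by simp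
qed

text \<open>The easy half of Nehari's theorem: \<open>H\<close> is a projection after multiplication
  by \<open>G - F\<close>.\<close>

lemma gam_le_linf_norm:
  assumes F: "F \<in> Hinf_fun"
  shows "gam G \<le> linf_norm (\<lambda>t. G t - F t)"
proof -
  have GF: "(\<lambda>t. G t - F t) \<in> Linf_fun"
    using F by (intro Linf_diff G) (simp add: Hinf_fun_def)
  show ?thesis
  proof (rule gam_le[OF linf_norm_nonneg[OF GF]])
    fix c :: "'p seq" assume c: "c \<in> H2seq"
    obtain f where f: "f \<in> L2fun" "fcoefv f = c" using fcoefv_surj[OF H2seq_l2[OF c]] .
    have "hankel G c n = (if n < 0 then fcoefv (\<lambda>t. (G t - F t) *v f t) n else 0)" for n
      using hankel_minus_Hinf[OF F f(1)] hankel_K2[OF H2seq_l2[OF c]] f(2) c by (simp add: K2seq_def)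
    then have "hankel G c = (\<lambda>n. if n < 0 then fcoefv (\<lambda>t. (G t - F t) *v f t) n else 0)" by blast
    then have "lnorm (hankel G c) \<le> lnorm (fcoefv (\<lambda>t. (G t - F t) *v f t))"
      using lnorm_restrict_le[OF fcoefv_l2[OF Linf_mult_L2[OF GF f(1)]]] by simp
    also have "\<dots> \<le> linf_norm (\<lambda>t. G t - F t) * lnorm c"
      using lnorm_le_linf_norm[OF GF f(1)] by (simp add: f(2))
    finally show "lnorm (hankel G c) \<le> linf_norm (\<lambda>t. G t - F t) * lnorm c" .
  qed
qed

end

section \<open>Orthogonal projections and adjoints\<close>

lemma subspace_l2: "seqs.subspace l2"
  by (rule seqs.subspaceI) (auto intro: l2_add l2_scale)

lemma span_l2: "B \<subseteq> l2 \<Longrightarrow> seqs.span B \<subseteq> l2"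
  by (rule seqs.span_minimal[OF _ subspace_l2])

text \<open>Gram-Schmidt, one vector at a time: \<open>w\<close> is the component of the new vector
  \<open>b\<close> orthogonal to the old span, and the projection gains a multiple of
  \<open>w\<close>.\<close>

lemma projection_span:
  assumes "finite B" "B \<subseteq> l2" "d \<in> l2"
  shows "\<exists>p\<in>seqs.span B. \<forall>y\<in>seqs.span B. iprod (d - p) y = 0"
  using assms
proof (induction B arbitrary: d rule: finite_induct)
  case empty
  show ?case
  proof (intro bexI[of _ 0] ballI)
    fix y :: "'a seq" assume "y \<in> seqs.span {}"
    then have y: "y = 0" by simp
    show "iprod (d - 0) y = 0" unfolding y by (rule iprod_zero(2))
  qed (rule seqs.span_zero)
next
  case (insert b B)
  let ?S = "seqs.span B"
  have S: "seqs.subspace ?S" by (rule seqs.subspace_span)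
  have Sl: "?S \<subseteq> l2" using insert.prems by (intro span_l2) auto
  have bl: "b \<in> l2" using insert.prems by auto
  obtain q where q: "q \<in> ?S" "\<forall>y\<in>?S. iprod (b - q) y = 0" using insert.IH[OF _ bl] insert.prems by blast
  obtain p where p: "p \<in> ?S" "\<forall>y\<in>?S. iprod (d - p) y = 0" using insert.IH[of d] insert.prems by blast
  define w where "w = b - q"
  have wl: "w \<in> l2" using bl q Sl unfolding w_def by (intro l2_diff) auto
  have sub: "?S \<subseteq> seqs.span (insert b B)" by (rule seqs.span_mono) auto
  show ?case
  proof (cases "w = 0")
    case True
    then have "b \<in> ?S" using q by (simp add: w_def)
    then have eq: "seqs.span (insert b B) = ?S" by (rule seqs.span_redundant)
    show ?thesis unfolding eq using p by blast
  next
    case False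
    then have nz: "iprod w w \<noteq> 0" using wl by (simp add: iprod_self lnorm_eq_zero_iff)
    define a where "a = iprod (d - p) w / iprod w w"
    have ws: "w \<in> seqs.span (insert b B)"
      unfolding w_def using q sub seqs.span_base[of b "insert b B"] by (intro seqs.span_diff) auto
    have pl: "p \<in> l2" using p Sl by auto
    have dpl: "d - p \<in> l2" using insert.prems pl by (intro l2_diff) auto
    have main: "iprod (d - (p + cscale a w)) y = iprod (d - p) y - a * iprod w y" if "y \<in> l2" for y
    proof -
      have eq: "d - (p + cscale a w) = (d - p) - cscale a w" by (rule diff_diff_eq[symmetric])
      show ?thesis
        unfolding eq iprod_diff_left[OF dpl l2_scale[OF wl] that] iprod_scale_left ..
    qed
    have "iprod (d - (p + cscale a w)) y = 0" if y: "y \<in> seqs.span (insert b B)" for y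
    proof -
      obtain k where k: "y - cscale k b \<in> ?S" using y seqs.span_breakdown_eq by blast
      \<comment> \<open>Rewrites \<open>y\<close> with \<open>w\<close> in place of
        \<open>b\<close>, so that orthogonality has to be checked only on the old span and on
        \<open>w\<close>.\<close>
      define s where "s = (y - cscale k b) + cscale k q"
      have s: "s \<in> ?S" unfolding s_def using k q S by (intro seqs.subspace_add seqs.subspace_scale)
      have ys: "y = s + cscale k w" by (simp add: s_def w_def seqs.scale_right_diff_distrib)
      have sl: "s \<in> l2" using s Sl by auto
      have 1: "iprod (d - (p + cscale a w)) s = 0"
        using main[OF sl] p(2) q(2) s by (simp add: w_def)
      have 2: "iprod (d - (p + cscale a w)) w = 0"
        using main[OF wl] nz by (simp add: a_def)
      have "d - (p + cscale a w) \<in> l2" using insert.prems pl wl by (intro l2_diff l2_add l2_scale) auto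
      then show ?thesis unfolding ys using 1 2 sl wl by (simp add: iprod_add_right l2_scale iprod_scale_right)
    qed
    moreover have "p + cscale a w \<in> seqs.span (insert b B)"
      using p sub ws by (intro seqs.span_add seqs.span_scale) auto
    ultimately show ?thesis by blast
  qed
qed

lemma finite_dim_basis:
  assumes "seqs.finite_dim (Y :: ('n::finite) seq set)"
  obtains B where "finite B" "B \<subseteq> Y" "seqs.span B = Y"
proof -
  obtain C where C: "finite C" "Y \<subseteq> seqs.span C" and S: "seqs.subspace Y"
    using assms by (auto simp: seqs.finite_dim_def)
  obtain B where B: "B \<subseteq> Y" "seqs.independent B" "Y \<subseteq> seqs.span B"
    using seqs.maximal_independent_subset[of Y] by auto
  have "finite B" using seqs.independent_span_bound[OF C(1) B(2)] B(1) C(2) by auto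
  moreover have "seqs.span B = Y" using B S by (metis seqs.span_subspace)
  ultimately show ?thesis using that B by blast
qed

lemma projection:
  assumes "seqs.finite_dim Y" "Y \<subseteq> l2" "d \<in> l2"
  obtains p where "p \<in> Y" "\<forall>y\<in>Y. iprod (d - p) y = 0"
proof -
  obtain B where B: "finite B" "B \<subseteq> Y" "seqs.span B = Y" using finite_dim_basis[OF assms(1)] .
  then have "B \<subseteq> l2" using assms(2) by blast
  then obtain p where "p \<in> seqs.span B" "\<forall>y\<in>seqs.span B. iprod (d - p) y = 0"
    using projection_span[OF B(1) _ assms(3)] by blast
  then show ?thesis using that B(3) by blast
qed

text \<open>By Pythagoras the distance from \<open>d\<close> to its projection is at most the
  distance to any element of \<open>Y\<close>, hence 0.\<close>

lemma finite_dim_closed: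
  assumes Y: "seqs.finite_dim Y" "Y \<subseteq> l2" and d: "d \<in> l2" and ap: "\<And>e. e > 0 \<Longrightarrow> \<exists>y\<in>Y. lnorm (y - d) < e"
  shows "d \<in> Y"
proof -
  have S: "seqs.subspace Y" using Y by (simp add: seqs.finite_dim_def)
  obtain p where p: "p \<in> Y" "\<forall>y\<in>Y. iprod (d - p) y = 0" using projection[OF Y d] .
  have dp: "d - p \<in> l2" using d p Y by (intro l2_diff) auto
  have "lnorm (d - p) \<le> 0 + e" if e: "e > 0" for e
  proof -
    obtain y where y: "y \<in> Y" "lnorm (y - d) < e" using ap[OF e] by blast
    have yp: "y - p \<in> Y" using y p S by (intro seqs.subspace_diff)
    have "iprod (d - p) (y - p) = 0" using p(2) yp by blast
    then have "(lnorm ((d - p) - (y - p)))^2 = (lnorm (d - p))^2 + (lnorm (y - p))^2"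
      using dp yp Y by (subst lnorm_diff_square) auto
    moreover have "(d - p) - (y - p) = - (y - d)" by simp
    ultimately have "(lnorm (d - p))^2 \<le> (lnorm (y - d))^2"
      using lnorm_minus[of "y - d"] by simp
    then have "lnorm (d - p) \<le> lnorm (y - d)" by (rule power2_le_imp_le) simp
    then show ?thesis using y by simp
  qed
  then have "lnorm (d - p) \<le> 0" by (rule field_le_epsilon)
  then have "d - p = 0" using lnorm_eq_zero_iff[OF dp] lnorm_nonneg[of "d - p"] by linarith
  then show ?thesis using p by simp
qed

lemma iprod_ext:
  assumes U: "seqs.subspace U" "U \<subseteq> l2" and u: "u \<in> U" "u' \<in> U" and eq: "\<And>v. v \<in> U \<Longrightarrow> iprod v u = iprod v u'"
  shows "u = u'"
proof -
  have d: "u - u' \<in> U" using U u by (intro seqs.subspace_diff)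
  have "iprod (u - u') (u - u') = 0"
    using eq[OF d] d u U by (subst iprod_diff_right) auto
  then have "lnorm (u - u') = 0" using d U iprod_self[of "u - u'"] by (simp add: subset_iff)
  then show ?thesis using lnorm_eq_zero_iff[of "u - u'"] d U by auto
qed

lemma adjoint_unique:
  assumes U: "seqs.subspace U" "U \<subseteq> l2" and u: "u \<in> U" "\<And>v. v \<in> U \<Longrightarrow> iprod (A v) y = iprod v u"
  shows "adjoint U Y A y = u"
  unfolding adjoint_def
proof (rule the_equality)
  fix u' assume "u' \<in> U \<and> (\<forall>v\<in>U. iprod (A v) y = iprod v u')"
  then show "u' = u" using u by (intro iprod_ext[OF U]) auto
qed (use u in blast)

lemma adjoint_works:
  assumes U: "seqs.subspace U" "U \<subseteq> l2" and ex: "\<exists>u\<in>U. \<forall>v\<in>U. iprod (A v) y = iprod v u"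
  shows "adjoint U Y A y \<in> U" "v \<in> U \<Longrightarrow> iprod (A v) y = iprod v (adjoint U Y A y)"
proof -
  obtain u where u: "u \<in> U" "\<And>v. v \<in> U \<Longrightarrow> iprod (A v) y = iprod v u" using ex by blast
  have "adjoint U Y A y = u" by (rule adjoint_unique[OF U u])
  then show "adjoint U Y A y \<in> U" "v \<in> U \<Longrightarrow> iprod (A v) y = iprod v (adjoint U Y A y)"
    using u by auto
qed

lemma subspace_H2: "seqs.subspace H2seq"
  by (rule seqs.subspaceI) (auto intro: H2seq_add H2seq_scale)

lemma H2_sub_l2: "H2seq \<subseteq> l2" and K2_sub_l2: "K2seq \<subseteq> l2"
  by (auto simp: H2seq_def K2seq_def)

lemma Vminus_add: "Vminus (x + y) = Vminus x + Vminus y"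
  and Vminus_scale: "Vminus (cscale a x) = cscale a (Vminus x)"
  by (auto simp: Vminus_def cscale_def fun_eq_iff)

lemma Sst_scale: "Sst (cscale a x) = cscale a (Sst x)"
  by (auto simp: Sst_def cscale_def fun_eq_iff)

lemma lnorm_Vminus_le: "x \<in> l2 \<Longrightarrow> lnorm (Vminus x) \<le> lnorm x"
  using lnorm_restrict_le[OF shiftS_l2, of x "\<lambda>n. n < 0"] unfolding lnorm_shiftS
  unfolding Vminus_def shiftS_def .

section \<open>The operators of the theorem\<close>

locale nehari_data =
  fixes G :: "real \<Rightarrow> complex^'p^'q"
  assumes Linf: "G \<in> Linf_fun"
    and C1: "finite_rank H2seq (hankel G)"
    and C2a: "maximizing_vectors G \<inter> shiftS ` H2seq = {}"
    and C2b: "vector_space.dim cscale (maximizing_vectors G) = CARD('p)"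
begin

abbreviation H where "H \<equiv> hankel G"
abbreviation X where "X \<equiv> Xsp G"
abbreviation Ws where "Ws \<equiv> Wst G"
abbreviation Zs where "Zs \<equiv> Zst G"

lemma H_add: "c \<in> H2seq \<Longrightarrow> d \<in> H2seq \<Longrightarrow> H (c + d) = H c + H d"
  and H_scale: "c \<in> H2seq \<Longrightarrow> H (cscale a c) = cscale a (H c)"
  and H_shift: "c \<in> H2seq \<Longrightarrow> H (shiftS c) = Vminus (H c)"
  by (intro hankel_add hankel_scale hankel_shift Linf H2seq_l2; assumption)+

lemma finite_dim_image: "seqs.finite_dim (H ` H2seq)"
  unfolding seqs.finite_dim_def
proof
  show "seqs.subspace (H ` H2seq)"
  proof (rule seqs.subspaceI)
    show "0 \<in> H ` H2seq" using H_scale[of 0 0] by (intro image_eqI[of _ _ 0]) auto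
  next
    fix x y assume "x \<in> H ` H2seq" "y \<in> H ` H2seq"
    then obtain c d where "c \<in> H2seq" "d \<in> H2seq" "x = H c" "y = H d" by blast
    then show "x + y \<in> H ` H2seq" using H_add[of c d] H2seq_add[of c d] by (metis image_eqI)
  next
    fix a x assume "x \<in> H ` H2seq"
    then obtain c where "c \<in> H2seq" "x = H c" by blast
    then show "cscale a x \<in> H ` H2seq" using H_scale[of c a] H2seq_scale[of c a] by (metis image_eqI)
  qed
  show "\<exists>B. finite B \<and> H ` H2seq \<subseteq> seqs.span B" using C1 by (simp add: finite_rank_def)
qed

lemma image_l2: "H ` H2seq \<subseteq> l2"
  using hankel_l2[OF Linf] H2_sub_l2 by auto

text \<open>A finite-dimensional range is closed, so under (C1) the closure in the definition of
  \<open>Xsp\<close> adds nothing.\<close>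

lemma X_eq: "X = H ` H2seq"
proof
  show "X \<subseteq> H ` H2seq"
  proof
    fix d assume "d \<in> X"
    then have d: "d \<in> l2" "\<And>e. e > 0 \<Longrightarrow> \<exists>c\<in>H2seq. lnorm (H c - d) < e"
      by (auto simp: Xsp_def fun_diff_def)
    then show "d \<in> H ` H2seq"
      by (intro finite_dim_closed[OF finite_dim_image image_l2]) auto
  qed
  show "H ` H2seq \<subseteq> X"
  proof
    fix d assume "d \<in> H ` H2seq"
    then obtain c where c: "c \<in> H2seq" "d = H c" by blast
    have "(\<lambda>n. H c n - H c n) = 0" by (simp add: fun_eq_iff)
    then have "lnorm (\<lambda>n. H c n - d n) = 0" using c by simp
    then show "d \<in> X" using c image_l2 unfolding Xsp_def by (auto intro!: bexI[of _ c])
  qed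
qed

lemma finite_dim_X: "seqs.finite_dim X" and X_l2: "X \<subseteq> l2"
  using finite_dim_image image_l2 by (auto simp: X_eq)

lemma subspace_X: "seqs.subspace X"
  using finite_dim_X by (simp add: seqs.finite_dim_def)

lemma X_K2: "x \<in> X \<Longrightarrow> x \<in> K2seq"
  using hankel_K2[OF Linf] H2_sub_l2 by (auto simp: X_eq)

lemma X_in_l2: "x \<in> X \<Longrightarrow> x \<in> l2"
  using X_l2 by auto

lemma H_X: "c \<in> H2seq \<Longrightarrow> H c \<in> X"
  by (simp add: X_eq)

lemma Vminus_X: "x \<in> X \<Longrightarrow> Vminus x \<in> X"
  unfolding X_eq by (auto simp: H_shift[symmetric] intro: shiftS_H2)

lemma Ws_H2: "y \<in> X \<Longrightarrow> Ws y \<in> H2seq"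
  and Ws_adj: "y \<in> X \<Longrightarrow> v \<in> H2seq \<Longrightarrow> iprod (H v) y = iprod v (Ws y)"
  using adjoint_works[OF subspace_H2 H2_sub_l2 hankel_adjoint_ex[OF Linf X_K2]]
  by (auto simp: Wst_def)

lemma Ws_l2: "y \<in> X \<Longrightarrow> Ws y \<in> l2"
  using Ws_H2 H2_sub_l2 by auto

lemma Ws_eqI: "y \<in> X \<Longrightarrow> u \<in> H2seq \<Longrightarrow> (\<And>v. v \<in> H2seq \<Longrightarrow> iprod (H v) y = iprod v u) \<Longrightarrow> Ws y = u"
  unfolding Wst_def by (rule adjoint_unique[OF subspace_H2 H2_sub_l2])

text \<open>\<open>Vminus\<close> agrees with the bilateral shift when tested against
  \<open>K2seq\<close>, so its adjoint on \<open>X\<close> moves the indices back by one and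
  projects onto \<open>X\<close>.\<close>

lemma Zs_ex:
  assumes y: "y \<in> X"
  shows "\<exists>u\<in>X. \<forall>v\<in>X. iprod (Vminus v) y = iprod v u"
proof -
  define s where "s = (\<lambda>n. y (n + 1))"
  have s: "s \<in> l2" unfolding s_def
    by (rule l2_reindex[OF X_in_l2[OF y]]) (auto intro: bij_betwI[where g="\<lambda>n. n - 1"])
  have ss: "shiftS s = y" by (simp add: s_def shiftS_def)
  obtain u where u: "u \<in> X" "\<forall>v\<in>X. iprod (s - u) v = 0"
    using projection[OF finite_dim_X X_l2 s] .
  have "iprod (Vminus v) y = iprod v u" if v: "v \<in> X" for v
  proof -
    have "iprod (Vminus v) y = iprod (shiftS v) (shiftS s)" using iprod_Vminus[OF X_K2[OF y]] ss by simp
    also have "\<dots> = iprod v s" by (rule iprod_shiftS)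
    also have "\<dots> = iprod v u"
      using bspec[OF u(2) v] iprod_diff_left[OF s X_in_l2[OF u(1)] X_in_l2[OF v]] by (metis eq_iff_diff_eq_0 iprod_cnj)
    finally show ?thesis .
  qed
  then show ?thesis using u by blast
qed

lemma Zs_X: "y \<in> X \<Longrightarrow> Zs y \<in> X"
  and Zs_adj: "y \<in> X \<Longrightarrow> v \<in> X \<Longrightarrow> iprod (Vminus v) y = iprod v (Zs y)"
  using adjoint_works[OF subspace_X X_l2 Zs_ex] by (auto simp: Zst_def)

lemma Zs_eqI: "u \<in> X \<Longrightarrow> (\<And>v. v \<in> X \<Longrightarrow> iprod (Vminus v) y = iprod v u) \<Longrightarrow> Zs y = u"
  unfolding Zst_def by (rule adjoint_unique[OF subspace_X X_l2])

lemma X_add: "x \<in> X \<Longrightarrow> y \<in> X \<Longrightarrow> x + y \<in> X"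
  and X_diff: "x \<in> X \<Longrightarrow> y \<in> X \<Longrightarrow> x - y \<in> X"
  and X_scale: "x \<in> X \<Longrightarrow> cscale a x \<in> X"
  and X_zero: "0 \<in> X"
  using subspace_X seqs.subspace_add seqs.subspace_diff seqs.subspace_scale seqs.subspace_0 by blast+

lemma Ws_add: "x \<in> X \<Longrightarrow> y \<in> X \<Longrightarrow> Ws (x + y) = Ws x + Ws y"
  by (rule Ws_eqI)
     (auto simp: iprod_add_right Ws_adj X_in_l2 hankel_l2[OF Linf] H2seq_l2 Ws_l2 simp del: plus_fun_apply
       intro: X_add H2seq_add Ws_H2)

lemma Ws_scale: "x \<in> X \<Longrightarrow> Ws (cscale a x) = cscale a (Ws x)"
  by (rule Ws_eqI) (auto simp: iprod_scale_right Ws_adj intro: X_scale H2seq_scale Ws_H2)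

lemma Ws_diff: "x \<in> X \<Longrightarrow> y \<in> X \<Longrightarrow> Ws (x - y) = Ws x - Ws y"
  using Ws_add[of "x - y" y] X_diff[of x y] by simp

lemma Zs_lin: "seqs.lin_on X Zs"
  unfolding seqs.lin_on_def
proof (intro conjI ballI allI)
  fix x y assume x: "x \<in> X" and y: "y \<in> X"
  show "Zs (x + y) = Zs x + Zs y"
    by (rule Zs_eqI)
       (auto simp: iprod_add_right Zs_adj x y X_in_l2 Vminus_l2 Zs_X simp del: plus_fun_apply intro: X_add Zs_X x y)
next
  fix x a assume x: "x \<in> X"
  show "Zs (cscale a x) = cscale a (Zs x)"
    by (rule Zs_eqI) (auto simp: iprod_scale_right Zs_adj x intro: X_scale Zs_X x)
qed (auto intro: Zs_X)

text \<open>The adjoint of the intertwining \<open>H S = V\<^sub>- H\<close>. It turns powers of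
  \<open>Zs\<close> in the state formulas into powers of the backward shift.\<close>

lemma Ws_Zs: "y \<in> X \<Longrightarrow> Ws (Zs y) = Sst (Ws y)"
proof (rule Ws_eqI)
  assume y: "y \<in> X"
  then show "Zs y \<in> X" "Sst (Ws y) \<in> H2seq" by (auto intro: Zs_X Sst_H2 Ws_l2)
  fix v :: "'p seq" assume v: "v \<in> H2seq"
  have "iprod (H v) (Zs y) = iprod (H (shiftS v)) y" using Zs_adj[OF y H_X[OF v]] H_shift[OF v] by simp
  also have "\<dots> = iprod v (Sst (Ws y))" using Ws_adj[OF y shiftS_H2[OF v]] iprod_Sst[OF v] by simp
  finally show "iprod (H v) (Zs y) = iprod v (Sst (Ws y))" .
qed

lemma iprod_HW: "x \<in> X \<Longrightarrow> y \<in> X \<Longrightarrow> iprod (H (Ws x)) y = iprod (Ws x) (Ws y)"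
  by (intro Ws_adj Ws_H2)

lemma HW_lin: "seqs.lin_on X (\<lambda>x. H (Ws x))"
  unfolding seqs.lin_on_def by (auto simp: Ws_add Ws_scale H_add H_scale Ws_H2 simp del: plus_fun_apply intro: H_X Ws_H2)

lemma Vminus_lin: "seqs.lin_on X Vminus"
  unfolding seqs.lin_on_def by (auto simp del: plus_fun_apply simp: Vminus_add Vminus_scale intro: Vminus_X)

abbreviation g2 :: complex where "g2 \<equiv> complex_of_real ((gam G)^2)"

lemma Delta_eq: "Delta G = (\<lambda>x. cscale g2 x - Vminus (H (Ws (Zs x))))"
  and Xi_eq: "Xi G = (\<lambda>x. cscale g2 x - H (Ws x))"
  by (auto simp: Delta_def Xi_def cscale_def fun_eq_iff)

lemma Delta_lin: "seqs.lin_on X (Delta G)"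
  unfolding Delta_eq
  by (intro seqs.lin_on_scaled_diff subspace_X seqs.lin_on_compose[OF Vminus_lin] seqs.lin_on_compose[OF HW_lin] Zs_lin)

lemma Xi_lin: "seqs.lin_on X (Xi G)"
  unfolding Xi_eq by (intro seqs.lin_on_scaled_diff subspace_X HW_lin)

lemma iprod_Xi: "x \<in> X \<Longrightarrow> y \<in> X \<Longrightarrow> iprod (Xi G x) y = g2 * iprod x y - iprod (Ws x) (Ws y)"
  unfolding Xi_eq
  by (simp add: iprod_diff_left X_in_l2 l2_scale H_X Ws_H2 iprod_scale_left iprod_HW del: fun_diff_def minus_apply)

lemma iprod_Delta: "x \<in> X \<Longrightarrow> y \<in> X \<Longrightarrow> iprod (Delta G x) y = g2 * iprod x y - iprod (Ws (Zs x)) (Ws (Zs y))"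
  unfolding Delta_eq
  by (simp add: iprod_diff_left X_in_l2 l2_scale Vminus_X H_X Ws_H2 Zs_X iprod_scale_left Zs_adj iprod_HW)

lemma lnorm_Ws_le: "y \<in> X \<Longrightarrow> lnorm (Ws y) \<le> gam G * lnorm y"
proof -
  assume y: "y \<in> X"
  have "complex_of_real ((lnorm (Ws y))^2) = iprod (H (Ws y)) y"
    using iprod_HW[OF y y] iprod_self[OF Ws_l2[OF y]] by simp
  then have "(lnorm (Ws y))^2 \<le> lnorm (H (Ws y)) * lnorm y"
    using cmod_iprod_le[of "H (Ws y)" y] y by (metis H_X Ws_H2 X_in_l2 abs_of_nonneg norm_of_real zero_le_power2)
  also have "\<dots> \<le> (gam G * lnorm (Ws y)) * lnorm y"
    by (intro mult_right_mono hankel_le_gam[OF Linf] Ws_H2 y) simp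
  finally have *: "lnorm (Ws y) * lnorm (Ws y) \<le> lnorm (Ws y) * (gam G * lnorm y)"
    by (simp add: power2_eq_square mult_ac)
  show ?thesis
  proof (cases "lnorm (Ws y) = 0")
    case True
    then show ?thesis using gam_nonneg[OF Linf] by simp
  next
    case False
    then have "lnorm (Ws y) > 0" using lnorm_nonneg[of "Ws y"] by linarith
    then show ?thesis using * by simp
  qed
qed

section \<open>Maximizing vectors as an eigenspace\<close>

definition K :: "'p seq set" where
  "K = {k \<in> H2seq. Ws (H k) = cscale g2 k}"

lemma K_lnorm: "k \<in> K \<Longrightarrow> lnorm (H k) = gam G * lnorm k"
proof -
  assume k: "k \<in> K"
  then have kH: "k \<in> H2seq" and e: "Ws (H k) = cscale g2 k" by (auto simp: K_def)
  have "complex_of_real ((lnorm (H k))^2) = iprod (H k) (H k)"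
    using iprod_self[OF X_in_l2[OF H_X[OF kH]]] by simp
  also have "\<dots> = iprod k (cscale g2 k)" using Ws_adj[OF H_X[OF kH] kH] e by simp
  also have "\<dots> = complex_of_real ((gam G * lnorm k)^2)"
    by (simp add: iprod_scale_right iprod_self[OF H2seq_l2[OF kH]] power_mult_distrib)
  finally have "(lnorm (H k))^2 = (gam G * lnorm k)^2" by (rule of_real_eq_iff[THEN iffD1])
  then show ?thesis using gam_nonneg[OF Linf] by (intro power2_eq_imp_eq[of "lnorm (H k)"]) auto
qed

text \<open>Expand the squared norm of \<open>Ws (H h) - cscale g2 h\<close>: both squares are at
  most \<open>gam G ^ 4 * lnorm h ^ 2\<close>, and the cross term is exactly minus twice that
  amount.\<close>

lemma maximizing_in_K:
  assumes h: "h \<in> H2seq" "lnorm (H h) = gam G * lnorm h"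
  shows "h \<in> K"
proof -
  have hl: "h \<in> l2" and Hh: "H h \<in> X" using h by (auto intro: H2seq_l2 H_X)
  have wl: "Ws (H h) \<in> l2" by (rule Ws_l2[OF Hh])
  have "iprod h (Ws (H h)) = complex_of_real ((gam G * lnorm h)^2)"
    using Ws_adj[OF Hh h(1)] iprod_self[OF X_in_l2[OF Hh]] h(2) by simp
  then have ip: "iprod (Ws (H h)) (cscale g2 h) = complex_of_real ((gam G)^2 * (gam G * lnorm h)^2)"
    using iprod_cnj[of h "Ws (H h)"] by (simp add: iprod_scale_right)
  have "(lnorm (Ws (H h)))^2 \<le> (gam G * (gam G * lnorm h))^2"
    using lnorm_Ws_le[OF Hh] h(2) by (intro power_mono) auto
  moreover have "lnorm (cscale g2 h) = (gam G)^2 * lnorm h" by (simp add: lnorm_scale norm_power)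
  moreover have "(lnorm (Ws (H h) - cscale g2 h))^2
      = (lnorm (Ws (H h)))^2 + (lnorm (cscale g2 h))^2 - 2 * ((gam G)^2 * (gam G * lnorm h)^2)"
    using lnorm_diff_square[OF wl l2_scale[OF hl], of g2] unfolding ip by simp
  ultimately have "(lnorm (Ws (H h) - cscale g2 h))^2 \<le> 0"
    by (simp add: power_mult_distrib power2_eq_square algebra_simps)
  then have "lnorm (Ws (H h) - cscale g2 h) = 0" by simp
  then have "Ws (H h) - cscale g2 h = 0"
    by (rule lnorm_eq_zero_iff[THEN iffD1, rotated]) (intro l2_diff wl l2_scale hl)
  then show ?thesis using h by (simp add: K_def)
qed

lemma maximizing_eq: "maximizing_vectors G = K - {0}"
  using maximizing_in_K K_lnorm by (auto simp: maximizing_vectors_def K_def)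

lemma shift_in_K_zero: "h \<in> H2seq \<Longrightarrow> shiftS h \<in> K \<Longrightarrow> h = 0"
proof (rule ccontr)
  assume h: "h \<in> H2seq" "shiftS h \<in> K" "h \<noteq> 0"
  then have "shiftS h \<noteq> 0" by (metis lnorm_shiftS lnorm_eq_zero_iff H2seq_l2 lnorm_zero)
  then show False using h C2a by (auto simp: maximizing_eq)
qed

lemma K_zero_eval: "k \<in> K \<Longrightarrow> k 0 = 0 \<Longrightarrow> k = 0"
proof -
  assume k: "k \<in> K" "k 0 = 0"
  then have "k \<in> H2seq" by (simp add: K_def)
  then have "k = Einj (k 0) + shiftS (Sst k)" by (intro H2_decomp)
  moreover have "Einj (k 0) = 0" unfolding k(2) by (simp add: Einj_def fun_eq_iff)
  ultimately have eq: "k = shiftS (Sst k)" by (metis add_0)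
  have "Sst k = 0" by (rule shift_in_K_zero) (use eq k in \<open>auto intro: Sst_H2 H2seq_l2 simp: K_def\<close>)
  then show ?thesis using eq by (simp add: shiftS_def fun_eq_iff)
qed

text \<open>If the norm were 0, every nonzero element of \<open>H2seq\<close> would be maximizing,
  including shifted ones, against (C2).\<close>

lemma gam_pos: "gam G > 0"
proof (rule ccontr)
  assume "\<not> gam G > 0"
  then have g0: "gam G = 0" using gam_nonneg[OF Linf] by simp
  define e :: "'p seq" where "e = Einj (axis undefined 1)"
  have e: "e \<in> H2seq" unfolding e_def by (rule Einj_H2)
  have "lnorm (H (shiftS e)) = gam G * lnorm (shiftS e)"
    using hankel_le_gam[OF Linf shiftS_H2[OF e]] lnorm_nonneg[of "H (shiftS e)"] g0 by simp
  then have "e = 0" by (intro shift_in_K_zero e maximizing_in_K shiftS_H2)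
  then have "e 0 = 0" by simp
  then show False by (simp add: e_def Einj_def axis_eq_0_iff)
qed

lemma subspace_K: "seqs.subspace K"
proof (rule seqs.subspaceI)
  show "0 \<in> K" using Ws_scale[OF X_zero, of 0] H_scale[of 0 0] by (simp add: K_def)
next
  fix x y assume "x \<in> K" "y \<in> K"
  then show "x + y \<in> K"
    by (simp add: K_def H2seq_add H_add Ws_add H_X seqs.scale_right_distrib del: plus_fun_apply)
next
  fix a x assume "x \<in> K"
  then show "cscale a x \<in> K" by (simp add: K_def H2seq_scale H_scale Ws_scale H_X mult.commute)
qed

text \<open>Evaluation at \<open>0\<close> is injective on the space of maximizing vectors because none of them lies in
  the range of the shift; it is onto by counting dimensions.\<close>

lemma K_eval_surj: "\<exists>k\<in>K. k 0 = u"
proof -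
  have sub: "vec.subspace ((\<lambda>k. k 0) ` K)"
  proof (rule vec.subspaceI)
    show "0 \<in> (\<lambda>k. k 0) ` K" using seqs.subspace_0[OF subspace_K] by (intro image_eqI[of _ _ 0]) auto
  next
    fix x y assume "x \<in> (\<lambda>k. k 0) ` K" "y \<in> (\<lambda>k. k 0) ` K"
    then obtain k l where "k \<in> K" "l \<in> K" "x = k 0" "y = l 0" by blast
    then show "x + y \<in> (\<lambda>k. k 0) ` K" using seqs.subspace_add[OF subspace_K] by (intro image_eqI[of _ _ "k + l"]) auto
  next
    fix a x assume "x \<in> (\<lambda>k. k 0) ` K"
    then obtain k where "k \<in> K" "x = k 0" by blast
    then show "a *s x \<in> (\<lambda>k. k 0) ` K"
      using seqs.subspace_scale[OF subspace_K] by (intro image_eqI[of _ _ "cscale a k"]) (auto simp: cscale_apply)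
  qed
  have "(\<lambda>k. k 0) ` K = UNIV"
  proof (rule ccontr)
    assume neq: "(\<lambda>k. k 0) ` K \<noteq> UNIV"
    obtain D where D: "D \<subseteq> (\<lambda>k. k 0) ` K" "vec.independent D" "(\<lambda>k. k 0) ` K \<subseteq> vec.span D"
      "card D = vec.dim ((\<lambda>k. k 0) ` K)"
      using vec.basis_exists[of "(\<lambda>k. k 0) ` K"] by blast
    have fD: "finite D" using D(2) vec.finiteI_independent by blast
    have "vec.dim ((\<lambda>k. k 0) ` K) \<noteq> CARD('p)"
      using neq vec.dim_eq_full[of "(\<lambda>k. k 0) ` K"] vec.span_eq_iff[THEN iffD2, OF sub] vec_dim_card[where 'a=complex and 'n='p]
      by (metis vec.dim_eq_full vec.span_UNIV)
    moreover have "vec.dim ((\<lambda>k. k 0) ` K) \<le> CARD('p)"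
      using vec.dim_subset[OF subset_UNIV[of "(\<lambda>k. k 0) ` K"]] vec_dim_card[where 'a=complex and 'n='p] by simp
    ultimately have cD: "card D < CARD('p)" using D(4) by simp
    have "\<forall>d\<in>D. \<exists>k\<in>K. k 0 = d" using D(1) by blast
    then obtain g where g: "\<And>d. d \<in> D \<Longrightarrow> g d \<in> K \<and> g d 0 = d" by metis
    \<comment> \<open>Lifts of a basis \<open>D\<close> of the image span \<open>K\<close>, since
      evaluation is injective there. With fewer than \<open>CARD('p)\<close> of them,
      \<open>K\<close> could not contain that many independent maximizing vectors.\<close>
    have lift: "\<exists>k\<in>seqs.span (g ` D). k 0 = w" if "w \<in> vec.span D" for w
      using that
    proof (induction rule: vec.span_induct)
      case base
      show "vec.subspace {w. \<exists>k\<in>seqs.span (g ` D). k 0 = w}"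
      proof (rule vec.subspaceI)
        show "0 \<in> {w. \<exists>k\<in>seqs.span (g ` D). k 0 = w}"
          using seqs.span_zero[of "g ` D"] by (auto intro: bexI[of _ 0])
      next
        fix x y assume "x \<in> {w. \<exists>k\<in>seqs.span (g ` D). k 0 = w}" "y \<in> {w. \<exists>k\<in>seqs.span (g ` D). k 0 = w}"
        then obtain k l where "k \<in> seqs.span (g ` D)" "l \<in> seqs.span (g ` D)" "k 0 = x" "l 0 = y" by blast
        then show "x + y \<in> {w. \<exists>k\<in>seqs.span (g ` D). k 0 = w}"
          by (intro CollectI bexI[of _ "k + l"] seqs.span_add) auto
      next
        fix a x assume "x \<in> {w. \<exists>k\<in>seqs.span (g ` D). k 0 = w}"
        then obtain k where "k \<in> seqs.span (g ` D)" "k 0 = x" by blast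
        then show "a *s x \<in> {w. \<exists>k\<in>seqs.span (g ` D). k 0 = w}"
          by (intro CollectI bexI[of _ "cscale a k"] seqs.span_scale) (auto simp: cscale_apply)
      qed
    next
      case (step d)
      then show ?case using g[of d] by (intro bexI[of _ "g d"] seqs.span_base) auto
    qed
    have gK: "seqs.span (g ` D) \<subseteq> K" using g by (intro seqs.span_minimal subspace_K) auto
    have KD: "K \<subseteq> seqs.span (g ` D)"
    proof
      fix k assume k: "k \<in> K"
      then obtain l where l: "l \<in> seqs.span (g ` D)" "l 0 = k 0" using lift[of "k 0"] D(3) by blast
      have "k - l = 0" using k l gK by (intro K_zero_eval seqs.subspace_diff[OF subspace_K]) auto
      then show "k \<in> seqs.span (g ` D)" using l by simp
    qed
    obtain B where B: "B \<subseteq> maximizing_vectors G" "seqs.independent B" "card B = CARD('p)"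
      using seqs.basis_exists[of "maximizing_vectors G"] C2b by metis
    have "B \<subseteq> seqs.span (g ` D)" using B(1) KD by (auto simp: maximizing_eq)
    then have "card B \<le> card (g ` D)"
      using seqs.independent_span_bound[of "g ` D" B] fD B(2) by blast
    also have "\<dots> \<le> card D" by (rule card_image_le[OF fD])
    finally show False using cD B(3) by simp
  qed
  then have "u \<in> (\<lambda>k. k 0) ` K" by simp
  then show ?thesis by blast
qed

text \<open>For \<open>x\<close> in the kernel put \<open>h = Ws (Zs x)\<close>. Pairing with
  \<open>x\<close> gives \<open>lnorm h = gam G * lnorm x\<close>, while \<open>H (shiftS h)\<close>
  equals \<open>cscale g2 x\<close>; so \<open>shiftS h\<close> attains the norm and (C2) forces
  \<open>h = 0\<close>.\<close>

lemma Delta_bij: "bij_betw (Delta G) X X"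
proof (rule seqs.lin_on_bij[OF finite_dim_X Delta_lin])
  fix x assume x: "x \<in> X" "Delta G x = 0"
  define h where "h = Ws (Zs x)"
  have hH: "h \<in> H2seq" unfolding h_def using x by (intro Ws_H2 Zs_X)
  have "complex_of_real ((gam G)^2 * (lnorm x)^2) = complex_of_real ((lnorm h)^2)"
    using iprod_Delta[OF x(1) x(1)] x(2)
    by (simp add: iprod_self X_in_l2 x(1) h_def[symmetric] H2seq_l2[OF hH])
  then have "(gam G * lnorm x)^2 = (lnorm h)^2"
    by (simp only: power_mult_distrib of_real_eq_iff)
  then have n: "lnorm h = gam G * lnorm x"
    using power2_eq_imp_eq[of "lnorm h" "gam G * lnorm x"] gam_pos by simp
  have "cscale g2 x = H (shiftS h)"
    using x(2) H_shift[OF hH] by (simp add: Delta_eq h_def)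
  then have "lnorm (H (shiftS h)) = gam G * lnorm (shiftS h)"
    using n lnorm_scale[of g2 x] by (simp add: lnorm_shiftS norm_mult power2_eq_square)
  then have "h = 0" by (intro shift_in_K_zero maximizing_in_K shiftS_H2 hH)
  then show "x = 0" using n gam_pos lnorm_eq_zero_iff[OF X_in_l2[OF x(1)]] by simp
qed

lemma Delta_inv_X: "x \<in> X \<Longrightarrow> Delta_inv G x \<in> X"
  and Delta_Delta_inv: "x \<in> X \<Longrightarrow> Delta G (Delta_inv G x) = x"
  and Delta_inv_eqI: "x \<in> X \<Longrightarrow> Delta G x = y \<Longrightarrow> Delta_inv G y = x"
  using Delta_bij unfolding Delta_inv_def
  by (auto simp: bij_betw_def the_inv_into_into f_the_inv_into_f the_inv_into_f_f)

lemma Delta_inv_lin: "seqs.lin_on X (Delta_inv G)"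
  unfolding Delta_inv_def by (rule seqs.lin_on_the_inv[OF Delta_lin subspace_X Delta_bij])

text \<open>The input vector shared by the formulas for \<open>N\<close>, \<open>M\<close> and the
  inverse of \<open>M\<close>.\<close>

definition bvec :: "complex^'p \<Rightarrow> 'q seq" where
  "bvec u = Zs (Delta_inv G (H (Einj u)))"

lemma bvec_X: "bvec u \<in> X"
  unfolding bvec_def by (intro Zs_X Delta_inv_X H_X Einj_H2)

lemma bvec_add: "bvec (u + v) = bvec u + bvec v"
  and bvec_scale: "bvec (a *s u) = cscale a (bvec u)"
  unfolding bvec_def
  by (simp_all add: Einj_add Einj_scale H_add H_scale Einj_H2 H_X Delta_inv_X
      seqs.lin_onD(2,3)[OF Delta_inv_lin] seqs.lin_onD(2,3)[OF Zs_lin] del: plus_fun_apply)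

definition kvec :: "complex^'p \<Rightarrow> 'p seq" where
  "kvec u = (SOME k. k \<in> K \<and> k 0 = u)"

lemma kvec: "kvec u \<in> K" "kvec u 0 = u"
  using someI_ex[of "\<lambda>k. k \<in> K \<and> k 0 = u"] K_eval_surj[of u] by (auto simp: kvec_def)

lemma kvec_H2: "kvec u \<in> H2seq" and Ws_H_kvec: "Ws (H (kvec u)) = cscale g2 (kvec u)"
  using kvec(1)[of u] by (auto simp: K_def)

text \<open>The link between the formula for \<open>M\<close> and the maximizing vectors. Splitting
  \<open>kvec u\<close> into its constant term and a shifted part shows that \<open>Delta G\<close>
  maps \<open>H (kvec u)\<close> to \<open>g2\<close> times \<open>H (Einj u)\<close>, so
  \<open>Delta_inv\<close> can be evaluated explicitly.\<close>

lemma Ws_bvec: "Ws (bvec u) = Sst (kvec u)"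
proof -
  have HX: "H (kvec u) \<in> X" by (rule H_X[OF kvec_H2])
  have g0: "g2 \<noteq> 0" using gam_pos by simp
  have s: "Sst (kvec u) \<in> H2seq" by (rule Sst_H2[OF H2seq_l2[OF kvec_H2]])
  have "H (kvec u) = H (Einj u + shiftS (Sst (kvec u)))" using H2_decomp[OF kvec_H2] kvec(2) by metis
  then have H: "H (kvec u) = H (Einj u) + Vminus (H (Sst (kvec u)))"
    using H_add[OF Einj_H2 shiftS_H2[OF s]] H_shift[OF s] by simp
  have "Delta G (H (kvec u)) = cscale g2 (H (kvec u)) - Vminus (H (cscale g2 (Sst (kvec u))))"
    unfolding Delta_eq Ws_Zs[OF HX] Ws_H_kvec Sst_scale ..
  also have "\<dots> = cscale g2 (H (kvec u) - Vminus (H (Sst (kvec u))))"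
    unfolding H_scale[OF s] Vminus_scale seqs.scale_right_diff_distrib ..
  also have "\<dots> = cscale g2 (H (Einj u))" unfolding H by (metis add_diff_cancel_right')
  finally have "Delta G (cscale (1 / g2) (H (kvec u))) = H (Einj u)"
    using g0 by (simp add: seqs.lin_onD(3)[OF Delta_lin HX])
  then have "Delta_inv G (H (Einj u)) = cscale (1 / g2) (H (kvec u))"
    by (intro Delta_inv_eqI X_scale HX)
  then have "Ws (bvec u) = Sst (cscale (1 / g2) (cscale g2 (kvec u)))"
    unfolding bvec_def by (simp add: Ws_Zs X_scale HX Ws_scale Ws_H_kvec)
  then show ?thesis using g0 by simp
qed

end

section \<open>Decay of autocorrelations\<close>

lemma l2_tail:
  assumes c: "c \<in> l2" and e: "e > 0"
  obtains F where "finite F" "lnorm (\<lambda>n. if n \<in> F then 0 else c n) < e"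
proof -
  let ?a = "\<lambda>n. (norm (c n))^2" and ?I = "\<Sum>\<^sub>\<infinity>n. (norm (c n))^2"
  have hs: "(?a has_sum ?I) UNIV" using l2D[OF c] by (rule has_sum_infsum)
  then have "\<forall>\<^sub>F F in finite_subsets_at_top UNIV. dist (sum ?a F) ?I < e^2"
    using e unfolding has_sum_def by (intro tendstoD) auto
  then obtain F where F: "finite F" "dist (sum ?a F) ?I < e^2"
    by (auto simp: eventually_finite_subsets_at_top)
  have "((\<lambda>n. if n \<in> F then ?a n else 0) has_sum sum ?a F) UNIV"
    using has_sum_finite[OF F(1), of ?a]
      has_sum_cong_neutral[of UNIV F "\<lambda>n. if n \<in> F then ?a n else 0" ?a "sum ?a F"] by auto
  note D = has_sum_diff[OF hs this]
  have "(\<lambda>n. ?a n - (if n \<in> F then ?a n else 0)) = (\<lambda>n. (norm (if n \<in> F then 0 else c n))^2)"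
    by auto
  with D have "((\<lambda>n. (norm (if n \<in> F then 0 else c n))^2) has_sum (?I - sum ?a F)) UNIV"
    by simp
  then have "(lnorm (\<lambda>n. if n \<in> F then 0 else c n))^2 = ?I - sum ?a F"
    unfolding lnorm_square by (rule infsumI)
  also have "\<dots> < e^2" using F(2) by (simp add: dist_real_def)
  finally have "lnorm (\<lambda>n. if n \<in> F then 0 else c n) < e" using e by (rule power2_less_imp_less[OF _ less_imp_le])
  then show ?thesis using that F(1) by blast
qed

lemma shiftS_funpow: "(shiftS ^^ n) c m = c (m - int n)"
  by (induction n arbitrary: m) (auto simp: shiftS_def algebra_simps)

lemma shiftS_add: "shiftS (c + d) = shiftS c + shiftS d"
  and shiftS_diff: "shiftS (c - d) = shiftS c - shiftS d"
  and shiftS_scale: "shiftS (cscale a c) = cscale a (shiftS c)"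
  by (auto simp: shiftS_def cscale_def fun_eq_iff)

lemma shiftS_funpow_add: "(shiftS ^^ n) (c + d) = (shiftS ^^ n) c + (shiftS ^^ n) d"
  and shiftS_funpow_diff: "(shiftS ^^ n) (c - d) = (shiftS ^^ n) c - (shiftS ^^ n) d"
  and shiftS_funpow_scale: "(shiftS ^^ n) (cscale a c) = cscale a ((shiftS ^^ n) c)"
  by (induction n) (simp_all add: shiftS_add shiftS_diff shiftS_scale del: plus_fun_apply minus_apply)

lemma shiftS_funpow_l2: "c \<in> l2 \<Longrightarrow> (shiftS ^^ n) c \<in> l2"
  by (induction n) (auto intro: shiftS_l2)

lemma lnorm_shiftS_funpow: "lnorm ((shiftS ^^ n) c) = lnorm c"
  by (induction n) (auto simp: lnorm_shiftS)

text \<open>Up to small tails both sequences are finitely supported, and a large shift makes the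
  supports disjoint. No eigenvector argument on the unit circle works without this decay.\<close>

lemma iprod_shiftS_tendsto_zero:
  assumes c: "c \<in> l2" and d: "d \<in> l2"
  shows "(\<lambda>n. iprod ((shiftS ^^ n) c) d) \<longlonglongrightarrow> 0"
proof (rule LIMSEQ_I)
  fix e :: real assume e: "e > 0"
  \<comment> \<open>The summand 1 keeps \<open>C\<close> positive and makes the final estimate
    strictly smaller than \<open>e\<close>.\<close>
  define C where "C = lnorm c + lnorm d + 1"
  have C: "C > 0" unfolding C_def using lnorm_nonneg[of c] lnorm_nonneg[of d] by linarith
  obtain F where F: "finite F" "lnorm (\<lambda>n. if n \<in> F then 0 else c n) < e / C" using l2_tail[OF c, of "e / C"] e C by auto
  obtain F' where F': "finite F'" "lnorm (\<lambda>n. if n \<in> F' then 0 else d n) < e / C" using l2_tail[OF d, of "e / C"] e C by auto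
  define cF where "cF = (\<lambda>n. if n \<in> F then c n else 0)"
  define cr where "cr = (\<lambda>n. if n \<in> F then 0 else c n)"
  define dF where "dF = (\<lambda>n. if n \<in> F' then d n else 0)"
  define dr where "dr = (\<lambda>n. if n \<in> F' then 0 else d n)"
  have cl: "cF \<in> l2" "cr \<in> l2" "dF \<in> l2" "dr \<in> l2"
  proof -
    have "cr = (\<lambda>n. if n \<notin> F then c n else 0)" "dr = (\<lambda>n. if n \<notin> F' then d n else 0)"
      by (auto simp: cr_def dr_def)
    then show "cF \<in> l2" "cr \<in> l2" "dF \<in> l2" "dr \<in> l2"
      unfolding cF_def dF_def using l2_restrict[OF c] l2_restrict[OF d] by metis+
  qed
  have eq: "c = cF + cr" "d = dF + dr" by (auto simp: cF_def cr_def dF_def dr_def fun_eq_iff)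
  obtain A where A: "\<And>k. k \<in> F \<Longrightarrow> \<bar>k\<bar> \<le> A"
    using F(1) by (metis Max_ge finite_imageI imageI)
  obtain B where B: "\<And>k. k \<in> F' \<Longrightarrow> \<bar>k\<bar> \<le> B"
    using F'(1) by (metis Max_ge finite_imageI imageI)
  have "norm (iprod ((shiftS ^^ n) c) d - 0) < e" if n: "n > nat (\<bar>A\<bar> + \<bar>B\<bar>)" for n
  proof -
    have "hdot ((shiftS ^^ n) cF m) (dF m) = 0" for m
    proof -
      have "m - int n \<notin> F \<or> m \<notin> F'" using A[of "m - int n"] B[of m] n by linarith
      then show ?thesis by (auto simp: shiftS_funpow cF_def dF_def)
    qed
    then have zero: "iprod ((shiftS ^^ n) cF) dF = 0" by (simp add: iprod_hdot)
    have "iprod ((shiftS ^^ n) c) d = iprod ((shiftS ^^ n) cF) dF + iprod ((shiftS ^^ n) cF) dr + iprod ((shiftS ^^ n) cr) d"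
    proof -
      have "iprod ((shiftS ^^ n) c) d = iprod ((shiftS ^^ n) cF) d + iprod ((shiftS ^^ n) cr) d"
        unfolding eq(1) shiftS_funpow_add by (intro iprod_add_left shiftS_funpow_l2 cl d)
      moreover have "iprod ((shiftS ^^ n) cF) d = iprod ((shiftS ^^ n) cF) dF + iprod ((shiftS ^^ n) cF) dr"
        unfolding eq(2) by (intro iprod_add_right shiftS_funpow_l2 cl)
      ultimately show ?thesis by simp
    qed
    then have "norm (iprod ((shiftS ^^ n) c) d) \<le> lnorm cF * lnorm dr + lnorm cr * lnorm d"
      unfolding zero
      using norm_triangle_ineq[of "iprod ((shiftS ^^ n) cF) dr" "iprod ((shiftS ^^ n) cr) d"]
        cmod_iprod_le[OF shiftS_funpow_l2[OF cl(1)] cl(4), of n] cmod_iprod_le[OF shiftS_funpow_l2[OF cl(2)] d, of n]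
      by (simp add: lnorm_shiftS_funpow)
    also have "\<dots> \<le> lnorm c * (e / C) + (e / C) * lnorm d"
    proof (intro add_mono mult_mono)
      show "lnorm cF \<le> lnorm c" unfolding cF_def by (rule lnorm_restrict_le[OF c])
      show "lnorm dr \<le> e / C" "lnorm cr \<le> e / C" using F(2) F'(2) by (auto simp: cr_def dr_def)
    qed (use e C in auto)
    also have "\<dots> = (lnorm c + lnorm d) * (e / C)" by (simp only: distrib_right mult.commute[of "e / C"])
    also have "\<dots> = (C - 1) * (e / C)" by (simp add: C_def)
    also have "\<dots> < C * (e / C)" using e C by (intro mult_strict_right_mono) auto
    finally show ?thesis using C by simp
  qed
  then show "\<exists>N. \<forall>n\<ge>N. norm (iprod ((shiftS ^^ n) c) d - 0) < e"
    by (intro exI[of _ "Suc (nat (\<bar>A\<bar> + \<bar>B\<bar>))"]) auto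
qed

lemma Vminus_funpow_K2: "x \<in> K2seq \<Longrightarrow> (Vminus ^^ n) x m = (if m < 0 then x (m - int n) else 0)"
  by (induction n arbitrary: m) (auto simp: Vminus_def K2seq_def algebra_simps)

lemma iprod_Vminus_funpow:
  assumes "x \<in> K2seq" "y \<in> K2seq"
  shows "iprod ((Vminus ^^ n) x) y = iprod ((shiftS ^^ n) x) y"
  using assms(2) by (intro iprod_cong) (auto simp: Vminus_funpow_K2[OF assms(1)] shiftS_funpow K2seq_def)

text \<open>The second differences vanish, so \<open>e\<close> is an arithmetic progression; one
  that converges to 0 is constantly 0.\<close>

lemma affine_null_sequence:
  fixes e :: "nat \<Rightarrow> complex"
  assumes rec: "\<And>n. 2 * e (Suc n) = e (Suc (Suc n)) + e n" and lim: "e \<longlonglongrightarrow> 0"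
  shows "e 0 = 0"
proof -
  define \<delta> where "\<delta> = e (Suc 0) - e 0"
  have step: "e (Suc n) - e n = \<delta>" for n
  proof (induction n)
    case (Suc n)
    then show ?case using rec[of n] by (simp add: algebra_simps)
  qed (simp add: \<delta>_def)
  have "(\<lambda>n. e (Suc n) - e n) \<longlonglongrightarrow> 0 - 0" by (intro tendsto_diff LIMSEQ_Suc lim)
  then have "\<delta> = 0" unfolding step by (simp add: LIMSEQ_const_iff)
  then have "e n = e 0" for n using step by (induction n) auto
  then have "e = (\<lambda>n. e 0)" by auto
  then show ?thesis using lim by (metis LIMSEQ_const_iff)
qed

text \<open>Multiplying a sequence by \<open>1 - \<mu> S\<close> acts on its autocorrelation as
  minus a twisted second difference; the factor 2 is \<open>1 + \<mu> * cnj \<mu>\<close> for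
  unimodular \<mu>.\<close>

lemma autocorrelation_one_minus_shift:
  assumes c: "c \<in> l2" and \<mu>: "cmod \<mu> = 1"
  defines "c' \<equiv> c - cscale \<mu> (shiftS c)"
  shows "iprod ((shiftS ^^ Suc n) c') c' = 2 * iprod ((shiftS ^^ Suc n) c) c
    - \<mu> * iprod ((shiftS ^^ Suc (Suc n)) c) c - cnj \<mu> * iprod ((shiftS ^^ n) c) c"
proof -
  let ?p = "\<lambda>m. (shiftS ^^ m) c"
  have \<mu>': "\<mu> * cnj \<mu> = 1" using complex_norm_square[of \<mu>] \<mu> by simp
  have l: "?p m \<in> l2" for m by (rule shiftS_funpow_l2[OF c])
  have Sc: "shiftS c \<in> l2" by (rule shiftS_l2[OF c])
  have a: "(shiftS ^^ Suc n) c' = ?p (Suc n) - cscale \<mu> (?p (Suc (Suc n)))"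
    unfolding c'_def shiftS_funpow_diff shiftS_funpow_scale by (simp add: funpow_swap1)
  have cr: "iprod (?p (Suc m)) (shiftS c) = iprod (?p m) c" for m by (simp add: iprod_shiftS)
  have e: "iprod w c' = iprod w c - cnj \<mu> * iprod w (shiftS c)" if "w \<in> l2" for w
    unfolding c'_def using that c Sc by (simp add: iprod_diff_right l2_scale iprod_scale_right del: minus_apply)
  have "c' \<in> l2" unfolding c'_def by (intro l2_diff l2_scale c Sc)
  then have "iprod ((shiftS ^^ Suc n) c') c' = iprod (?p (Suc n)) c' - \<mu> * iprod (?p (Suc (Suc n))) c'"
    unfolding a using l[of "Suc n"] l[of "Suc (Suc n)"]
    by (simp add: iprod_diff_left l2_scale iprod_scale_left del: funpow.simps minus_apply)
  also have "\<dots> = (iprod (?p (Suc n)) c - cnj \<mu> * iprod (?p n) c)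
      - \<mu> * (iprod (?p (Suc (Suc n))) c - cnj \<mu> * iprod (?p (Suc n)) c)"
    unfolding e[OF l] cr ..
  also have "\<dots> = iprod (?p (Suc n)) c + (\<mu> * cnj \<mu>) * iprod (?p (Suc n)) c
     - \<mu> * iprod (?p (Suc (Suc n))) c - cnj \<mu> * iprod (?p n) c"
    by (simp only: algebra_simps)
  finally show ?thesis unfolding \<mu>' by simp
qed

lemma lnorm_Einj: "lnorm (Einj u) = norm u"
proof -
  have "(\<Sum>\<^sub>\<infinity>n. (norm (Einj u n))^2) = (norm (Einj u 0))^2"
    by (rule infsum_single) (simp add: Einj_def)
  then show ?thesis by (simp add: lnorm_def Einj_def)
qed

lemma lnorm_orthogonal_sum:
  assumes "c \<in> l2" "d \<in> l2" "\<And>n. c n = 0 \<or> d n = 0"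
  shows "(lnorm (c + d))^2 = (lnorm c)^2 + (lnorm d)^2"
proof -
  have "hdot (c n) (d n) = 0" for n using assms(3)[of n] by auto
  then have "iprod c d = 0" by (simp add: iprod_hdot)
  then show ?thesis using lnorm_add_square[OF assms(1,2)] by simp
qed

lemma H2_norm_decomp: "c \<in> H2seq \<Longrightarrow> (lnorm c)^2 = (norm (c 0))^2 + (lnorm (Sst c))^2"
proof -
  assume c: "c \<in> H2seq"
  have "(lnorm (Einj (c 0) + shiftS (Sst c)))^2 = (lnorm (Einj (c 0)))^2 + (lnorm (shiftS (Sst c)))^2"
    by (intro lnorm_orthogonal_sum Einj_l2 shiftS_l2 Sst_l2 H2seq_l2 c) (auto simp: Einj_def shiftS_def Sst_def)
  then show ?thesis using H2_decomp[OF c] by (simp add: lnorm_Einj lnorm_shiftS)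
qed

lemma K2_norm_decomp:
  assumes x: "x \<in> K2seq"
  shows "shiftS x = Vminus x + Einj (x (- 1))" "(lnorm x)^2 = (lnorm (Vminus x))^2 + (norm (x (- 1)))^2"
proof -
  show eq: "shiftS x = Vminus x + Einj (x (- 1))"
    using x by (auto simp: shiftS_def Vminus_def Einj_def K2seq_def fun_eq_iff)
  have "(lnorm (Vminus x + Einj (x (- 1))))^2 = (lnorm (Vminus x))^2 + (lnorm (Einj (x (- 1))))^2"
    by (intro lnorm_orthogonal_sum Einj_l2 Vminus_l2 K2seq_l2 x) (auto simp: Einj_def Vminus_def)
  then show "(lnorm x)^2 = (lnorm (Vminus x))^2 + (norm (x (- 1)))^2"
    using lnorm_shiftS[of x] unfolding eq by (simp add: lnorm_Einj)
qed

section \<open>Spectra of the state operators\<close>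

context nehari_data
begin

lemma Vminus_funpow_X: "x \<in> X \<Longrightarrow> (Vminus ^^ n) x \<in> X"
  by (induction n) (auto intro: Vminus_X)

text \<open>For an eigenvector \<open>y\<close> the numbers \<open>iprod ((Vminus ^^ n) y) y\<close>
  are \<open>cnj \<mu> ^ n\<close> times a positive constant. They are also autocorrelations of
  \<open>y\<close>, which tend to 0.\<close>

lemma Zs_stable: "\<mu> \<in> seqs.eigvals X Zs \<Longrightarrow> cmod \<mu> < 1"
proof (rule ccontr)
  assume "\<mu> \<in> seqs.eigvals X Zs" and "\<not> cmod \<mu> < 1"
  then obtain y where y: "y \<in> X" "y \<noteq> 0" "Zs y = cscale \<mu> y" and \<mu>: "cmod \<mu> \<ge> 1"
    by (auto simp: seqs.eigvals_def)
  have ind: "iprod ((Vminus ^^ n) y) y = cnj \<mu> ^ n * iprod y y" for n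
  proof (induction n)
    case (Suc n)
    have "iprod ((Vminus ^^ Suc n) y) y = cnj \<mu> * iprod ((Vminus ^^ n) y) y"
      using Zs_adj[OF y(1) Vminus_funpow_X[OF y(1), of n]] y(3) by (simp add: iprod_scale_right)
    then show ?case unfolding Suc by simp
  qed simp
  have "(\<lambda>n. cmod (iprod ((shiftS ^^ n) y) y)) \<longlonglongrightarrow> 0"
    using tendsto_norm[OF iprod_shiftS_tendsto_zero[OF X_in_l2[OF y(1)] X_in_l2[OF y(1)]]] by simp
  then have lim: "(\<lambda>n. cmod \<mu> ^ n * cmod (iprod y y)) \<longlonglongrightarrow> 0"
    unfolding iprod_Vminus_funpow[OF X_K2 X_K2, OF y(1) y(1), symmetric] ind
    by (simp add: norm_mult norm_power)
  have "cmod (iprod y y) \<le> 0"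
  proof (rule LIMSEQ_le_const[OF lim])
    have "1 * cmod (iprod y y) \<le> cmod \<mu> ^ n * cmod (iprod y y)" for n
      using \<mu> by (intro mult_right_mono one_le_power) auto
    then show "\<exists>N. \<forall>n\<ge>N. cmod (iprod y y) \<le> cmod \<mu> ^ n * cmod (iprod y y)" by auto
  qed
  then show False using y iprod_self[OF X_in_l2[OF y(1)]] lnorm_eq_zero_iff[OF X_in_l2[OF y(1)]] by simp
qed

lemma H_shift_funpow: "k \<in> H2seq \<Longrightarrow> (shiftS ^^ n) k \<in> H2seq \<and> H ((shiftS ^^ n) k) = (Vminus ^^ n) (H k)"
  by (induction n) (auto simp: H_shift intro: shiftS_H2)

text \<open>Against \<open>K2seq\<close> a power of the shift may be replaced by the same power of
  \<open>Vminus\<close>, which passes through \<open>H\<close>; then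
  \<open>Ws (H l) = cscale g2 l\<close> finishes.\<close>

lemma autocorrelation_K:
  assumes k: "k \<in> H2seq" and l: "l \<in> K"
  shows "iprod ((shiftS ^^ n) (H k)) (H l) = g2 * iprod ((shiftS ^^ n) k) l"
proof -
  have lH: "l \<in> H2seq" and Wl: "Ws (H l) = cscale g2 l" using l by (auto simp: K_def)
  have "iprod ((shiftS ^^ n) (H k)) (H l) = iprod (H ((shiftS ^^ n) k)) (H l)"
    using iprod_Vminus_funpow[OF X_K2[OF H_X[OF k]] X_K2[OF H_X[OF lH]], of n] H_shift_funpow[OF k, of n] by simp
  also have "\<dots> = iprod ((shiftS ^^ n) k) (cscale g2 l)"
    unfolding Wl[symmetric] using H_shift_funpow[OF k, of n] by (intro Ws_adj H_X lH) simp
  finally show ?thesis by (simp add: iprod_scale_right)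
qed

text \<open>The quadratic form \<open>iprod (Xi G x) x\<close>, written with norms so that it is
  real by construction.\<close>

definition q :: "'q seq \<Rightarrow> real" where
  "q x = (gam G)^2 * (lnorm x)^2 - (lnorm (Ws x))^2"

lemma q_nonneg: "x \<in> X \<Longrightarrow> 0 \<le> q x"
  using power_mono[OF lnorm_Ws_le, of x 2] by (simp add: q_def power_mult_distrib)

text \<open>Isotropic vectors of this semidefinite form lie in the kernel of \<open>Xi G\<close>,
  because the squared norm of \<open>Xi G x\<close> is at most
  \<open>(gam G)^2 * q x\<close>.\<close>

lemma q_zero: "x \<in> X \<Longrightarrow> q x = 0 \<Longrightarrow> Xi G x = 0"
proof -
  assume x: "x \<in> X" and q0: "q x = 0"
  have HW: "H (Ws x) \<in> X" by (intro H_X Ws_H2 x)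
  have ip: "iprod (H (Ws x)) (cscale g2 x) = complex_of_real ((gam G)^2 * (lnorm (Ws x))^2)"
    by (simp add: iprod_scale_right iprod_HW x iprod_self[OF Ws_l2[OF x]])
  have "(lnorm (H (Ws x)))^2 \<le> (gam G * lnorm (Ws x))^2"
    by (intro power_mono hankel_le_gam[OF Linf] Ws_H2 x) simp
  moreover have "(lnorm (cscale g2 x))^2 = (gam G)^2 * ((gam G)^2 * (lnorm x)^2)"
    by (simp add: lnorm_scale norm_power power_mult_distrib norm_mult)
  moreover have "(lnorm (H (Ws x) - cscale g2 x))^2 = (lnorm (H (Ws x)))^2 + (lnorm (cscale g2 x))^2
      - 2 * ((gam G)^2 * (lnorm (Ws x))^2)"
    using lnorm_diff_square[OF X_in_l2[OF HW] l2_scale[OF X_in_l2[OF x]], of g2] unfolding ip by simp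
  ultimately have "(lnorm (H (Ws x) - cscale g2 x))^2 \<le> (gam G)^2 * q x"
    by (simp add: q_def power_mult_distrib algebra_simps)
  then have "lnorm (H (Ws x) - cscale g2 x) = 0" using q0 by simp
  then have "H (Ws x) - cscale g2 x = 0"
    by (rule lnorm_eq_zero_iff[THEN iffD1, rotated]) (intro l2_diff l2_scale X_in_l2 HW x)
  then show "Xi G x = 0" by (simp add: Xi_eq)
qed

lemma Top_eq: "Top G = (\<lambda>x. Zs (Delta_inv G (Xi G x)))"
  by (simp add: Top_def fun_eq_iff)

lemma Top_lin: "seqs.lin_on X (Top G)"
  unfolding Top_eq by (intro seqs.lin_on_compose[OF Zs_lin] seqs.lin_on_compose[OF Delta_inv_lin] Xi_lin)

lemma lnorm_Zs_le: "y \<in> X \<Longrightarrow> lnorm (Zs y) \<le> lnorm y"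
proof -
  assume y: "y \<in> X"
  have z: "Zs y \<in> X" by (rule Zs_X[OF y])
  have "complex_of_real ((lnorm (Zs y))^2) = iprod (Vminus (Zs y)) y"
    using Zs_adj[OF y z] iprod_self[OF X_in_l2[OF z]] by simp
  then have "(lnorm (Zs y))^2 \<le> lnorm (Vminus (Zs y)) * lnorm y"
    using cmod_iprod_le[OF Vminus_l2[OF X_in_l2[OF z]] X_in_l2[OF y]]
    by (metis abs_of_nonneg norm_of_real zero_le_power2)
  also have "\<dots> \<le> lnorm (Zs y) * lnorm y"
    by (intro mult_right_mono lnorm_Vminus_le X_in_l2 z) simp
  finally have *: "lnorm (Zs y) * lnorm (Zs y) \<le> lnorm (Zs y) * lnorm y" by (simp add: power2_eq_square)
  then show ?thesis using lnorm_nonneg[of "Zs y"] lnorm_nonneg[of y]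
    by (cases "lnorm (Zs y) = 0") (auto simp: less_le)
qed

text \<open>The quadratic form \<open>q\<close> of \<open>\<Xi>\<close> satisfies a Stein inequality along \<open>Z\<^sup>* \<Delta>\<inverse> \<Xi>\<close>, which excludes
  eigenvalues outside the closed disc. An eigenvector \<open>x\<close> for \<open>\<mu>\<close> on the unit circle would yield a maximizing
  vector \<open>(1 - \<mu> S) W\<^sup>* x\<close>, and comparing autocorrelations would give \<open>q x = 0\<close>.\<close>

lemma Top_stable: "\<mu> \<in> seqs.eigvals X (Top G) \<Longrightarrow> cmod \<mu> < 1"
proof (rule ccontr)
  assume "\<mu> \<in> seqs.eigvals X (Top G)" and "\<not> cmod \<mu> < 1"
  then obtain x where x: "x \<in> X" "x \<noteq> 0" "Top G x = cscale \<mu> x" and \<mu>: "cmod \<mu> \<ge> 1"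
    by (auto simp: seqs.eigvals_def)
  define m where "m = (cmod \<mu>)^2"
  have m: "m \<ge> 1" using \<mu> by (simp add: m_def)
  define y where "y = Delta_inv G (Xi G x)"
  have XiX: "Xi G x \<in> X" by (rule seqs.lin_onD(1)[OF Xi_lin x(1)])
  have y: "y \<in> X" unfolding y_def by (rule Delta_inv_X[OF XiX])
  have Dy: "Delta G y = Xi G x" unfolding y_def by (rule Delta_Delta_inv[OF XiX])
  have Zy: "Zs y = cscale \<mu> x" using x(3) by (simp add: Top_eq y_def)
  have xl: "x \<in> l2" and yl: "y \<in> l2" using x y by (auto intro: X_in_l2)
  have wxl: "Ws x \<in> l2" and wyl: "Ws y \<in> l2" using x y by (auto intro: Ws_l2)
  have WZy: "Sst (Ws y) = cscale \<mu> (Ws x)" using Ws_Zs[OF y] Zy Ws_scale[OF x(1)] by simp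
  define c where "c = (norm (Ws y 0))^2"
  have wy: "(lnorm (Ws y))^2 = c + m * (lnorm (Ws x))^2"
    using H2_norm_decomp[OF Ws_H2[OF y]] WZy by (simp add: c_def m_def lnorm_scale power_mult_distrib)
  have "iprod (Delta G y) y = complex_of_real ((gam G)^2 * (lnorm y)^2 - m * (lnorm (Ws x))^2)"
    using iprod_Delta[OF y y] Zy Ws_scale[OF x(1), of \<mu>] iprod_self[OF l2_scale[OF wxl, of \<mu>]]
    by (simp add: iprod_self yl lnorm_scale m_def power_mult_distrib)
  then have ipD: "Re (iprod (Xi G x) y) = (gam G)^2 * (lnorm y)^2 - m * (lnorm (Ws x))^2"
    unfolding Dy by simp
  have ip: "Re (iprod (Xi G x) y) = (gam G)^2 * Re (iprod x y) - Re (iprod (Ws x) (Ws y))"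
    unfolding iprod_Xi[OF x(1) y] by (simp flip: of_real_power)
  \<comment> \<open>Since \<open>Delta G y = Xi G x\<close>, the mixed term can be evaluated with
    the form of \<open>Delta G\<close> at \<open>y\<close>, where
    \<open>Zs y = cscale \<mu> x\<close>.\<close>
  have "q (x - y) = q x + q y - 2 * Re (iprod (Xi G x) y)"
    unfolding q_def Ws_diff[OF x(1) y] lnorm_diff_square[OF xl yl] lnorm_diff_square[OF wxl wyl] ip
    by (simp add: algebra_simps)
  also have "\<dots> = (1 - m) * q x - (gam G)^2 * ((lnorm y)^2 - m * (lnorm x)^2) - c"
    unfolding ipD q_def wy by (simp add: algebra_simps)
  \<comment> \<open>Four terms that are nonnegative for \<open>m \<ge> 1\<close> add up to 0, so
    each of them vanishes.\<close>
  finally have key: "q (x - y) + (m - 1) * q x + (gam G)^2 * ((lnorm y)^2 - m * (lnorm x)^2) + c = 0"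
    by (simp add: algebra_simps)
  have nn1: "0 \<le> q (x - y)" by (intro q_nonneg X_diff x y)
  have nn2: "0 \<le> (m - 1) * q x" using m q_nonneg[OF x(1)] by simp
  have "(lnorm (Zs y))^2 \<le> (lnorm y)^2" by (intro power_mono lnorm_Zs_le y) simp
  then have mle: "m * (lnorm x)^2 \<le> (lnorm y)^2" unfolding Zy by (simp add: lnorm_scale power_mult_distrib m_def)
  then have nn3: "0 \<le> (gam G)^2 * ((lnorm y)^2 - m * (lnorm x)^2)" by simp
  have nn4: "0 \<le> c" by (simp add: c_def)
  have z1: "q (x - y) = 0" and z2: "(m - 1) * q x = 0"
    and z3: "(gam G)^2 * ((lnorm y)^2 - m * (lnorm x)^2) = 0" and z4: "c = 0"
    using key nn1 nn2 nn3 nn4 by linarith+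
  \<comment> \<open>If \<open>q x = 0\<close>, then \<open>Xi G x = 0\<close>, hence
    \<open>y = 0\<close>, although the norm of \<open>y\<close> is at least
    \<open>cmod \<mu>\<close> times that of \<open>x\<close>.\<close>
  have qx: "q x \<noteq> 0"
  proof
    assume "q x = 0"
    then have "Delta G y = 0" using q_zero[OF x(1)] Dy by simp
    moreover have "Delta G 0 = 0" by (rule seqs.lin_on_zero[OF Delta_lin subspace_X])
    ultimately have "y = 0"
      using inj_onD[OF bij_betw_imp_inj_on[OF Delta_bij], of y 0] y X_zero by simp
    then have "m * (lnorm x)^2 \<le> 0" using mle by simp
    then have "lnorm x = 0" using m by (simp add: mult_le_0_iff)
    then show False using x lnorm_eq_zero_iff[OF xl] by simp
  qed
  then have m1: "m = 1" using z2 by simp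
  then have \<mu>1: "cmod \<mu> = 1" using \<mu> by (simp add: m_def abs_square_eq_1)
  have nxy: "(lnorm y)^2 = (lnorm x)^2" using z3 gam_pos m1 by simp
  have \<mu>': "cnj \<mu> * \<mu> = 1" using complex_norm_square[of \<mu>] \<mu>1 by (simp add: mult.commute)
  have Vl: "Vminus x \<in> l2" by (rule Vminus_l2[OF xl])
  have "iprod y (Vminus x) = \<mu> * complex_of_real ((lnorm x)^2)"
    using Zs_adj[OF y x(1)] Zy iprod_cnj[of "Vminus x" y] by (simp add: iprod_scale_right iprod_self[OF xl])
  then have "iprod y (cscale \<mu> (Vminus x)) = (cnj \<mu> * \<mu>) * complex_of_real ((lnorm x)^2)"
    by (simp add: iprod_scale_right)
  then have "Re (iprod y (cscale \<mu> (Vminus x))) = (lnorm x)^2" unfolding \<mu>' by simp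
  \<comment> \<open>The equality case of the contraction \<open>Zs\<close>. The right-hand side is
    minus the squared norm of \<open>x (- 1)\<close>, so \<open>y = cscale \<mu> (Vminus x)\<close>
    and the truncation in \<open>Vminus x\<close> loses nothing.\<close>
  then have dV: "(lnorm (y - cscale \<mu> (Vminus x)))^2 = (lnorm (Vminus x))^2 - (lnorm x)^2"
    using lnorm_diff_square[OF yl l2_scale[OF Vl], of \<mu>] nxy \<mu>1 by (simp add: lnorm_scale)
  have nV: "(lnorm (Vminus x))^2 + (norm (x (- 1)))^2 = (lnorm x)^2"
    using K2_norm_decomp(2)[OF X_K2[OF x(1)]] by simp
  then have "(lnorm (y - cscale \<mu> (Vminus x)))^2 + (norm (x (- 1)))^2 = 0" using dV by linarith
  then have d0: "lnorm (y - cscale \<mu> (Vminus x)) = 0" and x1: "x (- 1) = 0"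
    by (auto simp: add_nonneg_eq_0_iff)
  have "y - cscale \<mu> (Vminus x) = 0"
    by (rule lnorm_eq_zero_iff[THEN iffD1, OF _ d0]) (intro l2_diff l2_scale yl Vl)
  moreover have "shiftS x = Vminus x"
    using K2_norm_decomp(1)[OF X_K2[OF x(1)]] x1 by (simp add: Einj_def fun_eq_iff)
  ultimately have yS: "y = cscale \<mu> (shiftS x)" by simp
  have "Ws y = Einj (Ws y 0) + shiftS (Sst (Ws y))" by (rule H2_decomp[OF Ws_H2[OF y]])
  moreover have "Einj (Ws y 0) = 0" using z4 by (auto simp: c_def Einj_def fun_eq_iff)
  ultimately have WyS: "Ws y = cscale \<mu> (shiftS (Ws x))" by (metis WZy shiftS_scale add_0)
  \<comment> \<open>This is the vector \<open>(1 - \<mu> S)\<close> applied to \<open>Ws x\<close>.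
    As \<open>q (x - y) = 0\<close>, \<open>Xi G\<close> kills \<open>x - y\<close>, which makes
    \<open>k\<close> an element of \<open>K\<close>.\<close>
  define k where "k = Ws (x - y)"
  have kH: "k \<in> H2seq" unfolding k_def by (intro Ws_H2 X_diff x y)
  have kf: "k = Ws x - cscale \<mu> (shiftS (Ws x))" unfolding k_def Ws_diff[OF x(1) y] WyS ..
  have Hk: "H k = cscale g2 (x - cscale \<mu> (shiftS x))"
    using q_zero[OF X_diff[OF x(1) y] z1] yS by (simp add: Xi_eq k_def)
  have kK: "k \<in> K"
    using Hk kH Ws_scale[OF X_diff[OF x(1) y], of g2] yS by (simp add: K_def k_def)
  \<comment> \<open>The gap between the autocorrelations of \<open>Ws x\<close> and of
    \<open>x\<close> scaled by \<open>g2\<close>; at \<open>n = 0\<close> it is minus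
    \<open>q x\<close>. Applying \<open>1 - \<mu> S\<close> to both sequences closes the gap, which
    yields the recursion below.\<close>
  define d where "d n = iprod ((shiftS ^^ n) (Ws x)) (Ws x) - g2 * iprod ((shiftS ^^ n) x) x" for n
  have rec: "2 * d (Suc n) = \<mu> * d (Suc (Suc n)) + cnj \<mu> * d n" for n
  proof -
    have g0: "g2 \<noteq> 0" using gam_pos by simp
    let ?x = "x - cscale \<mu> (shiftS x)"
    have "iprod ((shiftS ^^ Suc n) (H k)) (H k) = g2 * (cnj g2 * iprod ((shiftS ^^ Suc n) ?x) ?x)"
      unfolding Hk shiftS_funpow_scale iprod_scale_left iprod_scale_right by (simp only: mult_ac)
    then have "g2 * (g2 * iprod ((shiftS ^^ Suc n) ?x) ?x) = g2 * iprod ((shiftS ^^ Suc n) k) k"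
      using autocorrelation_K[OF kH kK, of "Suc n"] by simp
    then have "g2 * iprod ((shiftS ^^ Suc n) ?x) ?x = iprod ((shiftS ^^ Suc n) k) k" using g0 mult_left_cancel by blast
    then have "g2 * (2 * iprod ((shiftS ^^ Suc n) x) x - \<mu> * iprod ((shiftS ^^ Suc (Suc n)) x) x
          - cnj \<mu> * iprod ((shiftS ^^ n) x) x)
        = 2 * iprod ((shiftS ^^ Suc n) (Ws x)) (Ws x) - \<mu> * iprod ((shiftS ^^ Suc (Suc n)) (Ws x)) (Ws x)
          - cnj \<mu> * iprod ((shiftS ^^ n) (Ws x)) (Ws x)"
      unfolding kf autocorrelation_one_minus_shift[OF xl \<mu>1] autocorrelation_one_minus_shift[OF wxl \<mu>1] .
    then show ?thesis unfolding d_def by (simp add: algebra_simps del: funpow.simps)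
  qed
  \<comment> \<open>The factor \<open>\<mu> ^ n\<close> absorbs the phases of the recursion and
    leaves the size unchanged, so the lemma on affine null sequences applies.\<close>
  have "\<mu> ^ 0 * d 0 = 0"
  proof (rule affine_null_sequence)
    show "2 * (\<mu> ^ Suc n * d (Suc n)) = \<mu> ^ Suc (Suc n) * d (Suc (Suc n)) + \<mu> ^ n * d n" for n
    proof -
      have "2 * (\<mu> ^ Suc n * d (Suc n)) = \<mu> ^ Suc n * (\<mu> * d (Suc (Suc n)) + cnj \<mu> * d n)"
        unfolding rec[symmetric] by simp
      also have "\<dots> = \<mu> ^ Suc (Suc n) * d (Suc (Suc n)) + \<mu> ^ n * (cnj \<mu> * \<mu>) * d n"
        by (simp add: algebra_simps)
      finally show ?thesis unfolding \<mu>' by simp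
    qed
    have "d \<longlonglongrightarrow> 0 - g2 * 0"
      unfolding d_def by (intro tendsto_diff tendsto_mult tendsto_const iprod_shiftS_tendsto_zero xl wxl)
    then have "(\<lambda>n. cmod (d n)) \<longlonglongrightarrow> 0" using tendsto_norm by fastforce
    then have "(\<lambda>n. cmod (\<mu> ^ n * d n)) \<longlonglongrightarrow> 0" by (simp add: norm_mult norm_power \<mu>1)
    then show "(\<lambda>n. \<mu> ^ n * d n) \<longlonglongrightarrow> 0" by (rule tendsto_norm_zero_cancel)
  qed
  then have "complex_of_real (q x) = 0"
    by (simp add: d_def q_def iprod_self xl wxl)
  then show False using qx by simp
qed

text \<open>Ensures that the spectrum is nonempty, so that the supremum in
  \<open>spec_radius\<close> is a maximum over finitely many eigenvalue moduli.\<close>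

lemma X_nontrivial: "X \<noteq> {0}"
proof
  assume X0: "X = {0}"
  define u :: "complex^'p" where "u = axis undefined 1"
  have "H (kvec u) = 0" using H_X[OF kvec_H2] X0 by blast
  then have "gam G * lnorm (kvec u) = 0" using K_lnorm[OF kvec(1), of u] by simp
  then have "kvec u = 0" using gam_pos lnorm_eq_zero_iff[OF H2seq_l2[OF kvec_H2]] by simp
  then have "u = 0" using kvec(2)[of u] by simp
  then show False by (simp add: u_def axis_eq_0_iff)
qed

text \<open>On the finite-dimensional space \<open>X\<close>, failure of bijectivity is the
  existence of a nonzero kernel vector.\<close>

lemma spectrum_on_eq: "seqs.lin_on X T \<Longrightarrow> spectrum_on X T = seqs.eigvals X T"
proof (intro set_eqI iffI)
  fix \<mu> assume T: "seqs.lin_on X T"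
  have fn: "(\<lambda>x n. \<mu> *s x n - T x n) = (\<lambda>x. cscale \<mu> x - T x)" by (auto simp: cscale_def fun_eq_iff)
  have lin: "seqs.lin_on X (\<lambda>x. cscale \<mu> x - T x)" by (rule seqs.lin_on_scaled_diff[OF T subspace_X])
  {
    assume "\<mu> \<in> spectrum_on X T"
    then have "\<not> bij_betw (\<lambda>x. cscale \<mu> x - T x) X X" by (simp add: spectrum_on_def fn)
    then obtain v where "v \<in> X" "cscale \<mu> v - T v = 0" "v \<noteq> 0"
      using seqs.lin_on_bij[OF finite_dim_X lin] by blast
    then show "\<mu> \<in> seqs.eigvals X T" unfolding seqs.eigvals_def by (auto intro!: bexI[of _ v])
  next
    assume "\<mu> \<in> seqs.eigvals X T"
    then obtain v where v: "v \<in> X" "v \<noteq> 0" "T v = cscale \<mu> v" by (auto simp: seqs.eigvals_def)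
    have "cscale \<mu> v - T v = cscale \<mu> 0 - T 0" using v(3) seqs.lin_on_zero[OF T subspace_X] by simp
    then have "\<not> inj_on (\<lambda>x. cscale \<mu> x - T x) X" using v X_zero unfolding inj_on_def by blast
    then show "\<mu> \<in> spectrum_on X T" by (simp add: spectrum_on_def fn bij_betw_def)
  }
qed

lemma spec_radius_Top: "spec_radius X (Top G) < 1"
proof -
  have fin: "finite (cmod ` seqs.eigvals X (Top G))"
    by (intro finite_imageI seqs.finite_eigvals finite_dim_X Top_lin)
  have ne: "cmod ` seqs.eigvals X (Top G) \<noteq> {}"
    using seqs.ex_eigenvalue[OF finite_dim_X Top_lin X_nontrivial] by simp
  show ?thesis
    unfolding spec_radius_def spectrum_on_eq[OF Top_lin] cSup_eq_Max[OF fin ne]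
    using Top_stable fin ne by (subst Max_less_iff) auto
qed

end

section \<open>Rational functions without poles in the closed disc\<close>

definition ratfun :: "(complex \<Rightarrow> complex) \<Rightarrow> bool" where
  "ratfun \<phi> \<longleftrightarrow> (\<exists>a b :: complex poly. \<forall>z\<in>cball 0 1. poly b z \<noteq> 0 \<and> \<phi> z = poly a z / poly b z)"

lemma ratfunI: "(\<And>z. z \<in> cball 0 1 \<Longrightarrow> poly b z \<noteq> 0) \<Longrightarrow> (\<And>z. z \<in> cball 0 1 \<Longrightarrow> \<phi> z = poly a z / poly b z) \<Longrightarrow> ratfun \<phi>"
  unfolding ratfun_def by blast

lemma ratfunE:
  assumes "ratfun \<phi>"
  obtains a b :: "complex poly" where "\<And>z. z \<in> cball 0 1 \<Longrightarrow> poly b z \<noteq> 0"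
    "\<And>z. z \<in> cball 0 1 \<Longrightarrow> \<phi> z = poly a z / poly b z"
  using assms unfolding ratfun_def by blast

lemma ratfun_add:
  assumes "ratfun \<phi>" "ratfun \<psi>" shows "ratfun (\<lambda>z. \<phi> z + \<psi> z)"
proof -
  obtain a b :: "complex poly" where 1: "\<forall>z\<in>cball 0 1. poly b z \<noteq> 0 \<and> \<phi> z = poly a z / poly b z"
    using assms(1) unfolding ratfun_def by blast
  obtain c d :: "complex poly" where 2: "\<forall>z\<in>cball 0 1. poly d z \<noteq> 0 \<and> \<psi> z = poly c z / poly d z"
    using assms(2) unfolding ratfun_def by blast
  show ?thesis
    by (rule ratfunI[of "b * d" _ "a * d + c * b"]) (auto simp: 1 2 add_frac_eq)
qed

lemma ratfun_mult:
  assumes "ratfun \<phi>" "ratfun \<psi>" shows "ratfun (\<lambda>z. \<phi> z * \<psi> z)"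
proof -
  obtain a b :: "complex poly" where 1: "\<forall>z\<in>cball 0 1. poly b z \<noteq> 0 \<and> \<phi> z = poly a z / poly b z"
    using assms(1) unfolding ratfun_def by blast
  obtain c d :: "complex poly" where 2: "\<forall>z\<in>cball 0 1. poly d z \<noteq> 0 \<and> \<psi> z = poly c z / poly d z"
    using assms(2) unfolding ratfun_def by blast
  show ?thesis
    by (rule ratfunI[of "b * d" _ "a * c"]) (auto simp: 1 2)
qed

lemma ratfun_sum: "(\<And>i. i \<in> I \<Longrightarrow> ratfun (\<phi> i)) \<Longrightarrow> ratfun (\<lambda>z. \<Sum>i\<in>I. \<phi> i z)"
proof (induction I rule: infinite_finite_induct)
  case (insert i I)
  then show ?case by (simp add: ratfun_add)
qed (auto intro: ratfunI[of 1 _ 0])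

lemma ratfun_continuous: "ratfun \<phi> \<Longrightarrow> continuous_on (cball 0 1) \<phi>"
proof (erule ratfunE)
  fix a b :: "complex poly"
  assume *: "\<And>z. z \<in> cball 0 1 \<Longrightarrow> poly b z \<noteq> 0" "\<And>z. z \<in> cball 0 1 \<Longrightarrow> \<phi> z = poly a z / poly b z"
  have "continuous_on (cball 0 1) (\<lambda>z. poly a z / poly b z)"
    using *(1) by (intro continuous_intros) auto
  then show "continuous_on (cball 0 1) \<phi>" using *(2) by (subst continuous_on_cong[OF refl]) auto
qed

lemma ratfun_holomorphic: "ratfun \<phi> \<Longrightarrow> \<phi> holomorphic_on ball 0 1"
proof (erule ratfunE)
  fix a b :: "complex poly"
  assume *: "\<And>z. z \<in> cball 0 1 \<Longrightarrow> poly b z \<noteq> 0" "\<And>z. z \<in> cball 0 1 \<Longrightarrow> \<phi> z = poly a z / poly b z"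
  have p: "poly p holomorphic_on A" for p :: "complex poly" and A
    unfolding holomorphic_on_def field_differentiable_def
    using DERIV_subset[OF poly_DERIV subset_UNIV] by blast
  have "(\<lambda>z. poly a z / poly b z) holomorphic_on ball 0 1"
    using *(1) by (intro holomorphic_on_divide p) auto
  then show "\<phi> holomorphic_on ball 0 1" using *(2) by (subst holomorphic_cong[OF refl]) auto
qed

lemma ratfun_bounded: "ratfun \<phi> \<Longrightarrow> \<exists>C. \<forall>z\<in>cball 0 1. cmod (\<phi> z) \<le> C"
  using compact_imp_bounded[OF compact_continuous_image[OF ratfun_continuous compact_cball]]
  unfolding bounded_iff by (metis image_eqI)

lemma ratseq_ratfun:
  assumes "ratseq c" "\<And>z. cmod z \<le> 1 \<Longrightarrow> (\<lambda>n. c n * z ^ n) sums \<phi> z"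
  shows "ratfun \<phi>"
proof -
  obtain a b :: "complex poly" where "\<forall>z\<in>cball 0 1. poly b z \<noteq> 0 \<and> (\<lambda>n. c n * z ^ n) sums (poly a z / poly b z)"
    using assms(1) unfolding ratseq_def by blast
  then show ?thesis using assms(2) sums_unique2 by (intro ratfunI[of b _ a]) fastforce+
qed

lemma ratseq_Suc: "ratseq (\<lambda>n. c (Suc n)) \<Longrightarrow> ratseq c"
  by (rule ratseq_step[where \<mu>=0]) auto

text \<open>Absolute summability of the coefficients permits integration term by term, so Taylor
  coefficients in the disc are Fourier coefficients on the circle.\<close>

lemma power_series_circ:
  assumes c: "summable (\<lambda>n. cmod (c n))" and \<phi>: "\<And>z. cmod z \<le> 1 \<Longrightarrow> (\<lambda>n. c n * z ^ n) sums \<phi> z"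
  shows "(\<lambda>t. \<phi> (cis t)) \<in> borel_measurable circ" "cmod (\<phi> (cis t)) \<le> (\<Sum>n. cmod (c n))"
    "fcoefc (\<lambda>t. \<phi> (cis t)) k = (if k \<ge> 0 then c (nat k) else 0)"
proof -
  have eq: "\<phi> (cis t) = (\<Sum>n. c n * cis (of_int (int n) * t))" for t
    using sums_unique[OF \<phi>[of "cis t"]] by (simp add: Complex.DeMoivre)
  have "(\<lambda>t. \<Sum>n. c n * cis (of_int (int n) * t)) \<in> borel_measurable circ"
    by (intro borel_measurable_suminf borel_measurable_times borel_measurable_const cis_measurable)
  then show "(\<lambda>t. \<phi> (cis t)) \<in> borel_measurable circ" by (simp add: eq)
  have "cmod (\<Sum>n. c n * cis (of_int (int n) * t)) \<le> (\<Sum>n. cmod (c n * cis (of_int (int n) * t)))"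
    using c by (intro summable_norm) (simp add: norm_mult)
  then show "cmod (\<phi> (cis t)) \<le> (\<Sum>n. cmod (c n))" by (simp add: eq norm_mult)
  let ?f = "\<lambda>n t. cis (- (of_int k * t)) * (c n * cis (of_int (int n) * t))"
  have fi: "integrable circ (?f n)" for n
    by (intro fcoefc_integrable' L2fun_integrable L2fun_cmult L2fun_cis)
  have m: "measure circ {0..2*pi} = 2 * pi" using measure_circ by simp
  have "(LINT t|circ. (\<Sum>n. ?f n t)) = (\<Sum>n. (LINT t|circ. ?f n t))"
  proof (rule integral_suminf[OF fi])
    show "AE t in circ. summable (\<lambda>n. norm (?f n t))" using c by (simp add: norm_mult)
    show "summable (\<lambda>n. LINT t|circ. norm (?f n t))"
      using c m by (simp add: norm_mult summable_mult)
  qed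
  moreover have "(\<Sum>n. ?f n t) = cis (- (of_int k * t)) * \<phi> (cis t)" for t
    unfolding eq using c
    by (intro suminf_mult summable_norm_cancel[of "\<lambda>n. c n * cis (of_int (int n) * t)"]) (simp add: norm_mult)
  ultimately have 1: "fcoefc (\<lambda>t. \<phi> (cis t)) k = of_real (1 / (2*pi)) * (\<Sum>n. (LINT t|circ. ?f n t))"
    unfolding fcoefc_def by simp
  have 2: "(LINT t|circ. ?f n t) = of_real (2*pi) * (if int n = k then c n else 0)" for n
  proof -
    have "fcoefc (\<lambda>t. c n * cis (of_int (int n) * t)) k = (if int n = k then c n else 0)"
      unfolding fcoefc_cmult fcoefc_cis by auto
    then show ?thesis unfolding fcoefc_def by (simp add: field_simps)
  qed
  have 3: "(\<Sum>n. of_real (2*pi) * (if int n = k then c n else 0)) = complex_of_real (2*pi) * (if k \<ge> 0 then c (nat k) else 0)"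
  proof (cases "k \<ge> 0")
    case True
    then have "(\<lambda>n. of_real (2*pi) * (if int n = k then c n else 0))
        = (\<lambda>n. if n = nat k then complex_of_real (2*pi) * c n else 0)"
      by (intro ext) auto
    then show ?thesis using sums_unique[OF sums_single[of "nat k" "\<lambda>n. complex_of_real (2*pi) * c n"]] True by simp
  next
    case False
    then have "int n \<noteq> k" for n by auto
    then show ?thesis using False by simp
  qed
  show "fcoefc (\<lambda>t. \<phi> (cis t)) k = (if k \<ge> 0 then c (nat k) else 0)"
    unfolding 1 2 3 by simp
qed

lemma matrix_vector_apply:
  fixes f :: "complex^'n \<Rightarrow> complex^'m"
  assumes "\<And>x y. f (x + y) = f x + f y" "\<And>a x. f (a *s x) = a *s f x"
  shows "matrix f *v x = f x"
proof (rule matrix_works)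
  show "Vector_Spaces.linear (*s) (*s) f"
    by unfold_locales (auto simp: assms)
qed

lemma matrix_inv_eqI:
  fixes A B :: "complex^'n^'n"
  assumes "A ** B = mat 1" "B ** A = mat 1"
  shows "matrix_inv A = B"
proof -
  have "A ** matrix_inv A = mat 1 \<and> matrix_inv A ** A = mat 1"
    unfolding matrix_inv_def by (rule someI[of _ B]) (use assms in blast)
  then show ?thesis by (metis assms(1) matrix_mul_assoc matrix_mul_lid matrix_mul_rid)
qed

section \<open>State space formulas\<close>

context nehari_data
begin

definition stable :: "('q seq \<Rightarrow> 'q seq) \<Rightarrow> bool" where
  "stable A \<longleftrightarrow> seqs.lin_on X A \<and> (\<forall>\<mu>\<in>seqs.eigvals X A. cmod \<mu> < 1)"

lemma stable_Zs: "stable Zs" and stable_Top: "stable (Top G)"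
  using Zs_lin Zs_stable Top_lin Top_stable by (auto simp: stable_def)

context
  fixes A z
  assumes A: "stable A" and z: "cmod z \<le> 1"
begin

lemma resolv_eq: "resolv X A z = the_inv_into X (\<lambda>x. x - cscale z (A x))"
proof -
  have "(\<lambda>x n. x n - z *s A x n) = (\<lambda>x. x - cscale z (A x))" by (auto simp: cscale_def fun_eq_iff)
  then show ?thesis by (simp add: resolv_def)
qed

lemma resolv_bij: "bij_betw (\<lambda>x. x - cscale z (A x)) X X"
  using A z by (intro seqs.stable_resolvent_bij finite_dim_X) (auto simp: stable_def)

lemma resolv_X: "b \<in> X \<Longrightarrow> resolv X A z b \<in> X"
  and resolv_works: "b \<in> X \<Longrightarrow> resolv X A z b - cscale z (A (resolv X A z b)) = b"
  and resolv_eqI: "r \<in> X \<Longrightarrow> r - cscale z (A r) = b \<Longrightarrow> resolv X A z b = r"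
proof -
  have inj: "inj_on (\<lambda>x. x - cscale z (A x)) X" and im: "(\<lambda>x. x - cscale z (A x)) ` X = X"
    using resolv_bij by (auto simp: bij_betw_def)
  show "b \<in> X \<Longrightarrow> resolv X A z b \<in> X"
    unfolding resolv_eq using the_inv_into_into[OF inj, of b X] im by simp
  show "b \<in> X \<Longrightarrow> resolv X A z b - cscale z (A (resolv X A z b)) = b"
    unfolding resolv_eq using f_the_inv_into_f[OF inj, of b] im by simp
  show "r \<in> X \<Longrightarrow> r - cscale z (A r) = b \<Longrightarrow> resolv X A z b = r"
    unfolding resolv_eq by (rule the_inv_into_f_eq[OF inj])
qed

lemma resolv_lin: "seqs.lin_on X (resolv X A z)"
  unfolding resolv_eq using A
  by (intro seqs.lin_on_the_inv[OF _ subspace_X resolv_bij] seqs.lin_on_resolvent subspace_X) (simp add: stable_def)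

lemma resolv_sums:
  assumes "seqs.functional_on X L" "b \<in> X"
  shows "(\<lambda>n. L ((A ^^ n) b) * z ^ n) sums L (resolv X A z b)"
  using A z by (intro seqs.resolvent_sums[OF finite_dim_X _ _ assms(1)] resolv_X resolv_works assms(2)) (auto simp: stable_def)

end

lemma stable_imp_ratseq:
  assumes "stable A" "seqs.functional_on X L" "b \<in> X"
  shows "ratseq (\<lambda>n. L ((A ^^ n) b))"
  using assms by (intro seqs.stable_ratseq[OF finite_dim_X]) (auto simp: stable_def)

section \<open>Taylor coefficients of \<open>M\<close>, \<open>N\<close> and the inverse of
  \<open>M\<close>\<close>

lemma functional_Ws: "seqs.functional_on X (\<lambda>x. Ws x 0 $ i)"
  and functional_Ws_minus: "seqs.functional_on X (\<lambda>x. - (Ws x 0 $ i))"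
  and functional_HW: "seqs.functional_on X (\<lambda>x. - (H (Ws x) (- 1) $ j))"
  by (auto simp: seqs.functional_on_def Ws_add Ws_scale H_add H_scale Ws_H2 cscale_apply)

text \<open>Defined from the maximizing vector itself, so that the columns of \<open>M\<close> have
  the right Fourier coefficients at once; agreement with the state formula is
  \<open>mseq_Suc\<close>.\<close>

definition mseq :: "'p \<Rightarrow> 'p \<Rightarrow> nat \<Rightarrow> complex" where
  "mseq i j n = kvec (axis j 1) (int n) $ i"

definition nseq :: "'q \<Rightarrow> 'p \<Rightarrow> nat \<Rightarrow> complex" where
  "nseq i j n = - (H (Ws ((Zs ^^ n) (bvec (axis j 1)))) (- 1) $ i)"

definition iseq :: "'p \<Rightarrow> 'p \<Rightarrow> nat \<Rightarrow> complex" where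
  "iseq i j n = (case n of 0 \<Rightarrow> (if i = j then 1 else 0) | Suc m \<Rightarrow> - (Ws ((Top G ^^ m) (bvec (axis j 1))) 0 $ i))"

lemma Sst_funpow: "m \<ge> 0 \<Longrightarrow> (Sst ^^ n) c m = c (m + int n)"
  by (induction n arbitrary: m) (auto simp: Sst_def algebra_simps)

lemma Ws_Zs_funpow: "y \<in> X \<Longrightarrow> Ws ((Zs ^^ n) y) = (Sst ^^ n) (Ws y)"
  by (induction n) (auto simp: Ws_Zs seqs.lin_on_funpow[OF Zs_lin])

lemma Ws_Zs_funpow_bvec: "Ws ((Zs ^^ n) (bvec u)) = (Sst ^^ Suc n) (kvec u)"
  unfolding Ws_Zs_funpow[OF bvec_X] Ws_bvec by (simp add: funpow_swap1)

lemma Mmat_entry: "Mmat G z $ i $ j = (if i = j then 1 else 0) + z * (Ws (resolv X Zs z (bvec (axis j 1))) 0 $ i)"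
  by (simp add: Mmat_def matrix_def mat_def Estar_def bvec_def)

lemma Nmat_entry: "Nmat G z $ i $ j = - (H (Ws (resolv X Zs z (bvec (axis j 1)))) (- 1) $ i)"
  by (simp add: Nmat_def matrix_def PiOp_def bvec_def)

lemma Minv_entry: "Minv_formula G z $ i $ j = (if i = j then 1 else 0) - z * (Ws (resolv X (Top G) z (bvec (axis j 1))) 0 $ i)"
  by (simp add: Minv_formula_def matrix_def mat_def Estar_def bvec_def)

lemma sums_shift_power:
  assumes "(\<lambda>n. c (Suc n) * z ^ n) sums s"
  shows "(\<lambda>n. c n * z ^ n) sums (c 0 + z * (s::complex))"
proof -
  have "(\<lambda>n. z * (c (Suc n) * z ^ n)) sums (z * s)" by (intro sums_mult assms)
  then have "(\<lambda>n. c (Suc n) * z ^ Suc n) sums (z * s)" by (simp add: mult_ac)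
  from sums_Suc[of "\<lambda>n. c n * z ^ n", OF this] show ?thesis
    by (simp only: power_0 mult_1_right add.commute)
qed

lemma mseq_0: "mseq i j 0 = (if i = j then 1 else 0)"
  by (simp add: mseq_def kvec(2) axis_def)

text \<open>Each \<open>Zs\<close> becomes a backward shift under \<open>Ws\<close>, and
  \<open>Ws (bvec u)\<close> has already been shifted once; hence the index
  \<open>Suc n\<close>.\<close>

lemma mseq_Suc: "mseq i j (Suc n) = Ws ((Zs ^^ n) (bvec (axis j 1))) 0 $ i"
  unfolding mseq_def Ws_Zs_funpow_bvec by (subst Sst_funpow) auto

lemma mseq_ratseq: "ratseq (mseq i j)"
  by (rule ratseq_Suc) (unfold mseq_Suc, intro stable_imp_ratseq stable_Zs functional_Ws bvec_X)

lemma nseq_ratseq: "ratseq (nseq i j)"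
  unfolding nseq_def by (intro stable_imp_ratseq[OF stable_Zs functional_HW] bvec_X)

lemma iseq_ratseq: "ratseq (iseq i j)"
  by (rule ratseq_Suc) (unfold iseq_def nat.case, intro stable_imp_ratseq[OF stable_Top functional_Ws_minus] bvec_X)

lemma mseq_sums: "cmod z \<le> 1 \<Longrightarrow> (\<lambda>n. mseq i j n * z ^ n) sums (Mmat G z $ i $ j)"
  unfolding Mmat_entry mseq_0[symmetric]
  by (rule sums_shift_power) (unfold mseq_Suc, intro resolv_sums[OF stable_Zs _ functional_Ws] bvec_X)

lemma nseq_sums: "cmod z \<le> 1 \<Longrightarrow> (\<lambda>n. nseq i j n * z ^ n) sums (Nmat G z $ i $ j)"
  unfolding Nmat_entry nseq_def by (intro resolv_sums[OF stable_Zs _ functional_HW] bvec_X)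

lemma iseq_sums: "cmod z \<le> 1 \<Longrightarrow> (\<lambda>n. iseq i j n * z ^ n) sums (Minv_formula G z $ i $ j)"
proof -
  assume z: "cmod z \<le> 1"
  have "(\<lambda>n. iseq i j n * z ^ n) sums (iseq i j 0 + z * (- (Ws (resolv X (Top G) z (bvec (axis j 1))) 0 $ i)))"
    by (rule sums_shift_power)
       (unfold iseq_def nat.case, intro resolv_sums[OF stable_Top z functional_Ws_minus] bvec_X)
  then show ?thesis unfolding Minv_entry by (simp add: iseq_def)
qed

lemma Mmat_apply:
  assumes z: "cmod z \<le> 1"
  shows "Mmat G z *v u = u + z *s Ws (resolv X Zs z (bvec u)) 0"
    and "Minv_formula G z *v u = u - z *s Ws (resolv X (Top G) z (bvec u)) 0"
proof -
  have *: "matrix (\<lambda>u. z *s Estar (Ws (resolv X A z (Zs (Delta_inv G (H (Einj u))))))) *v u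
     = z *s Ws (resolv X A z (bvec u)) 0" if A: "stable A" for A
    unfolding bvec_def[symmetric] Estar_def
    by (rule matrix_vector_apply)
       (simp_all add: bvec_add bvec_scale seqs.lin_onD(2,3)[OF resolv_lin[OF A z]] bvec_X Ws_add Ws_scale
         resolv_X[OF A z] cscale_apply vector_add_ldistrib vec.scale_left_commute[of z])
  show "Mmat G z *v u = u + z *s Ws (resolv X Zs z (bvec u)) 0"
    unfolding Mmat_def matrix_vector_mult_add_rdistrib *[OF stable_Zs] by simp
  show "Minv_formula G z *v u = u - z *s Ws (resolv X (Top G) z (bvec u)) 0"
    unfolding Minv_formula_def matrix_vector_mult_diff_rdistrib *[OF stable_Top] by simp
qed

text \<open>Splitting off the constant term of \<open>Ws w\<close> gives
  \<open>H (Einj (Ws w 0)) = Delta G w - Xi G w\<close>. The resulting identity says that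
  \<open>Zs\<close> and \<open>Top G\<close> differ by output followed by input, the relation
  between a system and its inverse.\<close>

lemma bvec_Ws_eval:
  assumes w: "w \<in> X"
  shows "bvec (Ws w 0) = Zs w - Top G w"
proof -
  have H2: "Ws w \<in> H2seq" "Sst (Ws w) \<in> H2seq" using w by (auto intro: Ws_H2 Sst_H2 Ws_l2)
  have "H (Ws w) = H (Einj (Ws w 0) + shiftS (Sst (Ws w)))" using H2_decomp[OF H2(1)] by simp
  also have "\<dots> = H (Einj (Ws w 0)) + Vminus (H (Ws (Zs w)))"
    using H_add[OF Einj_H2 shiftS_H2[OF H2(2)]] H_shift[OF H2(2)] Ws_Zs[OF w] by simp
  finally have "H (Einj (Ws w 0)) = H (Ws w) - Vminus (H (Ws (Zs w)))" by (metis add_diff_cancel_right')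
  also have "\<dots> = Delta G w - Xi G w" unfolding Delta_eq Xi_eq by (simp add: algebra_simps del: plus_fun_apply minus_apply)
  finally have eq: "H (Einj (Ws w 0)) = Delta G w - Xi G w" .
  have X: "Delta G w \<in> X" "Xi G w \<in> X" using w seqs.lin_onD(1)[OF Delta_lin] seqs.lin_onD(1)[OF Xi_lin] by auto
  have "Delta_inv G (H (Einj (Ws w 0))) = w - Delta_inv G (Xi G w)"
    unfolding eq seqs.lin_on_diff[OF Delta_inv_lin subspace_X X] Delta_inv_eqI[OF w refl] ..
  then show ?thesis
    unfolding bvec_def Top_eq using seqs.lin_on_diff[OF Zs_lin subspace_X w Delta_inv_X[OF X(2)]] by simp
qed

text \<open>The state of the inverse system driven by \<open>u\<close> is also the state of the
  original system driven by the output \<open>v\<close>; so \<open>M\<close> recovers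
  \<open>u\<close> from \<open>v\<close>.\<close>

lemma M_Minv: "cmod z \<le> 1 \<Longrightarrow> Mmat G z ** Minv_formula G z = mat 1"
proof -
  assume z: "cmod z \<le> 1"
  have "Mmat G z *v (Minv_formula G z *v u) = u" for u
  proof -
    define w where "w = resolv X (Top G) z (bvec u)"
    have w: "w \<in> X" unfolding w_def by (rule resolv_X[OF stable_Top z bvec_X])
    have wr: "w - cscale z (Top G w) = bvec u" unfolding w_def by (rule resolv_works[OF stable_Top z bvec_X])
    define v where "v = u - z *s Ws w 0"
    have "u = v + z *s Ws w 0" by (simp add: v_def)
    then have "bvec u = bvec v + cscale z (Zs w - Top G w)" using bvec_add bvec_scale bvec_Ws_eval[OF w] by metis
    then have bv: "w - cscale z (Zs w) = bvec v"
      unfolding wr[symmetric] seqs.scale_right_diff_distrib by (simp add: algebra_simps del: plus_fun_apply minus_apply)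
    have "resolv X Zs z (bvec v) = w" by (rule resolv_eqI[OF stable_Zs z w bv])
    then have "Mmat G z *v v = u" unfolding Mmat_apply(1)[OF z] by (simp add: v_def)
    moreover have "Minv_formula G z *v u = v" unfolding Mmat_apply(2)[OF z] v_def w_def ..
    ultimately show ?thesis by simp
  qed
  then show ?thesis by (simp add: matrix_eq matrix_vector_mul_assoc[symmetric])
qed

lemma Minv_M: "cmod z \<le> 1 \<Longrightarrow> Minv_formula G z ** Mmat G z = mat 1"
  using M_Minv matrix_left_right_inverse by blast

lemma Mmat_inv:
  assumes z: "cmod z \<le> 1"
  shows "invertible (Mmat G z)" "matrix_inv (Mmat G z) = Minv_formula G z"
proof -
  show "invertible (Mmat G z)" using M_Minv[OF z] Minv_M[OF z] by (auto simp: invertible_def)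
  show "matrix_inv (Mmat G z) = Minv_formula G z"
    by (rule matrix_inv_eqI[OF M_Minv[OF z] Minv_M[OF z]])
qed

lemma Phi_plus_eq: "cmod z \<le> 1 \<Longrightarrow> Phi_plus G z = Nmat G z ** Minv_formula G z"
  by (simp add: Phi_plus_def Mmat_inv)

lemma Phi_plus_ratfun: "ratfun (\<lambda>z. Phi_plus G z $ i $ j)"
proof -
  have "ratfun (\<lambda>z. \<Sum>k\<in>UNIV. Nmat G z $ i $ k * Minv_formula G z $ k $ j)"
    by (intro ratfun_sum ratfun_mult ratseq_ratfun[OF nseq_ratseq nseq_sums] ratseq_ratfun[OF iseq_ratseq iseq_sums])
  moreover have "Phi_plus G z $ i $ j = (\<Sum>k\<in>UNIV. Nmat G z $ i $ k * Minv_formula G z $ k $ j)"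
    if "z \<in> cball 0 1" for z
    using that by (simp add: Phi_plus_eq matrix_matrix_mult_def)
  ultimately show ?thesis unfolding ratfun_def by simp
qed

end

section \<open>The optimal solution\<close>

text \<open>The Fourier coefficients of a pointwise inner product are correlations of the
  coefficient sequences. The two signs of the index are treated apart so that only forward shifts
  occur.\<close>

lemma fcoefc_hdot:
  fixes f g :: "real \<Rightarrow> complex^'n"
  assumes f: "f \<in> L2fun" and g: "g \<in> L2fun"
  shows "fcoefc (\<lambda>t. hdot (f t) (g t)) (int n) = cnj (iprod ((shiftS ^^ n) (fcoefv g)) (fcoefv f))"
    and "fcoefc (\<lambda>t. hdot (f t) (g t)) (- int n) = iprod ((shiftS ^^ n) (fcoefv f)) (fcoefv g)"
proof -
  have 1: "fcoefc (\<lambda>t. hdot (f t) (g t)) (int n) = cnj (iprod ((shiftS ^^ n) (fcoefv g)) (fcoefv f))"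
    if f: "f \<in> L2fun" and g: "g \<in> L2fun" for f g :: "real \<Rightarrow> complex^'n"
  proof -
    let ?g = "\<lambda>t. cis (of_int (int n) * t) *s g t"
    have gl: "?g \<in> L2fun" using g by (auto simp: L2fun_vec_iff intro: L2fun_cis_mult)
    have "fcoefv ?g = (shiftS ^^ n) (fcoefv g)"
      using fcoefc_cis_mult[of "int n"] by (auto simp: fun_eq_iff vec_eq_iff fcoefv_comp shiftS_funpow)
    moreover have "hdot (f t) (?g t) = cis (- (of_int (int n) * t)) * hdot (f t) (g t)" for t
      by (simp add: hdot_def cis_cnj sum_distrib_left mult_ac)
    ultimately have "iprod (fcoefv f) ((shiftS ^^ n) (fcoefv g)) = fcoefc (\<lambda>t. hdot (f t) (g t)) (int n)"
      using parseval_vec[OF f gl] by (simp add: fcoefc_def)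
    then show ?thesis by (simp add: iprod_cnj)
  qed
  show "fcoefc (\<lambda>t. hdot (f t) (g t)) (int n) = cnj (iprod ((shiftS ^^ n) (fcoefv g)) (fcoefv f))"
    by (rule 1[OF f g])
  have "fcoefc (\<lambda>t. hdot (f t) (g t)) (- int n) = cnj (fcoefc (\<lambda>t. hdot (g t) (f t)) (int n))"
    using fcoefc_cnj[of "\<lambda>t. hdot (g t) (f t)" "- int n"] by (simp add: hdot_cnj)
  then show "fcoefc (\<lambda>t. hdot (f t) (g t)) (- int n) = iprod ((shiftS ^^ n) (fcoefv f)) (fcoefv g)"
    unfolding 1[OF g f] by simp
qed

lemma hdot_integrable:
  fixes f g :: "real \<Rightarrow> complex^'n"
  assumes f: "f \<in> L2fun" and g: "g \<in> L2fun"
  shows "integrable circ (\<lambda>t. hdot (f t) (g t))"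
  unfolding hdot_def by (intro Bochner_Integration.integrable_sum L2fun_mult_integrable L2fun_cnj L2fun_comp f g)

lemma hdot_matrix_vector:
  fixes A :: "complex^'n^'m"
  shows "hdot (A *v w) (A *v w) = (\<Sum>i\<in>UNIV. \<Sum>j\<in>UNIV. w $ i * cnj (w $ j) * hdot (column i A) (column j A))"
proof -
  have "hdot (A *v w) (A *v w) = (\<Sum>k\<in>UNIV. \<Sum>i\<in>UNIV. \<Sum>j\<in>UNIV. w $ i * cnj (w $ j) * (A $ k $ i * cnj (A $ k $ j)))"
    unfolding hdot_def matrix_vector_mult_def vec_lambda_beta cnj_sum sum_product
    by (intro sum.cong refl) (simp add: mult_ac)
  also have "\<dots> = (\<Sum>i\<in>UNIV. \<Sum>k\<in>UNIV. \<Sum>j\<in>UNIV. w $ i * cnj (w $ j) * (A $ k $ i * cnj (A $ k $ j)))"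
    by (rule sum.swap)
  also have "\<dots> = (\<Sum>i\<in>UNIV. \<Sum>j\<in>UNIV. \<Sum>k\<in>UNIV. w $ i * cnj (w $ j) * (A $ k $ i * cnj (A $ k $ j)))"
    by (intro sum.cong refl sum.swap)
  finally show ?thesis by (simp add: hdot_def column_def sum_distrib_left)
qed

lemma column_matrix_vector: "column j (A ** B) = A *v column j (B::complex^'n^'m)"
  by (simp add: column_def matrix_matrix_mult_def matrix_vector_mult_def vec_eq_iff)

lemma matrix_vector_axis: "(A::complex^'n^'m) *v axis j 1 = column j A"
  by (simp add: matrix_vector_mult_def column_def axis_def vec_eq_iff if_distrib cong: if_cong)

text \<open>In the convolution for a negative index one of the two indices is always
  negative.\<close>

lemma fcoefc_mult_causal:
  assumes f: "f \<in> L2fun" and g: "g \<in> L2fun" and neg: "\<And>k. k < 0 \<Longrightarrow> fcoefc f k = 0" "\<And>k. k < 0 \<Longrightarrow> fcoefc g k = 0"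
    and n: "n < 0"
  shows "fcoefc (\<lambda>t. f t * g t) n = 0"
proof -
  have "fcoefc f (n - k) * fcoefc g k = 0" for k
    using neg(1)[of "n - k"] neg(2)[of k] n by (cases "k < 0") auto
  then have "((\<lambda>k::int. 0) has_sum fcoefc (\<lambda>t. f t * g t) n) UNIV"
    using fcoefc_mult[OF f g, of n] by (simp only:)
  then show ?thesis by (metis infsumI infsum_0_simp)
qed

lemma L2fun_matrix_mult_bounded:
  fixes A :: "real \<Rightarrow> complex^'n^'m" and B :: "real \<Rightarrow> complex^'p^'n"
  assumes "\<And>i j. (\<lambda>t. A t $ i $ j) \<in> L2fun" "\<And>i j. (\<lambda>t. B t $ i $ j) \<in> borel_measurable circ"
    "\<And>i j. AE t in circ. cmod (B t $ i $ j) \<le> C i j"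
  shows "(\<lambda>t. (A t ** B t) $ i $ j) \<in> L2fun"
proof -
  have "(\<lambda>t. \<Sum>k\<in>UNIV. B t $ k $ j * A t $ i $ k) \<in> L2fun"
    by (intro L2fun_sum L2fun_mult_bounded[OF assms])
  then show ?thesis by (simp add: matrix_matrix_mult_def mult.commute)
qed

lemma fcoefm_mult_causal:
  fixes A :: "real \<Rightarrow> complex^'n^'m" and B :: "real \<Rightarrow> complex^'p^'n"
  assumes A: "\<And>i j. (\<lambda>t. A t $ i $ j) \<in> L2fun" and B: "\<And>i j. (\<lambda>t. B t $ i $ j) \<in> L2fun"
    and neg: "\<And>i j k. k < 0 \<Longrightarrow> fcoefc (\<lambda>t. A t $ i $ j) k = 0" "\<And>i j k. k < 0 \<Longrightarrow> fcoefc (\<lambda>t. B t $ i $ j) k = 0"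
    and n: "n < 0"
  shows "fcoefm (\<lambda>t. A t ** B t) n = 0"
proof -
  have "fcoefc (\<lambda>t. (A t ** B t) $ i $ j) n = 0" for i j
  proof -
    have "fcoefc (\<lambda>t. (A t ** B t) $ i $ j) n = (\<Sum>k\<in>UNIV. fcoefc (\<lambda>t. A t $ i $ k * B t $ k $ j) n)"
      unfolding matrix_matrix_mult_def vec_lambda_beta
      by (rule fcoefc_sum) (intro L2fun_mult_integrable A B)
    also have "\<dots> = 0" by (intro sum.neutral ballI fcoefc_mult_causal A B neg n)
    finally show ?thesis .
  qed
  then show ?thesis by (simp add: fcoefm_def vec_eq_iff)
qed

lemma L2fun_column: "(\<And>i j. (\<lambda>t. A t $ i $ j) \<in> L2fun) \<Longrightarrow> (\<lambda>t. column j (A t)) \<in> L2fun"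
  for A :: "real \<Rightarrow> complex^'n^'m"
  by (simp add: L2fun_vec_iff column_def)

context nehari_data
begin

section \<open>Boundary values on the unit circle\<close>

abbreviation Mt where "Mt t \<equiv> Mmat G (cis t)"
abbreviation Nt where "Nt t \<equiv> Nmat G (cis t)"
abbreviation It where "It t \<equiv> Minv_formula G (cis t)"

lemma Mt_circ:
  "(\<lambda>t. Mt t $ i $ j) \<in> borel_measurable circ" "AE t in circ. cmod (Mt t $ i $ j) \<le> (\<Sum>n. cmod (mseq i j n))"
  "fcoefc (\<lambda>t. Mt t $ i $ j) k = (if k \<ge> 0 then mseq i j (nat k) else 0)"
proof -
  have "summable (\<lambda>n. cmod (mseq i j n))" using mseq_ratseq by (simp add: ratseq_def)
  note P = power_series_circ[OF this mseq_sums]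
  show "(\<lambda>t. Mt t $ i $ j) \<in> borel_measurable circ" by (rule P(1))
  show "AE t in circ. cmod (Mt t $ i $ j) \<le> (\<Sum>n. cmod (mseq i j n))" using P(2) by simp
  show "fcoefc (\<lambda>t. Mt t $ i $ j) k = (if k \<ge> 0 then mseq i j (nat k) else 0)" by (rule P(3))
qed

lemma Nt_circ:
  "(\<lambda>t. Nt t $ i $ j) \<in> borel_measurable circ" "AE t in circ. cmod (Nt t $ i $ j) \<le> (\<Sum>n. cmod (nseq i j n))"
  "fcoefc (\<lambda>t. Nt t $ i $ j) k = (if k \<ge> 0 then nseq i j (nat k) else 0)"
proof -
  have "summable (\<lambda>n. cmod (nseq i j n))" using nseq_ratseq by (simp add: ratseq_def)
  note P = power_series_circ[OF this nseq_sums]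
  show "(\<lambda>t. Nt t $ i $ j) \<in> borel_measurable circ" by (rule P(1))
  show "AE t in circ. cmod (Nt t $ i $ j) \<le> (\<Sum>n. cmod (nseq i j n))" using P(2) by simp
  show "fcoefc (\<lambda>t. Nt t $ i $ j) k = (if k \<ge> 0 then nseq i j (nat k) else 0)" by (rule P(3))
qed

lemma It_circ:
  "(\<lambda>t. It t $ i $ j) \<in> borel_measurable circ" "AE t in circ. cmod (It t $ i $ j) \<le> (\<Sum>n. cmod (iseq i j n))"
  "fcoefc (\<lambda>t. It t $ i $ j) k = (if k \<ge> 0 then iseq i j (nat k) else 0)"
proof -
  have "summable (\<lambda>n. cmod (iseq i j n))" using iseq_ratseq by (simp add: ratseq_def)
  note P = power_series_circ[OF this iseq_sums]
  show "(\<lambda>t. It t $ i $ j) \<in> borel_measurable circ" by (rule P(1))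
  show "AE t in circ. cmod (It t $ i $ j) \<le> (\<Sum>n. cmod (iseq i j n))" using P(2) by simp
  show "fcoefc (\<lambda>t. It t $ i $ j) k = (if k \<ge> 0 then iseq i j (nat k) else 0)" by (rule P(3))
qed

lemma Mt_L2: "(\<lambda>t. Mt t $ i $ j) \<in> L2fun"
  and Nt_L2: "(\<lambda>t. Nt t $ i' $ j) \<in> L2fun"
  and It_L2: "(\<lambda>t. It t $ i $ j) \<in> L2fun"
  by (rule L2fun_bounded[OF Mt_circ(1,2)] L2fun_bounded[OF Nt_circ(1,2)] L2fun_bounded[OF It_circ(1,2)])+

lemma Mt_column: "(\<lambda>t. column j (Mt t)) \<in> L2fun" "fcoefv (\<lambda>t. column j (Mt t)) = kvec (axis j 1)"
proof -
  show "(\<lambda>t. column j (Mt t)) \<in> L2fun" by (intro L2fun_column Mt_L2)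
  show "fcoefv (\<lambda>t. column j (Mt t)) = kvec (axis j 1)"
  proof
    fix n show "fcoefv (\<lambda>t. column j (Mt t)) n = kvec (axis j 1) n"
      using kvec_H2[of "axis j 1"]
      by (auto simp: vec_eq_iff fcoefv_comp column_def Mt_circ(3) mseq_def H2seq_def)
  qed
qed

text \<open>A function on the circle representing the sequence
  \<open>H (kvec (axis j 1))\<close>.\<close>

definition Bcol :: "'p \<Rightarrow> real \<Rightarrow> complex^'q" where
  "Bcol j = (SOME f. f \<in> L2fun \<and> fcoefv f = H (kvec (axis j 1)))"

definition Bt :: "real \<Rightarrow> complex^'p^'q" where
  "Bt t = (\<chi> i j. Bcol j t $ i)"

lemma Bt_column: "column j (Bt t) = Bcol j t"
  by (simp add: Bt_def column_def vec_eq_iff)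

lemma Bcol: "Bcol j \<in> L2fun" "fcoefv (Bcol j) = H (kvec (axis j 1))"
proof -
  obtain f where "f \<in> L2fun" "fcoefv f = H (kvec (axis j 1))"
    using fcoefv_surj[OF X_in_l2[OF H_X[OF kvec_H2]]] by blast
  then show "Bcol j \<in> L2fun" "fcoefv (Bcol j) = H (kvec (axis j 1))"
    using someI[of "\<lambda>f. f \<in> L2fun \<and> fcoefv f = H (kvec (axis j 1))" f] by (auto simp: Bcol_def)
qed

lemma Bt_L2: "(\<lambda>t. Bt t $ i $ j) \<in> L2fun"
  using Bcol(1)[of j] by (simp add: Bt_def L2fun_comp)

text \<open>Maximizing vectors satisfy \<open>H\<^sup>*H k = \<gamma>\<^sup>2 k\<close>, so the functions \<open>\<langle>H k, H l\<rangle>\<close> and \<open>\<gamma>\<^sup>2 \<langle>k, l\<rangle>\<close> on the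
  circle have the same Fourier coefficients.\<close>

lemma Bt_isometric: "AE t in circ. \<forall>w. norm (Bt t *v w) = gam G * norm (Mt t *v w)"
proof -
  have "AE t in circ. hdot (Bcol i t) (Bcol j t) = g2 * hdot (column i (Mt t)) (column j (Mt t))" for i j
  proof (rule fcoefc_eq_imp_AE_eq)
    show "integrable circ (\<lambda>t. hdot (Bcol i t) (Bcol j t))" by (intro hdot_integrable Bcol)
    show "integrable circ (\<lambda>t. g2 * hdot (column i (Mt t)) (column j (Mt t)))"
      by (intro integrable_mult_right hdot_integrable Mt_column)
    fix n :: int
    show "fcoefc (\<lambda>t. hdot (Bcol i t) (Bcol j t)) n = fcoefc (\<lambda>t. g2 * hdot (column i (Mt t)) (column j (Mt t))) n"
    proof (cases n rule: int_cases2)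
      case (nonneg m)
      then show ?thesis
        unfolding fcoefc_cmult nonneg fcoefc_hdot(1)[OF Bcol(1) Bcol(1)] fcoefc_hdot(1)[OF Mt_column(1) Mt_column(1)]
          Bcol(2) Mt_column(2) autocorrelation_K[OF kvec_H2 kvec(1)] by simp
    next
      case (nonpos m)
      then show ?thesis
        unfolding fcoefc_cmult nonpos fcoefc_hdot(2)[OF Bcol(1) Bcol(1)] fcoefc_hdot(2)[OF Mt_column(1) Mt_column(1)]
          Bcol(2) Mt_column(2) autocorrelation_K[OF kvec_H2 kvec(1)] by simp
    qed
  qed
  then have "AE t in circ. \<forall>i\<in>UNIV. \<forall>j\<in>UNIV. hdot (Bcol i t) (Bcol j t) = g2 * hdot (column i (Mt t)) (column j (Mt t))"
    by (intro AE_finite_allI) auto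
  then show ?thesis
  proof eventually_elim
    case (elim t)
    show ?case
    proof
      fix w
      have "complex_of_real ((norm (Bt t *v w))^2) = g2 * hdot (Mt t *v w) (Mt t *v w)"
        unfolding hdot_self[symmetric] hdot_matrix_vector Bt_column
        using elim by (simp add: sum_distrib_left mult_ac)
      also have "\<dots> = complex_of_real ((gam G * norm (Mt t *v w))^2)"
        by (simp add: hdot_self power_mult_distrib)
      finally have "(norm (Bt t *v w))^2 = (gam G * norm (Mt t *v w))^2" by (rule of_real_eq_iff[THEN iffD1])
      then show "norm (Bt t *v w) = gam G * norm (Mt t *v w)"
        using gam_pos power2_eq_imp_eq[of "norm (Bt t *v w)" "gam G * norm (Mt t *v w)"] by simp
    qed
  qed
qed

definition Phi where "Phi t = Bt t ** It t"

lemma Mt_It: "Mt t ** It t = mat 1"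
  by (rule M_Minv) simp

lemma Phi_mnorm: "AE t in circ. mnorm (Phi t) \<le> gam G"
  using Bt_isometric
proof eventually_elim
  case (elim t)
  show ?case
  proof (rule mnorm_le)
    fix x :: "complex^'p" assume x: "norm x \<le> 1"
    have "norm (Phi t *v x) = gam G * norm (Mt t *v (It t *v x))"
      using elim by (simp add: Phi_def matrix_vector_mul_assoc[symmetric])
    also have "\<dots> = gam G * norm x" by (simp add: matrix_vector_mul_assoc Mt_It)
    finally show "norm (Phi t *v x) \<le> gam G" using mult_left_le[OF x gam_nonneg[OF Linf]] by simp
  qed
qed

lemma Phi_L2: "(\<lambda>t. Phi t $ i $ j) \<in> L2fun"
  unfolding Phi_def by (rule L2fun_matrix_mult_bounded[OF Bt_L2 It_circ(1,2)])

lemma Phi_Linf: "Phi \<in> Linf_fun"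
  using Phi_mnorm Phi_L2 L2fun_measurable by (auto simp: Linf_fun_def measurable_entry)

lemma G_minus_Phi_Hinf: "(\<lambda>t. G t - Phi t) \<in> Hinf_fun"
proof -
  \<comment> \<open>\<open>P\<close> is the analytic part of \<open>G M\<close>, because
    \<open>B\<close> collects exactly its negative coefficients. Then \<open>G - Phi\<close> is the
    product of \<open>P\<close> and the inverse of \<open>M\<close>, two factors with no negative
    coefficients.\<close>
  define P where "P t = G t ** Mt t - Bt t" for t
  have eq: "G t - Phi t = P t ** It t" for t
  proof -
    have "(G t - Phi t) *v x = (P t ** It t) *v x" for x
      by (simp add: P_def Phi_def matrix_vector_mul_assoc[symmetric] matrix_vector_mult_diff_rdistrib)
         (simp add: matrix_vector_mul_assoc Mt_It flip: matrix_mul_assoc)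
    then show ?thesis by (simp add: matrix_eq)
  qed
  have Pc: "P t $ i $ j = (G t *v column j (Mt t) - Bcol j t) $ i" for t i j
    by (simp add: P_def Bt_def matrix_matrix_mult_def matrix_vector_mult_def column_def)
  have GM: "(\<lambda>t. G t *v column j (Mt t)) \<in> L2fun" for j by (intro Linf_mult_L2 Linf Mt_column)
  have PL2: "(\<lambda>t. P t $ i $ j) \<in> L2fun" for i j
    unfolding Pc by (intro L2fun_comp L2fun_diff GM Bcol)
  have Pn: "fcoefc (\<lambda>t. P t $ i $ j) k = 0" if "k < 0" for i j k
  proof -
    have "fcoefv (\<lambda>t. G t *v column j (Mt t)) k = H (kvec (axis j 1)) k"
      using hankel_fcoefv[OF Linf Mt_column(1)[of j]] that unfolding Mt_column(2) by simp
    then have "fcoefv (\<lambda>t. G t *v column j (Mt t) - Bcol j t) k = 0"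
      unfolding fcoefv_diff[OF GM Bcol(1)] Bcol(2) by simp
    then show ?thesis unfolding Pc fcoefv_comp[symmetric] by simp
  qed
  have "fcoefm (\<lambda>t. P t ** It t) n = 0" if "n < 0" for n
    by (rule fcoefm_mult_causal[OF PL2 It_L2 Pn _ that]) (simp_all add: It_circ(3))
  then show ?thesis
    using Linf_diff[OF Linf Phi_Linf] unfolding Hinf_fun_def eq by simp
qed

lemma optimal_G_minus_Phi: "nehari_optimal G (\<lambda>t. G t - Phi t)"
proof -
  have "linf_norm (\<lambda>t. G t - (G t - Phi t)) \<le> gam G" using Phi_mnorm by (intro linf_norm_le) simp
  then show ?thesis
    using gam_le_linf_norm[OF Linf] G_minus_Phi_Hinf by (auto simp: nehari_optimal_def intro: order_trans)
qed

lemma optimal_unique: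
  assumes opt: "nehari_optimal G F"
  shows "AE t in circ. G t - F t = Phi t"
proof -
  have F: "F \<in> Hinf_fun" using opt by (simp add: nehari_optimal_def)
  then have Fi: "F \<in> Linf_fun" by (simp add: Hinf_fun_def)
  have D: "(\<lambda>t. G t - F t) \<in> Linf_fun" by (rule Linf_diff[OF Linf Fi])
  have "\<forall>F'\<in>Hinf_fun. linf_norm (\<lambda>t. G t - F t) \<le> linf_norm (\<lambda>t. G t - F' t)"
    using opt by (simp add: nehari_optimal_def)
  from bspec[OF this G_minus_Phi_Hinf]
  have "linf_norm (\<lambda>t. G t - F t) \<le> linf_norm (\<lambda>t. G t - (G t - Phi t))" .
  also have "\<dots> \<le> gam G" using Phi_mnorm by (intro linf_norm_le) simp
  finally have le: "linf_norm (\<lambda>t. G t - F t) \<le> gam G" .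
  have "AE t in circ. (G t - F t) *v column j (Mt t) = Bcol j t" for j
  proof -
    let ?m = "\<lambda>t. column j (Mt t)" and ?k = "kvec (axis j 1)"
    let ?f = "\<lambda>t. (G t - F t) *v ?m t"
    have f: "?f \<in> L2fun" by (rule Linf_mult_L2[OF D Mt_column(1)])
    define a where "a = fcoefv ?f"
    have al: "a \<in> l2" unfolding a_def by (rule fcoefv_l2[OF f])
    have neg: "a n = H ?k n" if "n < 0" for n
      unfolding a_def using hankel_minus_Hinf[OF Linf F Mt_column(1) _ that] kvec_H2 by (simp add: Mt_column(2))
    \<comment> \<open>The analytic part of \<open>(G - F) k\<close>. The co-analytic part is
      \<open>H k\<close> for every analytic \<open>F\<close>, and it already has the largest norm
      that optimality allows, so Pythagoras leaves no room for \<open>b\<close>.\<close>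
    define b where "b = (\<lambda>n. if n \<ge> 0 then a n else 0)"
    have bl: "b \<in> l2" unfolding b_def by (rule l2_restrict[OF al])
    have Hl: "H ?k \<in> l2" by (rule X_in_l2[OF H_X[OF kvec_H2]])
    have H0: "H ?k n = 0" if "n \<ge> 0" for n using X_K2[OF H_X[OF kvec_H2]] that by (simp add: K2seq_def)
    have ab: "a = H ?k + b" using neg H0 by (auto simp: b_def fun_eq_iff)
    have "(lnorm a)^2 = (lnorm (H ?k))^2 + (lnorm b)^2"
      unfolding ab using H0 by (intro lnorm_orthogonal_sum Hl bl) (auto simp: b_def)
    moreover have "(lnorm a)^2 \<le> (lnorm (H ?k))^2"
    proof (rule power_mono)
      have "lnorm a \<le> linf_norm (\<lambda>t. G t - F t) * lnorm ?k"
        using lnorm_le_linf_norm[OF D Mt_column(1)[of j]] by (simp add: a_def Mt_column(2))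
      also have "\<dots> \<le> gam G * lnorm ?k" by (intro mult_right_mono le) simp
      finally show "lnorm a \<le> lnorm (H ?k)" by (simp add: K_lnorm[OF kvec(1)])
    qed simp
    ultimately have "lnorm b = 0" by simp
    then have "b = 0" using lnorm_eq_zero_iff[OF bl] by simp
    then have "fcoefv ?f = fcoefv (Bcol j)" using ab by (simp add: a_def Bcol(2))
    then show ?thesis by (rule fcoefv_inj_AE[OF f Bcol(1)])
  qed
  then have "AE t in circ. \<forall>j\<in>UNIV. (G t - F t) *v column j (Mt t) = Bcol j t"
    by (intro AE_finite_allI) auto
  then show ?thesis
  proof eventually_elim
    case (elim t)
    have "column j ((G t - F t) ** Mt t) = column j (Bt t)" for j
      using elim by (simp add: column_matrix_vector Bt_column)
    then have "(G t - F t) ** Mt t = Bt t"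
      by (simp add: column_def vec_eq_iff)
    then have "Phi t = (G t - F t) ** (Mt t ** It t)" by (simp add: Phi_def matrix_mul_assoc)
    then show ?case by (simp add: Mt_It)
  qed
qed

section \<open>The analytic part of the symbol\<close>

lemma Phi_plus_circ: "Phi_plus G (cis t) = Nt t ** It t"
  by (rule Phi_plus_eq) simp

lemma Phi_plus_L2: "(\<lambda>t. Phi_plus G (cis t) $ i $ j) \<in> L2fun"
  unfolding Phi_plus_circ by (rule L2fun_matrix_mult_bounded[OF Nt_L2 It_circ(1,2)])

lemma Phi_plus_fcoefm_neg: "n < 0 \<Longrightarrow> fcoefm (\<lambda>t. Phi_plus G (cis t)) n = 0"
  unfolding Phi_plus_circ
  by (rule fcoefm_mult_causal[OF Nt_L2 It_L2]) (simp_all add: Nt_circ(3) It_circ(3))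

text \<open>Put \<open>Q = G - F - Phi_plus\<close>. Its negative coefficients are those of
  \<open>G\<close>, and \<open>Q M = B - N\<close>. It remains to see that \<open>Q\<close> has no
  coefficients of index at least 0.\<close>

lemma analytic_part:
  assumes opt: "nehari_optimal G F"
  shows "is_analytic_part G (\<lambda>t. F t + Phi_plus G (cis t))"
proof -
  have F: "F \<in> Hinf_fun" using opt by (simp add: nehari_optimal_def)
  then have Fi: "F \<in> Linf_fun" and Fn: "\<And>n. n < 0 \<Longrightarrow> fcoefm F n = 0" by (auto simp: Hinf_fun_def)
  define g where "g t = F t + Phi_plus G (cis t)" for t
  have gL2: "(\<lambda>t. g t $ i $ j) \<in> L2fun" for i j
    unfolding g_def vector_add_component by (intro L2fun_add Linf_entry_L2[OF Fi] Phi_plus_L2)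
  have gn: "fcoefm g n = 0" if "n < 0" for n
  proof -
    have "fcoefm g n = fcoefm F n + fcoefm (\<lambda>t. Phi_plus G (cis t)) n"
      unfolding fcoefm_def g_def vec_eq_iff
      by (simp add: fcoefc_add L2fun_integrable[OF Linf_entry_L2[OF Fi]] L2fun_integrable[OF Phi_plus_L2])
    then show ?thesis using Fn[OF that] Phi_plus_fcoefm_neg[OF that] by simp
  qed
  define Q where "Q t = G t - g t" for t
  have QL2: "(\<lambda>t. Q t $ i $ j) \<in> L2fun" for i j
    unfolding Q_def vector_minus_component by (intro L2fun_diff Linf_entry_L2[OF Linf] gL2)
  have Qc: "fcoefm Q n = fcoefm G n - fcoefm g n" for n
    unfolding fcoefm_def Q_def vec_eq_iff
    by (simp add: fcoefc_diff L2fun_integrable[OF Linf_entry_L2[OF Linf]] L2fun_integrable[OF gL2])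
  have QM: "AE t in circ. Q t *v column j (Mt t) = Bcol j t - column j (Nt t)" for j
    using optimal_unique[OF opt]
  proof eventually_elim
    case (elim t)
    have "Q t = Phi t - Nt t ** It t"
      using elim by (simp add: Q_def g_def Phi_plus_circ diff_diff_eq[symmetric])
    moreover have "It t ** Mt t = mat 1" by (rule Minv_M) simp
    ultimately have "Q t ** Mt t = Bt t - Nt t"
      by (simp add: matrix_eq matrix_vector_mul_assoc[symmetric] matrix_vector_mult_diff_rdistrib Phi_def)
    then have "column j (Q t ** Mt t) = column j (Bt t) - column j (Nt t)" by (simp add: column_def vec_eq_iff)
    then show ?case by (simp add: column_matrix_vector Bt_column)
  qed
  have NL2: "(\<lambda>t. column j (Nt t)) \<in> L2fun" for j by (intro L2fun_column Nt_L2)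
  have QML2: "(\<lambda>t. Q t *v column j (Mt t)) \<in> L2fun" for j
  proof -
    have "(\<lambda>t. (Q t ** Mt t) $ i $ j) \<in> L2fun" for i
      by (rule L2fun_matrix_mult_bounded[OF QL2 Mt_circ(1,2)])
    then show ?thesis unfolding column_matrix_vector[symmetric] by (simp add: L2fun_vec_iff column_def)
  qed
  \<comment> \<open>The coefficient of \<open>Q M\<close> at \<open>n\<close> is that of
    \<open>- N\<close>, since \<open>B\<close> is co-analytic. The terms with \<open>k > n\<close>
    involve only negative coefficients of \<open>Q\<close>, that is of \<open>G\<close>, and already
    sum to this value; so the terms with \<open>k \<le> n\<close> sum to 0.\<close>
  have conv: "((\<lambda>k. fcoefm Q (int n - k) *v (if k \<le> int n then kvec (axis j 1) k else 0)) has_sum 0) UNIV" for n j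
  proof -
    let ?k = "kvec (axis j 1)"
    have kneg: "?k m = 0" if "m < 0" for m using kvec_H2[of "axis j 1"] that by (simp add: H2seq_def)
    \<comment> \<open>By \<open>Ws_Zs_funpow_bvec\<close> this is the backward shift of
      \<open>kvec (axis j 1)\<close> by \<open>n + 1\<close> places, and \<open>H w (- 1)\<close> is
      minus the column of the Taylor coefficient of \<open>N\<close> at \<open>n\<close>.\<close>
    define w where "w = Ws ((Zs ^^ n) (bvec (axis j 1)))"
    have wX: "w \<in> H2seq" unfolding w_def by (intro Ws_H2 seqs.lin_on_funpow[OF Zs_lin] bvec_X)
    have wk: "w m = (if m < 0 then 0 else ?k (m + int n + 1))" for m
    proof (cases "m < 0")
      case True
      then show ?thesis using wX by (simp add: H2seq_def)
    next
      case False
      then show ?thesis unfolding w_def Ws_Zs_funpow_bvec by (subst Sst_funpow) (auto simp: algebra_simps)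
    qed
    have "((\<lambda>m. fcoefm G (- 1 - m) *v w m) has_sum H w (- 1)) UNIV"
      by (rule hankel_convolution[OF Linf H2seq_l2[OF wX]]) simp
    then have "((\<lambda>k. fcoefm G (- 1 - (k - (int n + 1))) *v w (k - (int n + 1))) has_sum H w (- 1)) UNIV"
      by (subst has_sum_reindex_bij_betw[of "\<lambda>k. k - (int n + 1)" UNIV UNIV])
         (auto intro: bij_betwI[where g="\<lambda>k. k + (int n + 1)"])
    moreover have "fcoefm G (- 1 - (k - (int n + 1))) *v w (k - (int n + 1))
        = fcoefm G (int n - k) *v (if k > int n then ?k k else 0)" for k
      unfolding wk by (auto simp: algebra_simps)
    ultimately have hG: "((\<lambda>k. fcoefm G (int n - k) *v (if k > int n then ?k k else 0)) has_sum H w (- 1)) UNIV"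
      by simp
    have "fcoefv (\<lambda>t. Q t *v column j (Mt t)) (int n) = (fcoefv (Bcol j) - fcoefv (\<lambda>t. column j (Nt t))) (int n)"
      unfolding fcoefv_cong_AE[OF QM QML2 L2fun_diff[OF Bcol(1) NL2]] fcoefv_diff[OF Bcol(1) NL2] ..
    also have "\<dots> = H w (- 1)"
    proof -
      have "fcoefv (Bcol j) (int n) = 0" using X_K2[OF H_X[OF kvec_H2]] by (simp add: Bcol(2) K2seq_def)
      moreover have "fcoefv (\<lambda>t. column j (Nt t)) (int n) = - H w (- 1)"
        by (simp add: vec_eq_iff fcoefv_comp column_def Nt_circ(3) nseq_def w_def)
      ultimately show ?thesis by simp
    qed
    finally have hQ: "((\<lambda>k. fcoefm Q (int n - k) *v ?k k) has_sum H w (- 1)) UNIV"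
      using fcoefv_mult[OF QL2 Mt_column(1)[of j], of "int n"] by (simp add: Mt_column(2))
    have "fcoefm Q (int n - k) *v ?k k - fcoefm G (int n - k) *v (if k > int n then ?k k else 0)
        = fcoefm Q (int n - k) *v (if k \<le> int n then ?k k else 0)" for k
      using gn[of "int n - k"] by (auto simp: Qc)
    then show ?thesis using has_sum_diff[OF hQ hG] by simp
  qed
  \<comment> \<open>The convolution is triangular with leading coefficient \<open>M(0) = I\<close>.
    By induction only the term \<open>k = 0\<close> survives, and it is the \<open>j\<close>-th
    column of the coefficient of \<open>Q\<close> at \<open>n\<close>.\<close>
  have Q0: "fcoefm Q (int n) = 0" for n
  proof (induction n rule: less_induct)
    case (less n)
    have "fcoefm Q (int n) *v axis j 1 = 0" for j
    proof -
      have "fcoefm Q (int n - k) *v (if k \<le> int n then kvec (axis j 1) k else 0) = 0" if "k \<noteq> 0" for k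
      proof -
        consider "k < 0" | "k > int n" | "0 < k" "k \<le> int n" using \<open>k \<noteq> 0\<close> by linarith
        then show ?thesis
        proof cases
          case 1
          then show ?thesis using kvec_H2[of "axis j 1"] by (simp add: H2seq_def)
        next
          case 2
          then show ?thesis by simp
        next
          case 3
          then have "fcoefm Q (int (nat (int n - k))) = 0" by (intro less.IH) auto
          then show ?thesis using 3 by simp
        qed
      qed
      then have "infsum (\<lambda>k. fcoefm Q (int n - k) *v (if k \<le> int n then kvec (axis j 1) k else 0)) UNIV
         = fcoefm Q (int n - 0) *v (if 0 \<le> int n then kvec (axis j 1) 0 else 0)"
        by (rule infsum_single)
      then show ?thesis using infsumI[OF conv[of n j]] by (simp add: kvec(2))
    qed
    then have "column j (fcoefm Q (int n)) $ i = 0" for i j by (simp add: matrix_vector_axis)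
    then have "fcoefm Q (int n) $ i $ j = 0" for i j by (simp add: column_def)
    then show ?case by (simp add: vec_eq_iff)
  qed
  have "fcoefm g n = (if n \<ge> 0 then fcoefm G n else 0)" for n
    using Q0[of "nat n"] gn[of n] Qc[of n] by auto
  then show ?thesis
    using gL2 by (simp add: is_analytic_part_def g_def[abs_def] L2fun_mat_iff)
qed

lemma Phi_plus_bounded: "bounded (Phi_plus G ` ball 0 1)"
proof -
  have "\<forall>i j. \<exists>C. \<forall>z\<in>cball 0 1. cmod (Phi_plus G z $ i $ j) \<le> C"
    using ratfun_bounded[OF Phi_plus_ratfun] by blast
  then obtain C where C: "\<And>i j z. z \<in> cball 0 1 \<Longrightarrow> cmod (Phi_plus G z $ i $ j) \<le> C i j" by metis
  have "norm (Phi_plus G z) \<le> (\<Sum>i\<in>UNIV. \<Sum>j\<in>UNIV. C i j)" if "z \<in> ball 0 1" for z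
  proof -
    have "norm (Phi_plus G z) \<le> (\<Sum>i\<in>UNIV. norm (Phi_plus G z $ i))"
      unfolding norm_vec_def[of "Phi_plus G z"] by (rule L2_set_le_sum) simp
    also have "\<dots> \<le> (\<Sum>i\<in>UNIV. \<Sum>j\<in>UNIV. cmod (Phi_plus G z $ i $ j))"
      unfolding norm_vec_def[of "Phi_plus G z $ _"] by (intro sum_mono L2_set_le_sum) simp
    also have "\<dots> \<le> (\<Sum>i\<in>UNIV. \<Sum>j\<in>UNIV. C i j)"
      using that by (intro sum_mono C) simp
    finally show ?thesis .
  qed
  then show ?thesis by (intro boundedI[where B="\<Sum>i\<in>UNIV. \<Sum>j\<in>UNIV. C i j"]) auto
qed

end

theorem theorem5p1:
  fixes G :: "real \<Rightarrow> complex^'p^'q"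
  assumes Linf: "G \<in> Linf_fun"
    and C1: "finite_rank H2seq (hankel G)"
    and C2a: "maximizing_vectors G \<inter> shiftS ` H2seq = {}"
    and C2b: "vector_space.dim cscale (maximizing_vectors G) = CARD('p)"
  shows "bij_betw (Delta G) (Xsp G) (Xsp G)
    \<and> (\<exists>F. nehari_optimal G F)
    \<and> (\<forall>F F'. nehari_optimal G F \<and> nehari_optimal G F' \<longrightarrow> (AE t in circ. F t = F' t))
    \<and> (\<forall>F. nehari_optimal G F \<longrightarrow> is_analytic_part G (\<lambda>t. F t + Phi_plus G (cis t)))
    \<and> (\<forall>i j. (\<lambda>z. Phi_plus G z $ i $ j) holomorphic_on ball 0 1)
    \<and> bounded (Phi_plus G ` ball 0 1)
    \<and> (\<forall>i j. \<exists>a b :: complex poly. \<forall>z\<in>cball 0 1.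
           poly b z \<noteq> 0 \<and> Phi_plus G z $ i $ j = poly a z / poly b z)
    \<and> spec_radius (Xsp G) (Top G) < 1
    \<and> (\<forall>z. cmod z \<le> 1 \<longrightarrow>
          invertible (Mmat G z) \<and> matrix_inv (Mmat G z) = Minv_formula G z)"
proof -
  interpret nehari_data G
    using assms by unfold_locales
  have unique: "AE t in circ. F t = F' t" if "nehari_optimal G F" "nehari_optimal G F'" for F F'
    using optimal_unique[OF that(1)] optimal_unique[OF that(2)]
    by eventually_elim (metis diff_diff_eq2 add_diff_cancel_left' diff_add_cancel)
  show ?thesis
    using Delta_bij optimal_G_minus_Phi unique analytic_part ratfun_holomorphic[OF Phi_plus_ratfun]
      Phi_plus_bounded Phi_plus_ratfun[unfolded ratfun_def] spec_radius_Top Mmat_inv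
    by blast
qed

end
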